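(* Let $T\in(0,\infty]$ be fixed, let $\Delta=(0,T]$ if $T<\infty$ and $\Delta=(0,\infty)$ if $T=\infty$. Let $\{X,X_k,k\ge 1\}$ be a sequence of i.i.d. real-valued random variables with common distribution $F$ and finite mean $\mu=EX$. Let $\{N(t),t\ge 0\}$ be a counting process, independent of $\{X,X_k,k\ge1\}$, with finite mean function $\lambda(t)=EN(t)$ such that $\lambda(t)\to\infty$ as $t\to\infty$. Put $F_\Delta(x)=F(x+\Delta)$ and $S_{N(t)}=\sum_{k=1}^{N(t)}X_k$ (with $\sum_{k=1}^{0}X_k=0$). Assume that $F_\Delta$ is almost decreasing and that $E(X^+)^r<\infty$ for some $r>1$, where $X^+=X\,I(X\ge 0)$. Suppose furthermore that one of the following two conditions holds: (i) $\mu\ge 0$ and there is some $p>|\beta(F_\Delta)|$ such that for all $\delta>0$ $$E\big[N^p(t)\,I(N(t)>(1+\delta)\lambda(t))\big]=O(\lambda(t)),\qquad t\to\infty;$$ (ii) $\mu<0$ and for all $0<\delta<1$ $$P\big(N(t)\le(1-\delta)\lambda(t)\big)=o\big(\lambda(t)F(\lambda(t)+\Delta)\big),\qquad t\to\infty.$$ If $F_\Delta\in\mathcal{OR}$, then for every fixed $\gamma>0$ the relation $$l_{F_\Delta}^2\,\lambda(t)F(x+\mu+\Delta)\ \lesssim\ P\big(S_{N(t)}-\mu\lambda(t)\in x+\Delta\big)\ \lesssim\ L_{F_\Delta}^2\,\lambda(t)F(x+\mu+\Delta)$$ holds uniformly for all $x\ge\gamma\lambda(t)$ as $t\to\infty$.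 In particular, if $F_\Delta\in\mathcal{IR}$, then for every fixed $\gamma>0$ the relation $$P\big(S_{N(t)}-\mu\lambda(t)\in x+\Delta\big)\sim\lambda(t)F(x+\mu+\Delta)$$ holds uniformly for all $x\ge\gamma\lambda(t)$ as $t\to\infty$.
   Context: Notation. $x+\Delta=\{x+y:y\in\Delta\}$, and $F(x+\Delta)=P(X\in x+\Delta)$, i.e. $F((x,x+T])$ if $T<\infty$ and $F((x,\infty))$ if $T=\infty$. $I(A)$ is the indicator of $A$. A function $f$ is eventually positive if $f(x)>0$ for all sufficiently large $x$. For an eventually positive function $f$: - $f\in\mathcal{OR}$ ($\mathcal{O}$-regularly varying) if $0<\liminf_{x\to\infty}\frac{f(xy)}{f(x)}\le\limsup_{x\to\infty}\frac{f(xy)}{f(x)}<\infty$ for each fixed $y\ge 1$. - $f\in\mathcal{IR}$ (intermediate regularly varying) if $\lim_{y\downarrow1}\liminf_{x\to\infty}\frac{f(xy)}{f(x)}=\lim_{y\downarrow1}\limsup_{x\to\infty}\frac{f(xy)}{f(x)}=1$. - $f$ is almost decreasing if $\limsup_{x\to\infty}\frac{\sup_{u\ge x}f(u)}{f(x)}<\infty$. - The lower Matuszewska index is $\beta(f)=\lim_{y\to\infty}\frac{\log\left(\liminf_{x\to\infty}f(xy)/f(x)\right)}{\log y}$. - $l_f=\lim_{\epsilon\downarrow0}\liminf_{x\to\infty}\frac{\inf_{(1-\epsilon)x\le z\le(1+\epsilon)x}f(z)}{f(x)}$ and $L_f=\lim_{\epsilon\downarrow0}\limsup_{x\to\infty}\frac{\sup_{(1-\epsilon)x\le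 z\le(1+\epsilon)x}f(z)}{f(x)}$. Uniform asymptotics: for nonnegative $a(t,x),b(t,x)$ and nonempty $x$-regions $\mathcal{D}_t$, "$a(t,x)\lesssim b(t,x)$ holds uniformly for all $x\in\mathcal{D}_t$ as $t\to\infty$" means $\limsup_{t\to\infty}\sup_{x\in\mathcal{D}_t}\frac{a(t,x)}{b(t,x)}\le1$; "$a(t,x)\sim b(t,x)$ uniformly" means that both $a\lesssim b$ and $b\lesssim a$ hold uniformly. *)

theory Defs
  imports "HOL-Probability.Probability" "HOL-Library.Landau_Symbols"
begin

section \<open>Classes of eventually positive functions\<close>

text \<open>
  Limits inferior and superior, suprema and infima are taken in \<^typ>\<open>ereal\<close>, so that
  the value infinity is genuine. Division in \<^typ>\<open>ereal\<close> satisfies \<open>a / 0 = \<infinity>\<close> for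
  \<open>a > 0\<close>, and \<open>0 / 0 = 0\<close>.
\<close>

definition eventually_positive :: "(real \<Rightarrow> real) \<Rightarrow> bool" where
  "eventually_positive f \<longleftrightarrow> (\<forall>\<^sub>F x in at_top. f x > 0)"

definition ratio_liminf :: "(real \<Rightarrow> real) \<Rightarrow> real \<Rightarrow> ereal" where
  "ratio_liminf f y = Liminf at_top (\<lambda>x. ereal (f (x * y)) / ereal (f x))"

definition ratio_limsup :: "(real \<Rightarrow> real) \<Rightarrow> real \<Rightarrow> ereal" where
  "ratio_limsup f y = Limsup at_top (\<lambda>x. ereal (f (x * y)) / ereal (f x))"

definition O_regularly_varying :: "(real \<Rightarrow> real) \<Rightarrow> bool" where
  "O_regularly_varying f \<longleftrightarrow> eventually_positive f \<and>
     (\<forall>y\<ge>1. 0 < ratio_liminf f y \<and> ratio_liminf f y \<le> ratio_limsup f y \<and> ratio_limsup f y < \<infinity>)"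

definition intermediate_regularly_varying :: "(real \<Rightarrow> real) \<Rightarrow> bool" where
  "intermediate_regularly_varying f \<longleftrightarrow> eventually_positive f \<and>
     (ratio_liminf f \<longlongrightarrow> 1) (at_right 1) \<and> (ratio_limsup f \<longlongrightarrow> 1) (at_right 1)"

definition almost_decreasing :: "(real \<Rightarrow> real) \<Rightarrow> bool" where
  "almost_decreasing f \<longleftrightarrow> eventually_positive f \<and>
     Limsup at_top (\<lambda>x. (SUP u\<in>{x..}. ereal (f u)) / ereal (f x)) < \<infinity>"

text \<open>Extended logarithm with \<open>log 0 = -\<infinity>\<close> and \<open>log \<infinity> = \<infinity>\<close>.\<close>

definition ln_ereal :: "ereal \<Rightarrow> ereal" where
  "ln_ereal z = (if z \<le> 0 then -\<infinity> else if z = \<infinity> then \<infinity> else ereal (ln (real_of_ereal z)))"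

definition lower_Matuszewska_index :: "(real \<Rightarrow> real) \<Rightarrow> ereal" where
  "lower_Matuszewska_index f = Lim at_top (\<lambda>y. ln_ereal (ratio_liminf f y) / ereal (ln y))"

definition l_index :: "(real \<Rightarrow> real) \<Rightarrow> ereal" where
  "l_index f = Lim (at_right 0) (\<lambda>\<epsilon>.
     Liminf at_top (\<lambda>x. (INF z\<in>{(1 - \<epsilon>) * x..(1 + \<epsilon>) * x}. ereal (f z)) / ereal (f x)))"

definition L_index :: "(real \<Rightarrow> real) \<Rightarrow> ereal" where
  "L_index f = Lim (at_right 0) (\<lambda>\<epsilon>.
     Limsup at_top (\<lambda>x. (SUP z\<in>{(1 - \<epsilon>) * x..(1 + \<epsilon>) * x}. ereal (f z)) / ereal (f x)))"


section \<open>Uniform asymptotics\<close>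

definition unif_lesssim ::
  "(real \<Rightarrow> real set) \<Rightarrow> (real \<Rightarrow> real \<Rightarrow> ereal) \<Rightarrow> (real \<Rightarrow> real \<Rightarrow> ereal) \<Rightarrow> bool" where
  "unif_lesssim D a b \<longleftrightarrow> Limsup at_top (\<lambda>t. SUP x\<in>D t. a t x / b t x) \<le> 1"

definition unif_sim ::
  "(real \<Rightarrow> real set) \<Rightarrow> (real \<Rightarrow> real \<Rightarrow> ereal) \<Rightarrow> (real \<Rightarrow> real \<Rightarrow> ereal) \<Rightarrow> bool" where
  "unif_sim D a b \<longleftrightarrow> unif_lesssim D a b \<and> unif_lesssim D b a"


section \<open>Local probabilities and counting processes\<close>

text \<open>The interval \<open>\<Delta>\<close>: \<open>(0, T]\<close> for finite \<open>T\<close>, and \<open>(0, \<infinity>)\<close> for \<open>T = \<infinity>\<close>.\<close>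

definition Delta :: "ereal \<Rightarrow> real set" where
  "Delta T = {y. 0 < y \<and> ereal y \<le> T}"

definition translate :: "real \<Rightarrow> real set \<Rightarrow> real set" where
  "translate x A = {x + y | y. y \<in> A}"

definition F_Delta :: "real measure \<Rightarrow> ereal \<Rightarrow> real \<Rightarrow> real" where
  "F_Delta F T x = measure F (translate x (Delta T))"

text \<open>
  Only nondecreasing, natural-number valued paths are required; neither \<open>N(0) = 0\<close> nor
  right continuity is imposed.
\<close>

definition counting_process :: "'a measure \<Rightarrow> (real \<Rightarrow> 'a \<Rightarrow> nat) \<Rightarrow> bool" where
  "counting_process M N \<longleftrightarrow>
     (\<forall>t\<ge>0. N t \<in> measurable M (count_space UNIV)) \<and>
     (AE \<omega> in M. \<forall>s t. 0 \<le> s \<and> s \<le> t \<longrightarrow> N s \<omega> \<le> N t \<omega>)"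

definition iid :: "'a measure \<Rightarrow> (nat \<Rightarrow> 'a \<Rightarrow> real) \<Rightarrow> real measure \<Rightarrow> bool" where
  "iid M X F \<longleftrightarrow> prob_space.indep_vars M (\<lambda>_. borel) X UNIV \<and> (\<forall>k. distr M borel (X k) = F)"

definition generated_sigma ::
  "'a measure \<Rightarrow> 'b measure \<Rightarrow> 'i set \<Rightarrow> ('i \<Rightarrow> 'a \<Rightarrow> 'b) \<Rightarrow> 'a set set" where
  "generated_sigma M M' I Y =
     sigma_sets (space M) (\<Union>i\<in>I. {Y i -` A \<inter> space M | A. A \<in> sets M'})"

text \<open>
  \<^const>\<open>prob_space.indep_var\<close> does not apply to the families below, since it requires both
  random elements to have the same value type.
\<close>

definition independent_processes ::
  "'a measure \<Rightarrow> (nat \<Rightarrow> 'a \<Rightarrow> real) \<Rightarrow> (real \<Rightarrow> 'a \<Rightarrow> nat) \<Rightarrow> bool" where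
  "independent_processes M X N \<longleftrightarrow>
     prob_space.indep_set M (generated_sigma M borel UNIV X)
       (generated_sigma M (count_space UNIV) {0..} N)"

definition random_sum :: "(nat \<Rightarrow> 'a \<Rightarrow> real) \<Rightarrow> (real \<Rightarrow> 'a \<Rightarrow> nat) \<Rightarrow> real \<Rightarrow> 'a \<Rightarrow> real" where
  "random_sum X N t \<omega> = (\<Sum>k = 1..N t \<omega>. X k \<omega>)"

end

theory Submission
  imports Defs "HOL-Real_Asymp.Real_Asymp"
begin

text \<open>
  The theorem is an instance of the principle of one big jump. Write \<open>f\<close> for \<open>F_Delta F T\<close>. Being
  almost decreasing and O-regularly varying, \<open>f\<close> satisfies \<open>f u = O(f x)\<close> for \<open>u \<ge> a x\<close> and
  has a polynomial lower bound. Let \<open>z \<ge> c n\<close> and split the event that \<open>S\<^sub>n\<close> lies in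
  \<open>z + n \<mu> + \<Delta>\<close> according to whether some summand exceeds \<open>\<theta> z\<close>. If none does, a Chernoff bound
  with parameter \<open>M log z / z\<close> for the truncated summands yields an arbitrarily large negative
  power of \<open>z\<close>, which is negligible against \<open>f z\<close>; only here the moment of order \<open>r > 1\<close> is needed,
  and the local event may be replaced by a tail event. If \<open>X\<^sub>k\<close> is large, condition on the other
  summands: by the weak law, the jump has to hit a translate of \<open>\<Delta>\<close> by a point close to \<open>z\<close>, and
  each such translate has probability between \<open>l f z\<close> and \<open>L f z\<close> asymptotically.

  Both alternatives of the theorem imply \<open>E |N(t) - \<lambda>(t)| = o(\<lambda>(t))\<close>. Indices close to \<open>\<lambda>(t)\<close> give the
  main term; replacing \<open>z = x + \<mu> (\<lambda>(t) - n)\<close> by \<open>x + \<mu>\<close> costs a second factor \<open>l\<close> or \<open>L\<close>. All other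
  indices contribute \<open>O(f (x + \<mu>) E[N(t); |N(t) - \<lambda>(t)| > \<delta> \<lambda>(t)])\<close>, except for those for which \<open>z\<close>
  is not of larger order than \<open>n\<close> or \<open>x\<close>. There the moment of order \<open>p > |\<beta>(f)|\<close> is used when
  \<open>\<mu> \<ge> 0\<close>, and the assumption on the lower tail of \<open>N(t)\<close> when \<open>\<mu> < 0\<close>.
\<close>

section \<open>Regular variation\<close>

text \<open>Every estimate for a fixed number of terms is proved for arbitrary finite index sets
  \<open>I\<close> with \<open>c * card I \<le> z\<close> and a threshold on \<open>z\<close> alone.
  This uniformity is what allows averaging over \<open>N t\<close>, and general index sets survive
  the deletion of the jumping summand. The negative part of a summand has a first moment only, so
  quadratic remainders are not integrable; a cut at a level \<open>K\<close> beyond which the mean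
  excess is at most \<open>e\<close> replaces them, both in the weak law and in the Chernoff bound.
  Concentration of \<open>N t\<close> in mean needs just one tail, since the parts above and below
  the mean have equal expectation: alternative (i) controls the upper part, where
  \<open>p > 1\<close> because f is \<open>O(x powr (-r))\<close> and hence
  \<open>p > s \<ge> r\<close>, and alternative (ii) the lower part. Finally, intermediate regular
  variation speaks of one ratio at a time, whereas the indices take suprema and infima over whole
  intervals; measurability of f bridges the gap.\<close>

lemma almost_decreasingE:
  assumes "almost_decreasing f"
  obtains C x0 :: real where "C \<ge> 1" "x0 > 0" "\<And>x. x \<ge> x0 \<Longrightarrow> f x > 0"
    "\<And>x u. x \<ge> x0 \<Longrightarrow> u \<ge> x \<Longrightarrow> f u \<le> C * f x"
proof -
  let ?g = "\<lambda>x. (SUP u\<in>{x..}. ereal (f u)) / ereal (f x)"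
  from assms have pos: "\<forall>\<^sub>F x in at_top. f x > 0" and "Limsup at_top ?g \<noteq> \<infinity>"
    unfolding almost_decreasing_def eventually_positive_def by auto
  then obtain n :: nat where "Limsup at_top ?g < ereal (real n)"
    using less_PInf_Ex_of_nat by blast
  then have "\<forall>\<^sub>F x in at_top. ?g x < ereal (real n)" by (rule Limsup_lessD)
  with pos have "\<forall>\<^sub>F x in at_top. f x > 0 \<and> ?g x < ereal (real n)"
    by eventually_elim auto
  then obtain x0 where x0: "\<And>x. x \<ge> x0 \<Longrightarrow> f x > 0 \<and> ?g x < ereal (real n)"
    unfolding eventually_at_top_linorder by blast
  show ?thesis
  proof (rule that[of "max 1 (real n)" "max 1 x0"])
    fix x u assume x: "max 1 x0 \<le> x" and u: "x \<le> u"
    have fx: "f x > 0" "?g x < ereal (real n)" using x0 x by auto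
    have "ereal (f u / f x) = ereal (f u) / ereal (f x)" using fx by simp
    also have "\<dots> \<le> ?g x"
      using u fx by (intro ereal_divide_right_mono SUP_upper) auto
    also have "\<dots> < ereal (real n)" by fact
    finally have "f u / f x < real n" by simp
    then have "f u \<le> real n * f x" using fx by (simp add: field_simps)
    also have "\<dots> \<le> max 1 (real n) * f x" using fx by (intro mult_right_mono) auto
    finally show "f u \<le> max 1 (real n) * f x" .
  qed (use x0 in auto)
qed

lemma ratio_liminf_lessD:
  assumes "eventually_positive f" "ereal c < ratio_liminf f y"
  shows "\<forall>\<^sub>F x in at_top. c * f x < f (x * y)"
proof -
  have "\<forall>\<^sub>F x in at_top. ereal c < ereal (f (x * y)) / ereal (f x)"
    using assms(2) unfolding ratio_liminf_def by (rule less_LiminfD)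
  with assms(1)[unfolded eventually_positive_def] show ?thesis
    by eventually_elim (auto simp: field_simps)
qed

lemma ratio_limsup_lessD:
  assumes "eventually_positive f" "ratio_limsup f y < ereal c"
  shows "\<forall>\<^sub>F x in at_top. f (x * y) < c * f x"
proof -
  have "\<forall>\<^sub>F x in at_top. ereal (f (x * y)) / ereal (f x) < ereal c"
    using assms(2) unfolding ratio_limsup_def by (rule Limsup_lessD)
  with assms(1)[unfolded eventually_positive_def] show ?thesis
    by eventually_elim (auto simp: field_simps)
qed

lemma ratio_liminf_ge:
  assumes "eventually_positive f" "\<forall>\<^sub>F x in at_top. c * f x \<le> f (x * y)"
  shows "ereal c \<le> ratio_liminf f y"
  unfolding ratio_liminf_def
  by (rule Liminf_bounded)
     (use assms[unfolded eventually_positive_def] in \<open>eventually_elim; auto simp: field_simps\<close>)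

lemma ratio_limsup_le:
  assumes "eventually_positive f" "\<forall>\<^sub>F x in at_top. f (x * y) \<le> c * f x"
  shows "ratio_limsup f y \<le> ereal c"
  unfolding ratio_limsup_def
  by (rule Limsup_bounded)
     (use assms[unfolded eventually_positive_def] in \<open>eventually_elim; auto simp: field_simps\<close>)

lemma filterlim_mult_at_top:
  assumes "0 < (y::real)"
  shows "filterlim (\<lambda>x. x * y) at_top at_top"
  using filterlim_tendsto_pos_mult_at_top[OF tendsto_const assms filterlim_ident]
  by (simp add: mult.commute)

lemma power_bracket:
  fixes y u :: real
  assumes y: "1 < y" and u: "1 \<le> u"
  obtains n where "y ^ n \<le> u" "u < y ^ Suc n"
proof -
  define k where "k = (LEAST k. u < y ^ k)"
  have k: "u < y ^ k" unfolding k_def using real_arch_pow[OF y] by (rule LeastI_ex)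
  then obtain n where n: "k = Suc n" using u by (cases k) auto
  have "\<not> u < y ^ n" using not_less_Least[of n "\<lambda>k. u < y ^ k"] n by (simp add: k_def)
  with k n show ?thesis by (intro that[of n]) auto
qed

lemma almost_decreasing_positive: "almost_decreasing f \<Longrightarrow> eventually_positive f"
  by (simp add: almost_decreasing_def)

text \<open>Almost decrease compares only points \<open>u \<ge> x\<close>. One lower ratio bound, at
  a factor \<open>y\<close> with \<open>a * y \<ge> 1\<close>, moves the starting point down to
  \<open>x / y \<le> a * x\<close>: then
  \<open>f u \<le> C0 * f (x / y) \<le> C0 / c * f x\<close>.\<close>

lemma O_regularly_varying_dominated:
  assumes "O_regularly_varying f" "almost_decreasing f" "a > 0"
  obtains C x1 :: real where "C > 0" "x1 > 0"
    "\<And>x u. x \<ge> x1 \<Longrightarrow> u \<ge> a * x \<Longrightarrow> f u \<le> C * f x"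
proof -
  obtain C0 x0 where C0: "C0 \<ge> 1" "x0 > 0" "\<And>x. x \<ge> x0 \<Longrightarrow> f x > 0"
    "\<And>x u. x \<ge> x0 \<Longrightarrow> u \<ge> x \<Longrightarrow> f u \<le> C0 * f x"
    using almost_decreasingE[OF assms(2)] by metis
  define y where "y = max 1 (1 / a)"
  have y: "y \<ge> 1" "a * y \<ge> 1" using assms(3) by (auto simp: y_def max_def field_simps)
  have "0 < ratio_liminf f y"
    using assms(1) y unfolding O_regularly_varying_def by auto
  then obtain c where c: "0 < ereal c" "ereal c < ratio_liminf f y"
    using ereal_dense2 by blast
  obtain x2 where x2: "\<And>x. x \<ge> x2 \<Longrightarrow> c * f x < f (x * y)"
    using ratio_liminf_lessD[OF almost_decreasing_positive[OF assms(2)] c(2)]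
    unfolding eventually_at_top_linorder by blast
  have c0: "c > 0" using c by simp
  show ?thesis
  proof (rule that[of "C0 / c" "max x0 x2 * y"])
    fix x u assume x: "max x0 x2 * y \<le> x" and u: "a * x \<le> u"
    have xy: "x / y \<ge> max x0 x2"
      by (subst pos_le_divide_eq) (use x y in auto)
    have "x / y \<le> a * x"
    proof -
      have "x \<ge> 0" using x C0 y
        by (meson max.cobounded1 mult_nonneg_nonneg order_trans less_imp_le zero_le_one)
      then have "x * 1 \<le> x * (a * y)" using y by (intro mult_left_mono) auto
      then show ?thesis using y by (simp add: field_simps)
    qed
    then have "f u \<le> C0 * f (x / y)" using C0(4)[of "x / y" u] xy u by auto
    moreover have "c * f (x / y) < f x" using x2[of "x / y"] xy y by auto
    then have "f (x / y) \<le> f x / c" using c0 by (simp add: field_simps)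
    then have "C0 * f (x / y) \<le> C0 * (f x / c)" using C0 by (intro mult_left_mono) auto
    ultimately show "f u \<le> C0 / c * f x" by simp
  qed (use C0 c0 y in \<open>auto intro!: mult_pos_pos simp: max_def\<close>)
qed

text \<open>Iteration of the step bounds \<open>f\<close> on the grid \<open>w * y ^ n\<close>, and
  almost decrease carries the bound from the grid point just above \<open>x\<close> back to
  \<open>x\<close>. Hence a single factor \<open>y\<close> suffices.\<close>

lemma power_lower_bound:
  assumes "almost_decreasing f" "y > 1" "s \<ge> 0"
    and step: "\<forall>\<^sub>F x in at_top. y powr (-s) * f x \<le> f (x * y)"
  obtains c x2 :: real where "c > 0" "x2 > 0" "\<And>x. x \<ge> x2 \<Longrightarrow> c * x powr (-s) \<le> f x"
proof -
  obtain C0 x0 where C0: "C0 \<ge> 1" "x0 > 0" "\<And>x. x \<ge> x0 \<Longrightarrow> f x > 0"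
    "\<And>x u. x \<ge> x0 \<Longrightarrow> u \<ge> x \<Longrightarrow> f u \<le> C0 * f x"
    using almost_decreasingE[OF assms(1)] by metis
  obtain x1 where x1: "\<And>x. x \<ge> x1 \<Longrightarrow> y powr (-s) * f x \<le> f (x * y)"
    using step unfolding eventually_at_top_linorder by blast
  define w where "w = max x0 x1"
  have w: "w > 0" "w \<ge> x0" "w \<ge> x1" using C0 by (auto simp: w_def)
  have pw: "(y powr (-s)) ^ n * f w \<le> f (w * y ^ n)" for n
  proof (induction n)
    case (Suc n)
    have "w * 1 \<le> w * y ^ n" using w assms(2) by (intro mult_left_mono) (auto simp: one_le_power)
    then have "w * y ^ n \<ge> x1" using w by linarith
    from x1[OF this] have "y powr (-s) * f (w * y ^ n) \<le> f (w * y ^ Suc n)"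
      by (simp add: mult_ac)
    moreover have "y powr (-s) * ((y powr (-s)) ^ n * f w) \<le> y powr (-s) * f (w * y ^ n)"
      using Suc by (intro mult_left_mono) auto
    ultimately show ?case by (simp add: mult_ac)
  qed simp
  show ?thesis
  \<comment> \<open>\<open>y powr (-s)\<close> pays for overshooting to the next grid point,
    \<open>w powr s\<close> for starting the grid at \<open>w\<close>, and \<open>C0\<close> for the
    return to \<open>x\<close>.\<close>
  proof (rule that[of "y powr (-s) * w powr s * f w / C0" w])
    show "0 < y powr (-s) * w powr s * f w / C0"
      using C0(1) C0(3)[of w] w assms(2) by auto
  next
    fix x assume x: "w \<le> x"
    have xw: "x / w \<ge> 1" using x w by simp
    obtain n where le: "y ^ n \<le> x / w" and lt: "x / w < y ^ Suc n"
      by (rule power_bracket[OF assms(2) xw])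
    have "x < w * y ^ Suc n" using lt w by (simp add: field_simps)
    then have "f (w * y ^ Suc n) \<le> C0 * f x" using C0(4)[of x "w * y ^ Suc n"] x w by auto
    with pw[of "Suc n"] have A: "(y powr (-s)) ^ Suc n * f w \<le> C0 * f x" by linarith
    have e1: "w powr s * x powr (-s) = (x / w) powr (-s)"
      using w x by (simp add: powr_divide powr_minus field_simps)
    have e2: "(y powr (-s)) ^ n = (y ^ n) powr (-s)"
      using assms(2) by (simp add: powr_realpow[symmetric] powr_powr mult.commute)
    have "(x / w) powr (-s) \<le> (y ^ n) powr (-s)"
      using le assms by (intro powr_mono2') auto
    then have "y powr (-s) * (w powr s * x powr (-s)) \<le> (y powr (-s)) ^ Suc n"
      unfolding e1 using e2 by (simp add: mult_left_mono)
    then have "y powr (-s) * (w powr s * x powr (-s)) * f w \<le> (y powr (-s)) ^ Suc n * f w"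
      using C0(3)[of w] w by (intro mult_right_mono) auto
    with A have "y powr (-s) * (w powr s * x powr (-s)) * f w \<le> C0 * f x" by linarith
    then show "y powr (-s) * w powr s * f w / C0 * x powr (-s) \<le> f x"
      using C0(1) by (simp add: field_simps)
  qed (use w in auto)
qed

section \<open>The oscillation indices l and L as monotone limits\<close>

lemma tendsto_at_right_0_INF:
  fixes g :: "real \<Rightarrow> ereal"
  assumes "\<And>a b. 0 < a \<Longrightarrow> a \<le> b \<Longrightarrow> g a \<le> g b"
  shows "(g \<longlongrightarrow> (INF \<epsilon>\<in>{0<..}. g \<epsilon>)) (at_right 0)"
proof (rule order_tendstoI)
  fix a assume a: "a < (INF \<epsilon>\<in>{0<..}. g \<epsilon>)"
  have "\<forall>\<^sub>F x::real in at_right 0. 0 < x" by (rule eventually_at_right_less)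
  then show "\<forall>\<^sub>F x in at_right 0. a < g x"
    by eventually_elim (use a in \<open>auto simp: less_le_trans[OF _ INF_lower]\<close>)
next
  fix a assume "(INF \<epsilon>\<in>{0<..}. g \<epsilon>) < a"
  then obtain b where b: "b > 0" "g b < a" by (auto simp: INF_less_iff)
  have "\<forall>\<^sub>F x::real in at_right 0. x \<in> {0<..<b}"
    using b by (intro eventually_at_rightI) auto
  then show "\<forall>\<^sub>F x in at_right 0. g x < a"
    by eventually_elim (use b(2) in \<open>auto intro!: le_less_trans[OF assms b(2)]\<close>)
qed

lemma tendsto_at_right_0_SUP:
  fixes g :: "real \<Rightarrow> ereal"
  assumes "\<And>a b. 0 < a \<Longrightarrow> a \<le> b \<Longrightarrow> g b \<le> g a"
  shows "(g \<longlongrightarrow> (SUP \<epsilon>\<in>{0<..}. g \<epsilon>)) (at_right 0)"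
proof -
  have "((\<lambda>x. - g x) \<longlongrightarrow> (INF \<epsilon>\<in>{0<..}. - g \<epsilon>)) (at_right 0)"
    by (rule tendsto_at_right_0_INF) (use assms in auto)
  then have "((\<lambda>x. - g x) \<longlongrightarrow> - (SUP \<epsilon>\<in>{0<..}. g \<epsilon>)) (at_right 0)"
    by (simp add: ereal_INF_uminus_eq)
  then have "((\<lambda>x. - (- g x)) \<longlongrightarrow> - (- (SUP \<epsilon>\<in>{0<..}. g \<epsilon>))) (at_right 0)"
    by (rule tendsto_uminus_ereal)
  then show ?thesis by simp
qed

lemma scaled_interval_mono:
  fixes x :: real
  assumes "0 \<le> x" "a \<le> b"
  shows "{(1 - a) * x..(1 + a) * x} \<subseteq> {(1 - b) * x..(1 + b) * x}"
proof -
  have "(1 - b) * x \<le> (1 - a) * x" "(1 + a) * x \<le> (1 + b) * x"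
    using assms by (auto intro!: mult_right_mono)
  then show ?thesis by auto
qed

abbreviation sup_ratio :: "(real \<Rightarrow> real) \<Rightarrow> real \<Rightarrow> real \<Rightarrow> ereal" where
  "sup_ratio f \<epsilon> x \<equiv> (SUP z\<in>{(1 - \<epsilon>) * x..(1 + \<epsilon>) * x}. ereal (f z)) / ereal (f x)"

abbreviation inf_ratio :: "(real \<Rightarrow> real) \<Rightarrow> real \<Rightarrow> real \<Rightarrow> ereal" where
  "inf_ratio f \<epsilon> x \<equiv> (INF z\<in>{(1 - \<epsilon>) * x..(1 + \<epsilon>) * x}. ereal (f z)) / ereal (f x)"

text \<open>\<open>Lim\<close> carries information only if the limit exists. It does here: for
  \<open>x \<ge> 0\<close> the interval grows with \<epsilon>, so the expression is increasing in
  \<epsilon> and its limit at 0 from the right is an infimum.\<close>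

lemma L_index_eq_INF:
  assumes "eventually_positive f"
  shows "L_index f = (INF \<epsilon>\<in>{0<..}. Limsup at_top (sup_ratio f \<epsilon>))"
  unfolding L_index_def
proof (rule tendsto_Lim[OF _ tendsto_at_right_0_INF])
  fix a b :: real assume ab: "0 < a" "a \<le> b"
  show "Limsup at_top (sup_ratio f a)
      \<le> Limsup at_top (sup_ratio f b)"
  proof (rule Limsup_mono)
    show "\<forall>\<^sub>F x in at_top. sup_ratio f a x
       \<le> sup_ratio f b x"
      using assms[unfolded eventually_positive_def] eventually_ge_at_top[of 0]
      by eventually_elim
         (intro ereal_divide_right_mono SUP_subset_mono scaled_interval_mono; use ab in auto)
  qed
qed simp

lemma l_index_eq_SUP:
  assumes "eventually_positive f"
  shows "l_index f = (SUP \<epsilon>\<in>{0<..}. Liminf at_top (inf_ratio f \<epsilon>))"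
  unfolding l_index_def
proof (rule tendsto_Lim[OF _ tendsto_at_right_0_SUP])
  fix a b :: real assume ab: "0 < a" "a \<le> b"
  show "Liminf at_top (inf_ratio f b)
      \<le> Liminf at_top (inf_ratio f a)"
  proof (rule Liminf_mono)
    show "\<forall>\<^sub>F x in at_top. inf_ratio f b x
       \<le> inf_ratio f a x"
      using assms[unfolded eventually_positive_def] eventually_ge_at_top[of 0]
      by eventually_elim
         (intro ereal_divide_right_mono INF_superset_mono scaled_interval_mono; use ab in auto)
  qed
qed simp

lemma L_index_le:
  assumes "eventually_positive f" "\<eta> > 0"
    and "\<forall>\<^sub>F x in at_top. \<forall>z\<in>{(1 - \<eta>) * x..(1 + \<eta>) * x}. f z \<le> K * f x"
  shows "L_index f \<le> ereal K"
proof -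
  have "L_index f \<le> Limsup at_top (sup_ratio f \<eta>)"
    unfolding L_index_eq_INF[OF assms(1)] by (intro INF_lower) (use assms in auto)
  also have "\<dots> \<le> ereal K"
  proof (rule Limsup_bounded)
    show "\<forall>\<^sub>F x in at_top. sup_ratio f \<eta> x \<le> ereal K"
      using assms(3) assms(1)[unfolded eventually_positive_def]
    proof eventually_elim
      case (elim x)
      have "(SUP z\<in>{(1 - \<eta>) * x..(1 + \<eta>) * x}. ereal (f z)) \<le> ereal (K * f x)"
        by (rule SUP_least) (use elim in auto)
      then have "sup_ratio f \<eta> x \<le> ereal (K * f x) / ereal (f x)"
        using elim by (intro ereal_divide_right_mono) auto
      then show ?case using elim by simp
    qed
  qed
  finally show ?thesis .
qed

lemma l_index_ge:
  assumes "eventually_positive f" "\<eta> > 0"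
    and "\<forall>\<^sub>F x in at_top. \<forall>z\<in>{(1 - \<eta>) * x..(1 + \<eta>) * x}. K * f x \<le> f z"
  shows "ereal K \<le> l_index f"
proof -
  have "ereal K \<le> Liminf at_top (inf_ratio f \<eta>)"
  proof (rule Liminf_bounded)
    show "\<forall>\<^sub>F x in at_top. ereal K \<le> inf_ratio f \<eta> x"
      using assms(3) assms(1)[unfolded eventually_positive_def]
    proof eventually_elim
      case (elim x)
      have "ereal (K * f x) \<le> (INF z\<in>{(1 - \<eta>) * x..(1 + \<eta>) * x}. ereal (f z))"
        by (rule INF_greatest) (use elim in auto)
      then have "ereal (K * f x) / ereal (f x) \<le> inf_ratio f \<eta> x"
        using elim by (intro ereal_divide_right_mono) auto
      then show ?case using elim by simp
    qed
  qed
  also have "\<dots> \<le> l_index f"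
    unfolding l_index_eq_SUP[OF assms(1)] by (intro SUP_upper) (use assms in auto)
  finally show ?thesis .
qed

lemma L_index_ge_1:
  assumes "eventually_positive f"
  shows "1 \<le> L_index f"
  unfolding L_index_eq_INF[OF assms]
proof (rule INF_greatest)
  fix \<epsilon> :: real assume e: "\<epsilon> \<in> {0<..}"
  show "1 \<le> Limsup at_top (sup_ratio f \<epsilon>)"
  proof (rule le_Limsup)
    show "\<forall>\<^sub>F x in at_top. 1 \<le> sup_ratio f \<epsilon> x"
      using assms[unfolded eventually_positive_def] eventually_ge_at_top[of 0]
    proof eventually_elim
      case (elim x)
      have "1 = ereal (f x) / ereal (f x)" using elim by (simp add: one_ereal_def)
      also have "\<dots> \<le> sup_ratio f \<epsilon> x"
        using elim e by (intro ereal_divide_right_mono SUP_upper) (auto simp: algebra_simps)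
      finally show ?case .
    qed
  qed simp
qed

lemma l_index_le_1:
  assumes "eventually_positive f"
  shows "l_index f \<le> 1"
  unfolding l_index_eq_SUP[OF assms]
proof (rule SUP_least)
  fix \<epsilon> :: real assume e: "\<epsilon> \<in> {0<..}"
  show "Liminf at_top (inf_ratio f \<epsilon>) \<le> 1"
  proof (rule Liminf_le)
    show "\<forall>\<^sub>F x in at_top. inf_ratio f \<epsilon> x \<le> 1"
      using assms[unfolded eventually_positive_def] eventually_ge_at_top[of 0]
    proof eventually_elim
      case (elim x)
      have "inf_ratio f \<epsilon> x \<le> ereal (f x) / ereal (f x)"
        using elim e by (intro ereal_divide_right_mono INF_lower) (auto simp: algebra_simps)
      also have "\<dots> = 1" using elim by (simp add: one_ereal_def)
      finally show ?case .
    qed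
  qed simp
qed

lemma L_index_lessD:
  assumes "eventually_positive f" "L_index f < ereal K"
  obtains \<eta> where "\<eta> > 0" "\<forall>\<^sub>F x in at_top. \<forall>z\<in>{(1 - \<eta>) * x..(1 + \<eta>) * x}. f z \<le> K * f x"
proof -
  obtain \<eta> where e: "\<eta> > 0"
    "Limsup at_top (sup_ratio f \<eta>) < ereal K"
    using assms(2) unfolding L_index_eq_INF[OF assms(1)] by (auto simp: INF_less_iff)
  have "\<forall>\<^sub>F x in at_top. \<forall>z\<in>{(1 - \<eta>) * x..(1 + \<eta>) * x}. f z \<le> K * f x"
    using assms(1)[unfolded eventually_positive_def] Limsup_lessD[OF e(2)]
  proof eventually_elim
    case (elim x)
    show ?case
    proof
      fix z assume z: "z \<in> {(1 - \<eta>) * x..(1 + \<eta>) * x}"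
      have "ereal (f z) / ereal (f x) \<le> sup_ratio f \<eta> x"
        using elim z by (intro ereal_divide_right_mono SUP_upper) auto
      also have "\<dots> < ereal K" by (rule elim)
      finally show "f z \<le> K * f x" using elim by (simp add: field_simps)
    qed
  qed
  with e(1) show ?thesis by (rule that)
qed

lemma l_index_greaterD:
  assumes "eventually_positive f" "ereal K < l_index f"
  obtains \<eta> where "\<eta> > 0" "\<forall>\<^sub>F x in at_top. \<forall>z\<in>{(1 - \<eta>) * x..(1 + \<eta>) * x}. K * f x \<le> f z"
proof -
  obtain \<eta> where e: "\<eta> > 0"
    "ereal K < Liminf at_top (inf_ratio f \<eta>)"
    using assms(2) unfolding l_index_eq_SUP[OF assms(1)] by (auto simp: less_SUP_iff)
  have "\<forall>\<^sub>F x in at_top. \<forall>z\<in>{(1 - \<eta>) * x..(1 + \<eta>) * x}. K * f x \<le> f z"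
    using assms(1)[unfolded eventually_positive_def] less_LiminfD[OF e(2)]
  proof eventually_elim
    case (elim x)
    show ?case
    proof
      fix z assume z: "z \<in> {(1 - \<eta>) * x..(1 + \<eta>) * x}"
      have "ereal K < inf_ratio f \<eta> x" by (rule elim)
      also have "\<dots> \<le> ereal (f z) / ereal (f x)"
        using elim z by (intro ereal_divide_right_mono INF_lower) auto
      finally show "K * f x \<le> f z" using elim by (simp add: field_simps)
    qed
  qed
  with e(1) show ?thesis by (rule that)
qed

section \<open>Polynomial lower bounds and the lower Matuszewska index\<close>

text \<open>The lower ratio limit \<open>\<rho>\<close> is supermultiplicative, so Fekete's argument
  shows that \<open>ln (\<rho> y) / ln y\<close> converges to its supremum, which is therefore the
  index. An exponent \<open>-s\<close> below the supremum is beaten at one single \<open>y\<close>,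
  and that is all \<open>power_lower_bound\<close> asks for.\<close>

lemma lower_Matuszewska_power_bound:
  assumes OR: "O_regularly_varying f" and AD: "almost_decreasing f"
    and p: "\<bar>lower_Matuszewska_index f\<bar> < ereal p"
  obtains s c x2 :: real where "0 \<le> s" "s < p" "c > 0" "x2 > 0" "\<And>x. x \<ge> x2 \<Longrightarrow> c * x powr (-s) \<le> f x"
proof -
  note ev = almost_decreasing_positive[OF AD]
  obtain C x0 where C: "C \<ge> 1" "x0 > 0" "\<And>x. x \<ge> x0 \<Longrightarrow> f x > 0"
    "\<And>x u. x \<ge> x0 \<Longrightarrow> u \<ge> x \<Longrightarrow> f u \<le> C * f x"
    using almost_decreasingE[OF AD] by metis
  define \<rho> where "\<rho> y = real_of_ereal (ratio_liminf f y)" for y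
  have R: "ratio_liminf f y = ereal (\<rho> y)" "0 < \<rho> y" "\<rho> y \<le> C" if y: "y \<ge> 1" for y
  proof -
    have *: "0 < ratio_liminf f y" "ratio_liminf f y \<le> ratio_limsup f y"
      using OR y unfolding O_regularly_varying_def by auto
    have "\<forall>\<^sub>F x in at_top. f (x * y) \<le> C * f x"
      using eventually_ge_at_top[of x0]
    proof eventually_elim
      case (elim x)
      have "x * 1 \<le> x * y" using y elim C by (intro mult_left_mono) auto
      then show ?case using C(4)[of x "x * y"] elim by simp
    qed
    from ratio_limsup_le[OF ev this] * have "ratio_liminf f y \<le> ereal C" by simp
    with * show "ratio_liminf f y = ereal (\<rho> y)" "0 < \<rho> y" "\<rho> y \<le> C"
      unfolding \<rho>_def by (cases "ratio_liminf f y"; auto)+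
  qed
  have \<rho>_less: "\<forall>\<^sub>F x in at_top. c * f x < f (x * y)" if "y \<ge> 1" "c < \<rho> y" for c y
    using ratio_liminf_lessD[OF ev, of c y] R(1)[OF that(1)] that by simp
  have \<rho>_ge: "c \<le> \<rho> y" if "y \<ge> 1" "\<forall>\<^sub>F x in at_top. c * f x \<le> f (x * y)" for c y
    using ratio_liminf_ge[OF ev that(2)] R(1)[OF that(1)] by simp
  \<comment> \<open>A lower limit yields inequalities only for constants strictly below it, so a
    factor \<open>k < 1\<close> is given away, split as \<open>sqrt k\<close> between the two
    ratios.\<close>
  have mult: "\<rho> y * \<rho> z \<le> \<rho> (y * z)" if y: "y \<ge> 1" and z: "z \<ge> 1" for y z
  proof (rule field_le_mult_one_interval)
    fix k :: real assume k: "0 < k" "k < 1"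
    define q where "q = sqrt k"
    have q: "0 < q" "q < 1" "q * q = k" using k by (auto simp: q_def)
    have "1 * 1 \<le> y * z" using y z by (intro mult_mono) auto
    then have yz: "y * z \<ge> 1" by simp
    have 1: "\<forall>\<^sub>F x in at_top. (q * \<rho> y) * f x < f (x * y)"
      using q R(2)[OF y] by (intro \<rho>_less y) auto
    have "\<forall>\<^sub>F x in at_top. (q * \<rho> z) * f x < f (x * z)"
      using q R(2)[OF z] by (intro \<rho>_less z) auto
    from eventually_compose_filterlim[OF this filterlim_mult_at_top[of y]] y
    have 2: "\<forall>\<^sub>F x in at_top. (q * \<rho> z) * f (x * y) < f (x * y * z)" by simp
    have "\<forall>\<^sub>F x in at_top. k * (\<rho> y * \<rho> z) * f x \<le> f (x * (y * z))"
      using 1 2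
    proof eventually_elim
      case (elim x)
      have "(q * \<rho> z) * ((q * \<rho> y) * f x) \<le> (q * \<rho> z) * f (x * y)"
        using elim q R(2)[OF z] by (intro mult_left_mono) auto
      also have "\<dots> \<le> f (x * (y * z))" using elim by (simp add: mult.assoc)
      finally have "(q * q) * (\<rho> y * \<rho> z) * f x \<le> f (x * (y * z))" by (simp add: mult_ac)
      then show ?case unfolding q(3) .
    qed
    then show "k * (\<rho> y * \<rho> z) \<le> \<rho> (y * z)" by (intro \<rho>_ge yz)
  qed
  have pow: "\<rho> y ^ n * \<rho> w \<le> \<rho> (y ^ n * w)" if y: "y \<ge> 1" "w \<ge> 1" for y w n
  proof (induction n)
    case (Suc n)
    have "1 * 1 \<le> y ^ n * w" using y by (intro mult_mono) (auto simp: one_le_power)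
    then have "\<rho> y * \<rho> (y ^ n * w) \<le> \<rho> (y * (y ^ n * w))" using y by (intro mult) auto
    moreover have "\<rho> y * (\<rho> y ^ n * \<rho> w) \<le> \<rho> y * \<rho> (y ^ n * w)"
      using Suc R(2)[OF y(1)] by (intro mult_left_mono) auto
    ultimately show ?case by (simp add: mult_ac)
  qed simp
  \<comment> \<open>A value above 1 would have powers exceeding the bound \<open>C\<close> on
    \<open>\<rho>\<close>.\<close>
  have le1: "\<rho> y \<le> 1" if y: "y \<ge> 1" for y
  proof (rule ccontr)
    assume "\<not> \<rho> y \<le> 1"
    then have *: "\<rho> y > 1" by simp
    from real_arch_pow[OF *, of "C / \<rho> 1"] obtain n where "C / \<rho> 1 < \<rho> y ^ n" by blast
    then have "C < \<rho> y ^ n * \<rho> 1" using R(2)[of 1] by (simp add: field_simps)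
    also have "\<dots> \<le> \<rho> (y ^ n * 1)" using y by (intro pow) auto
    also have "\<dots> \<le> C" using y by (intro R(3)) (auto simp: one_le_power)
    finally show False by simp
  qed
  \<comment> \<open>Fekete's argument needs a bound for the incomplete last factor \<open>w\<close>
    between 1 and \<open>A\<close>; almost decrease supplies it.\<close>
  have compact: "\<rho> A \<le> C * \<rho> w" if w: "1 \<le> w" "w \<le> A" for w A
  proof (rule dense_le)
    fix c assume c: "c < \<rho> A"
    have "\<forall>\<^sub>F x in at_top. c / C * f x \<le> f (x * w)"
      using \<rho>_less[OF order_trans[OF w] c] eventually_ge_at_top[of x0]
    proof eventually_elim
      case (elim x)
      have x: "x > 0" using elim C by linarith
      have "x * 1 \<le> x * w" "x * w \<le> x * A" using w x by (auto intro!: mult_left_mono)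
      then have "f (x * A) \<le> C * f (x * w)" using elim by (intro C(4)) auto
      then have "c * f x \<le> C * f (x * w)" using elim w by auto
      then show ?case using C(1) by (simp add: field_simps)
    qed
    then have "c / C \<le> \<rho> w" by (intro \<rho>_ge w)
    then show "c \<le> C * \<rho> w" using C(1) by (simp add: field_simps)
  qed
  define e where "e y = ln (\<rho> y) / ln y" for y
  have e0: "e y \<le> 0" if "y > 1" for y
    using le1[of y] R(2)[of y] that unfolding e_def by (auto simp: divide_le_0_iff)
  define B where "B = (SUP y\<in>{1<..}. e y)"
  have bdd: "bdd_above (e ` {1<..})" using e0 by (auto intro!: bdd_aboveI[of _ 0])
  have upper: "e y \<le> B" if "y > 1" for y
    unfolding B_def using that by (intro cSUP_upper bdd) auto
  have "(e \<longlongrightarrow> B) at_top"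
  proof (rule order_tendstoI)
    fix a assume a: "B < a"
    show "\<forall>\<^sub>F x in at_top. e x < a"
      by (rule eventually_mono[OF eventually_gt_at_top[of 1]]) (rule le_less_trans[OF upper a])
  next
    fix a assume "a < B"
    then obtain A where A: "A > 1" "a < e A"
      unfolding B_def using less_cSUP_iff[OF _ bdd, of a] by auto
    define K where "K = ln (\<rho> A / C)"
    have "((\<lambda>y. e A + K / ln y) \<longlongrightarrow> e A + 0) at_top"
      by (intro tendsto_add tendsto_const tendsto_divide_0[OF tendsto_const]
          filterlim_at_top_imp_at_infinity ln_at_top)
    then have "\<forall>\<^sub>F y in at_top. a < e A + K / ln y"
      using A by (intro order_tendstoD(1)) auto
    then show "\<forall>\<^sub>F y in at_top. a < e y"
      using eventually_gt_at_top[of 1]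
    proof eventually_elim
      case (elim y)
      \<comment> \<open>Write \<open>y = A ^ n * w\<close> with \<open>w\<close> between 1 and
        \<open>A\<close>. Since \<open>e A \<le> 0\<close>, replacing \<open>n * ln A\<close> by the
        larger \<open>ln y\<close> only lowers the bound, and the leftover \<open>K / ln y\<close>
        vanishes in the limit.\<close>
      obtain n where le: "A ^ n \<le> y" and lt: "y < A ^ Suc n"
        using power_bracket[of A y] A elim by auto
      define w where "w = y / A ^ n"
      have An: "A ^ n > 0" using A by simp
      have w: "1 \<le> w" "w \<le> A" "A ^ n * w = y"
        using le lt An by (auto simp: w_def field_simps)
      have A1: "\<rho> A > 0" using R(2) A by simp
      have "\<rho> A ^ n * (\<rho> A / C) \<le> \<rho> A ^ n * \<rho> w"
        using compact[OF w(1,2)] C(1) A1 by (intro mult_left_mono) (auto simp: field_simps)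
      also have "\<dots> \<le> \<rho> y" using pow[of A w n] A w by simp
      finally have *: "\<rho> A ^ n * (\<rho> A / C) \<le> \<rho> y" .
      have "ln (\<rho> A ^ n * (\<rho> A / C)) \<le> ln (\<rho> y)"
        using * A1 C(1) R(2)[of y] elim by (subst ln_le_cancel_iff) auto
      moreover have "ln (\<rho> A ^ n * (\<rho> A / C)) = real n * ln (\<rho> A) + K"
        using A1 C(1) unfolding K_def by (subst ln_mult) (auto simp: ln_realpow)
      ultimately have 1: "real n * ln (\<rho> A) + K \<le> ln (\<rho> y)" by simp
      have lnA: "ln (\<rho> A) = e A * ln A" using A by (simp add: e_def)
      have "ln (A ^ n) \<le> ln y" using le A elim by (subst ln_le_cancel_iff) auto
      then have "real n * ln A \<le> ln y" using A by (simp add: ln_realpow)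
      then have "e A * ln y \<le> e A * (real n * ln A)"
        using e0[of A] A by (intro mult_left_mono_neg) auto
      with 1 have "e A * ln y + K \<le> ln (\<rho> y)" by (simp add: lnA mult_ac)
      then have "(e A * ln y + K) / ln y \<le> e y"
        unfolding e_def[of y] using elim by (intro divide_right_mono) auto
      then have "e A + K / ln y \<le> e y" using elim by (simp add: add_divide_distrib)
      with elim show ?case by simp
    qed
  qed
  then have "((\<lambda>y. ereal (e y)) \<longlongrightarrow> ereal B) at_top" by simp
  then have "((\<lambda>y. ln_ereal (ratio_liminf f y) / ereal (ln y)) \<longlongrightarrow> ereal B) at_top"
  proof (rule Lim_transform_eventually)
    show "\<forall>\<^sub>F y in at_top. ereal (e y) = ln_ereal (ratio_liminf f y) / ereal (ln y)"
      using eventually_gt_at_top[of 1]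
    proof eventually_elim
      case (elim y)
      then show ?case using R[of y] by (simp add: ln_ereal_def e_def)
    qed
  qed
  then have "lower_Matuszewska_index f = ereal B"
    unfolding lower_Matuszewska_index_def by (intro tendsto_Lim) auto
  with p have Bp: "\<bar>B\<bar> < p" by simp
  \<comment> \<open>The midpoint of \<open>\<bar>B\<bar>\<close> and \<open>p\<close>:
    \<open>-s < B\<close> provides the factor \<open>y\<close>, and \<open>s < p\<close> leaves room
    for the moment of order \<open>p\<close> to win later.\<close>
  define s where "s = (\<bar>B\<bar> + p) / 2"
  have s: "0 \<le> s" "s < p" "- s < B" using Bp unfolding s_def by (auto simp: field_simps abs_if split: if_splits)
  then obtain y where y: "y > 1" "- s < e y"
    unfolding B_def using less_cSUP_iff[OF _ bdd, of "-s"] by auto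
  have "- s * ln y < ln (\<rho> y)" using y by (simp add: e_def field_simps)
  then have "exp (- s * ln y) < \<rho> y" using R(2)[of y] y by (metis exp_less_cancel_iff exp_ln less_imp_le)
  then have "y powr (-s) < \<rho> y" using y by (simp add: powr_def)
  then have "\<forall>\<^sub>F x in at_top. y powr (-s) * f x < f (x * y)" using y by (intro \<rho>_less) auto
  then have "\<forall>\<^sub>F x in at_top. y powr (-s) * f x \<le> f (x * y)"
    by (rule eventually_mono) simp
  from power_lower_bound[OF AD y(1) s(1) this] s that show ?thesis by metis
qed

text \<open>Here the size of \<open>s\<close> is left open, which is enough against quantities that
  decay faster than any prescribed power. The factor 2 alone determines \<open>s\<close>.\<close>

lemma O_regularly_varying_power_bound:
  assumes OR: "O_regularly_varying f" and AD: "almost_decreasing f"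
  obtains s c x2 :: real where "0 \<le> s" "c > 0" "x2 > 0" "\<And>x. x \<ge> x2 \<Longrightarrow> c * x powr (-s) \<le> f x"
proof -
  have "0 < ratio_liminf f 2" using OR unfolding O_regularly_varying_def by auto
  then obtain c where c: "0 < ereal c" "ereal c < ratio_liminf f 2"
    using ereal_dense2 by blast
  define s where "s = max 0 (- log 2 c)"
  have "2 powr (-s) \<le> 2 powr (log 2 c)" by (intro powr_mono) (auto simp: s_def)
  moreover have "2 powr (log 2 c) = c" using c(1) by simp
  ultimately have s: "s \<ge> 0" "2 powr (-s) \<le> c" by (auto simp: s_def)
  have "\<forall>\<^sub>F x in at_top. 2 powr (-s) * f x \<le> f (x * 2)"
    using ratio_liminf_lessD[OF almost_decreasing_positive[OF AD] c(2)]
      almost_decreasing_positive[OF AD, unfolded eventually_positive_def]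
  proof eventually_elim
    case (elim x)
    have "2 powr (-s) * f x \<le> c * f x" using s elim by (intro mult_right_mono) auto
    with elim(1) show ?case by linarith
  qed
  from power_lower_bound[OF AD _ s(1) this] s that show ?thesis by (metis one_less_numeral_iff semiring_norm(76))
qed

section \<open>Uniformity in intermediate regular variation\<close>

text \<open>
  Two translates of sets filling more than three quarters of an interval of length \<open>h\<close>, at
  distance at most \<open>h / 2\<close>, must meet; at a common point both increments are small.
\<close>

lemma uniform_increments:
  fixes g :: "real \<Rightarrow> real"
  assumes g[measurable]: "g \<in> borel_measurable borel" and h: "h > 0"
    and inc: "\<And>v. 0 \<le> v \<Longrightarrow> v < h \<Longrightarrow> \<forall>\<^sub>F u in at_top. \<bar>g (u + v) - g u\<bar> < e"
  shows "\<forall>\<^sub>F u in at_top. \<forall>v\<in>{0..h/2}. \<bar>g (u + v) - g u\<bar> < 2 * e"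
proof (rule ccontr)
  assume "\<not> ?thesis"
  then have "\<forall>n::nat. \<exists>u\<ge>real n. \<exists>v\<in>{0..h/2}. \<not> \<bar>g (u + v) - g u\<bar> < 2 * e"
    unfolding eventually_at_top_linorder by blast
  then obtain u v where uv: "\<And>n::nat. real n \<le> u n" "\<And>n. 0 \<le> v n" "\<And>n. v n \<le> h/2"
    "\<And>n. \<not> \<bar>g (u n + v n) - g (u n)\<bar> < 2 * e"
    by (metis atLeastAtMost_iff)
  \<comment> \<open>The points whose increments from \<open>w m\<close> are small for all
    \<open>m \<ge> n\<close>. As \<open>w\<close> tends to infinity these sets increase to the whole
    interval; this is used for \<open>u\<close> and for the shifted sequence
    \<open>u + v\<close>.\<close>
  define V where "V w n = {x\<in>{0..<h}. \<forall>m\<ge>n. \<bar>g (w m + x) - g (w m)\<bar> < e}" for w :: "nat \<Rightarrow> real" and n :: nat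
  have V_borel: "V w n \<in> sets borel" for w n
    unfolding V_def by measurable
  have V_leb[simp]: "V w n \<in> sets lebesgue" for w n
    using V_borel[of w n] by simp
  have V_fin[simp]: "emeasure lebesgue (V w n) \<noteq> \<infinity>" for w n
  proof -
    have "emeasure lebesgue (V w n) \<le> emeasure lebesgue {0..<h}"
      by (intro emeasure_mono) (auto simp: V_def)
    also have "\<dots> < \<infinity>" using h by simp
    finally show ?thesis by simp
  qed
  have V_fm: "V w n \<in> lmeasurable" for w n
    by (rule fmeasurableI[OF V_leb]) (use V_fin[of w n] in \<open>simp only: top.not_eq_extremum infinity_ennreal_def\<close>)
  have V_lim: "(\<lambda>n. measure lebesgue (V w n)) \<longlonglongrightarrow> h" if w: "\<And>n. real n \<le> w n" for w
  proof -
    have wlim: "filterlim w at_top sequentially"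
      using filterlim_at_top_mono[OF filterlim_real_sequentially] w by (auto intro: always_eventually)
    have Un: "(\<Union>n. V w n) = {0..<h}"
    proof (intro equalityI subsetI)
      fix x assume x: "x \<in> {0..<h}"
      from eventually_compose_filterlim[OF inc wlim, of x] x
      obtain n where "\<forall>m\<ge>n. \<bar>g (w m + x) - g (w m)\<bar> < e"
        unfolding eventually_sequentially by auto
      with x show "x \<in> (\<Union>n. V w n)" unfolding V_def by auto
    qed (auto simp: V_def)
    have "(\<lambda>n. measure lebesgue (V w n)) \<longlonglongrightarrow> measure lebesgue (\<Union>n. V w n)"
    proof (rule Lim_measure_incseq)
      show "incseq (V w)" by (auto simp: incseq_def V_def)
      show "emeasure lebesgue (\<Union>n. V w n) \<noteq> \<infinity>" unfolding Un using emeasure_lborel_Ico[of 0 h] h by simp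
    qed auto
    then show ?thesis unfolding Un using h by simp
  qed
  have "(\<lambda>n. measure lebesgue (V u n)) \<longlonglongrightarrow> h" by (rule V_lim) (rule uv)
  moreover have "(\<lambda>n. measure lebesgue (V (\<lambda>n. u n + v n) n)) \<longlonglongrightarrow> h"
    by (rule V_lim) (use uv in \<open>auto intro: add_increasing2\<close>)
  ultimately have "\<forall>\<^sub>F n in sequentially. 3/4 * h < measure lebesgue (V u n) \<and>
      3/4 * h < measure lebesgue (V (\<lambda>n. u n + v n) n)"
    using h by (intro eventually_conj order_tendstoD(1)) auto
  then obtain n where n: "3/4 * h < measure lebesgue (V u n)"
      "3/4 * h < measure lebesgue (V (\<lambda>n. u n + v n) n)"
    unfolding eventually_sequentially by auto
  define W where "W = (\<lambda>x. v n + x) ` V (\<lambda>n. u n + v n) n"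
  have Wm: "measure lebesgue W = measure lebesgue (V (\<lambda>n. u n + v n) n)"
    unfolding W_def by (rule measure_translation)
  have Wl: "W \<in> lmeasurable" unfolding W_def
    by (rule measurable_translation[OF V_fm])
  note Vl = V_fm[of u n]
  have "V u n \<inter> W \<noteq> {}"
  proof
    assume disj: "V u n \<inter> W = {}"
    have "measure lebesgue (V u n \<union> W) = measure lebesgue (V u n) + measure lebesgue W"
      using disj fmeasurableD2[OF Vl] fmeasurableD2[OF Wl]
      by (intro measure_Union fmeasurableD[OF Vl] fmeasurableD[OF Wl]) simp_all
    moreover have "measure lebesgue (V u n \<union> W) \<le> measure lebesgue {0..<3/2*h}"
    proof (rule measure_mono_fmeasurable)
      show "V u n \<union> W \<subseteq> {0..<3/2*h}"
        using uv(2)[of n] uv(3)[of n] h unfolding V_def W_def by (auto simp: field_simps)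
      show "{0..<3/2*h} \<in> lmeasurable"
        by (rule fmeasurableI) (use emeasure_lborel_Ico[of 0 "3/2*h"] h in auto)
    qed (use Vl Wl in auto)
    moreover have "measure lebesgue {0..<3/2*h} = 3/2*h" using h by simp
    ultimately show False using n Wm by simp
  qed
  then obtain x where x: "v n + x \<in> V u n" "x \<in> V (\<lambda>n. u n + v n) n" unfolding W_def by auto
  have "\<bar>g (u n + (v n + x)) - g (u n)\<bar> < e" "\<bar>g (u n + v n + x) - g (u n + v n)\<bar> < e"
    using x unfolding V_def by auto
  then have "\<bar>g (u n + v n) - g (u n)\<bar> < 2 * e" by (simp add: add.assoc)
  with uv(4) show False by blast
qed

text \<open>The definition controls \<open>f (x * y) / f x\<close> for each fixed \<open>y\<close>
  near 1, with a threshold on \<open>x\<close> that depends on \<open>y\<close>. In logarithmic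
  coordinates ratios become increments, and \<open>uniform_increments\<close> removes the
  dependence.\<close>

lemma intermediate_regularly_varying_uniform:
  assumes IR: "intermediate_regularly_varying f" and [measurable]: "f \<in> borel_measurable borel" and k: "k > 1"
  obtains \<eta> where "\<eta> > 0"
    "\<forall>\<^sub>F x in at_top. \<forall>z\<in>{(1 - \<eta>) * x..(1 + \<eta>) * x}. f z \<le> k * f x \<and> 1 / k * f x \<le> f z"
proof -
  have ev: "eventually_positive f" using IR by (simp add: intermediate_regularly_varying_def)
  define g where "g u = ln (f (exp u))" for u
  \<comment> \<open>Halved because \<open>uniform_increments\<close> doubles the bound.\<close>
  define e where "e = ln k / 2"
  have e: "e > 0" using k by (simp add: e_def)
  have "\<forall>\<^sub>F y in at_right 1. ratio_limsup f y < ereal (exp e)"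
    using IR e unfolding intermediate_regularly_varying_def
    by (intro order_tendstoD(2)[of _ 1]) (auto simp: one_ereal_def)
  moreover have "\<forall>\<^sub>F y in at_right 1. ereal (exp (-e)) < ratio_liminf f y"
    using IR e unfolding intermediate_regularly_varying_def
    by (intro order_tendstoD(1)[of _ 1]) (auto simp: one_ereal_def)
  ultimately have "\<forall>\<^sub>F y in at_right 1. ratio_limsup f y < ereal (exp e) \<and> ereal (exp (-e)) < ratio_liminf f y"
    by (rule eventually_conj)
  then obtain b where b: "b > 1" "\<And>y. 1 < y \<Longrightarrow> y < b \<Longrightarrow>
      ratio_limsup f y < ereal (exp e) \<and> ereal (exp (-e)) < ratio_liminf f y"
    unfolding eventually_at_right_field by auto
  define h where "h = ln b"
  have h: "h > 0" using b by (simp add: h_def)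
  have "\<forall>\<^sub>F u in at_top. \<forall>v\<in>{0..h/2}. \<bar>g (u + v) - g u\<bar> < 2 * e"
  proof (rule uniform_increments[OF _ h])
    show "g \<in> borel_measurable borel" unfolding g_def by measurable
  next
    fix v assume v: "0 \<le> v" "v < h"
    show "\<forall>\<^sub>F u in at_top. \<bar>g (u + v) - g u\<bar> < e"
    proof (cases "v = 0")
      case True
      then show ?thesis using e by simp
    next
      case False
      have "exp v < exp h" using v by simp
      then have y: "1 < exp v" "exp v < b" using v False b by (auto simp: h_def)
      have "\<forall>\<^sub>F x in at_top. exp (-e) * f x < f (x * exp v) \<and> f (x * exp v) < exp e * f x \<and> 0 < f x"
        using b(2)[OF y] ev
        by (intro eventually_conj ratio_liminf_lessD ratio_limsup_lessD) (auto simp: eventually_positive_def)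
      from eventually_compose_filterlim[OF this exp_at_top]
      show ?thesis
      proof eventually_elim
        case (elim u)
        let ?a = "f (exp u)" and ?b = "f (exp u * exp v)"
        have pos: "?a > 0" using elim by simp
        have b: "?b > 0" using elim pos by (smt (verit) exp_gt_zero mult_pos_pos)
        have "ln (exp (-e) * ?a) < ln ?b" "ln ?b < ln (exp e * ?a)"
          using elim pos b by (auto simp: ln_less_cancel_iff)
        then have "- e + ln ?a < ln ?b" "ln ?b < e + ln ?a"
          using pos by (auto simp: ln_mult)
        then show ?case by (simp add: g_def exp_add abs_less_iff)
      qed
    qed
  qed
  then obtain U where U: "\<And>u v. u \<ge> U \<Longrightarrow> 0 \<le> v \<Longrightarrow> v \<le> h/2 \<Longrightarrow> \<bar>g (u + v) - g u\<bar> < 2 * e"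
    unfolding eventually_at_top_linorder by force
  obtain X0 where X0: "\<And>x. x \<ge> X0 \<Longrightarrow> f x > 0"
    using ev unfolding eventually_positive_def eventually_at_top_linorder by blast
  \<comment> \<open>Only \<open>z\<close> to the right of \<open>x\<close> is covered, but with all
    four inequalities, so that a \<open>z\<close> to the left follows by exchanging the two
    points.\<close>
  have two: "f z \<le> k * f x \<and> 1 / k * f x \<le> f z \<and> f x \<le> k * f z \<and> 1 / k * f z \<le> f x"
    if x: "x \<ge> exp U" "x \<ge> X0" and z: "x \<le> z" "z \<le> exp (h/2) * x" for x z
  proof -
    have x0: "x > 0" using x by (meson exp_gt_zero less_le_trans)
    have z0: "z > 0" using x0 z by simp
    have fp: "f x > 0" "f z > 0" using X0 x z by auto
    have "ln U' \<ge> U" if "U' \<ge> exp U" for U' using that by (simp add: ln_ge_iff less_le_trans[OF exp_gt_zero])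
    then have "ln x \<ge> U" using x by blast
    moreover have "ln z \<le> ln (exp (h/2) * x)" using z z0 x0 by (subst ln_le_cancel_iff) auto
    then have "ln z - ln x \<le> h/2" using x0 by (simp add: ln_mult)
    moreover have "0 \<le> ln z - ln x" using z x0 by simp
    ultimately have "\<bar>g (ln x + (ln z - ln x)) - g (ln x)\<bar> < 2 * e" by (intro U)
    then have "\<bar>ln (f z) - ln (f x)\<bar> < ln k" using x0 z0 by (simp add: g_def e_def)
    then have "ln (f z) < ln (k * f x)" "ln (f x) < ln (k * f z)"
      using fp k by (auto simp: ln_mult abs_less_iff)
    then have "f z < k * f x" "f x < k * f z" using fp k by (auto simp: ln_less_cancel_iff)
    then show ?thesis using k by (auto simp: field_simps)
  qed
  \<comment> \<open>The largest \<eta> for which the interval around \<open>x\<close> stays between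
    \<open>exp (-(h/2)) * x\<close> and \<open>exp (h/2) * x\<close>.\<close>
  define \<eta> where "\<eta> = min (1 - exp (-(h/2))) (exp (h/2) - 1)"
  have \<eta>: "\<eta> > 0" "1 - \<eta> \<ge> exp (-(h/2))" "1 + \<eta> \<le> exp (h/2)" using h by (auto simp: \<eta>_def)
  show ?thesis
  proof (rule that[OF \<eta>(1)])
    show "\<forall>\<^sub>F x in at_top. \<forall>z\<in>{(1 - \<eta>) * x..(1 + \<eta>) * x}. f z \<le> k * f x \<and> 1 / k * f x \<le> f z"
      \<comment> \<open>The extra factor \<open>exp (h/2)\<close> keeps \<open>z\<close> itself
        above the threshold when \<open>z < x\<close>, where \<open>z\<close> plays the role of the
        base point.\<close>
      using eventually_ge_at_top[of "exp (h/2) * max (exp U) X0"]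
    proof eventually_elim
      case (elim x)
      have "0 < max (exp U) X0" by (simp add: less_max_iff_disj)
      then have "1 * max (exp U) X0 \<le> exp (h/2) * max (exp U) X0" using h by (intro mult_right_mono) auto
      then have x: "x \<ge> max (exp U) X0" using elim by linarith
      have x0: "x > 0" using x by (smt (verit) exp_gt_zero)
      show ?case
      proof
        fix z assume z: "z \<in> {(1 - \<eta>) * x..(1 + \<eta>) * x}"
        have "(1 + \<eta>) * x \<le> exp (h/2) * x" "exp (-(h/2)) * x \<le> (1 - \<eta>) * x"
          using \<eta> x0 by (auto intro!: mult_right_mono)
        then have z': "z \<le> exp (h/2) * x" "exp (-(h/2)) * x \<le> z" using z by auto
        then have "x \<le> exp (h/2) * z" by (simp add: exp_minus field_simps)
        show "f z \<le> k * f x \<and> 1 / k * f x \<le> f z"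
        proof (cases "x \<le> z")
          case True
          then show ?thesis using two[of x z] x z' by auto
        next
          case False
          have "exp (h/2) * max (exp U) X0 \<le> exp (h/2) * z"
            using elim \<open>x \<le> exp (h/2) * z\<close> by linarith
          then have "z \<ge> max (exp U) X0" by simp
          then show ?thesis using two[of z x] False \<open>x \<le> exp (h/2) * z\<close> by auto
        qed
      qed
    qed
  qed
qed

lemma intermediate_regularly_varying_index:
  assumes IR: "intermediate_regularly_varying f" and f: "f \<in> borel_measurable borel"
  shows "L_index f = 1" "l_index f = 1"
proof -
  have ev: "eventually_positive f" using IR by (simp add: intermediate_regularly_varying_def)
  have L: "L_index f \<le> ereal k \<and> ereal (1 / k) \<le> l_index f" if k: "k > 1" for k
  proof -
    obtain \<eta> where "\<eta> > 0"
      "\<forall>\<^sub>F x in at_top. \<forall>z\<in>{(1 - \<eta>) * x..(1 + \<eta>) * x}. f z \<le> k * f x \<and> 1 / k * f x \<le> f z"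
      using intermediate_regularly_varying_uniform[OF IR f k] by blast
    then show ?thesis
      by (intro conjI L_index_le[OF ev, of \<eta>] l_index_ge[OF ev, of \<eta>]) (auto elim!: eventually_mono)
  qed
  have "L_index f \<le> 1"
  proof (rule ccontr)
    assume "\<not> L_index f \<le> 1"
    then obtain k where "1 < ereal k" "ereal k < L_index f" using ereal_dense2[of 1 "L_index f"] by (auto simp: not_le)
    with L[of k] show False by auto
  qed
  then show "L_index f = 1" using L_index_ge_1[OF ev] by simp
  have "l_index f \<ge> 1"
  proof (rule ccontr)
    assume "\<not> l_index f \<ge> 1"
    moreover have "l_index f > 0"
    proof -
      have "0 < ereal (1/2)" by simp
      also have "\<dots> \<le> l_index f" using L[of 2] by simp
      finally show ?thesis .
    qed
    ultimately obtain r where r: "l_index f = ereal r" "0 < r" "r < 1" by (cases "l_index f") auto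
    \<comment> \<open>With \<open>k = 2 / (r + 1)\<close> the bound \<open>1 / k\<close> is the
      midpoint of \<open>r\<close> and 1, hence larger than \<open>r\<close>.\<close>
    have "1 / (2 / (r + 1)) \<le> r" using L[of "2 / (r + 1)"] r by auto
    then show False using r by simp
  qed
  then show "l_index f = 1" using l_index_le_1[OF ev] by simp
qed

text \<open>Almost decrease bounds the upper ratio. For the lower one, each factor
  \<open>1 + \<eta>\<close> costs at most one half; finitely many factors pass beyond
  \<open>y\<close>, and almost decrease returns to \<open>y\<close>.\<close>

lemma intermediate_imp_O_regularly_varying:
  assumes IR: "intermediate_regularly_varying f" and f: "f \<in> borel_measurable borel"
    and AD: "almost_decreasing f"
  shows "O_regularly_varying f"
  unfolding O_regularly_varying_def
proof (intro conjI allI impI)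
  show ev: "eventually_positive f" using IR by (simp add: intermediate_regularly_varying_def)
  obtain C x0 where C: "C \<ge> 1" "x0 > 0" "\<And>x. x \<ge> x0 \<Longrightarrow> f x > 0"
    "\<And>x u. x \<ge> x0 \<Longrightarrow> u \<ge> x \<Longrightarrow> f u \<le> C * f x"
    using almost_decreasingE[OF AD] by metis
  fix y :: real assume y: "1 \<le> y"
  show "ratio_liminf f y \<le> ratio_limsup f y"
    unfolding ratio_liminf_def ratio_limsup_def by (rule Liminf_le_Limsup) simp
  have "\<forall>\<^sub>F x in at_top. f (x * y) \<le> C * f x"
    using eventually_ge_at_top[of x0]
  proof eventually_elim
    case (elim x)
    have "x * 1 \<le> x * y" using y elim C by (intro mult_left_mono) auto
    then show ?case using C(4)[of x "x * y"] elim by simp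
  qed
  from ratio_limsup_le[OF ev this] show "ratio_limsup f y < \<infinity>" by auto
  obtain \<eta> where \<eta>: "\<eta> > 0"
      "\<forall>\<^sub>F x in at_top. \<forall>z\<in>{(1 - \<eta>) * x..(1 + \<eta>) * x}. f z \<le> 2 * f x \<and> 1 / 2 * f x \<le> f z"
    using intermediate_regularly_varying_uniform[OF IR f, of 2] by auto
  have step: "\<forall>\<^sub>F x in at_top. 1/2 * f x \<le> f (x * (1 + \<eta>))"
    using \<eta>(2) eventually_ge_at_top[of 0]
  proof eventually_elim
    case (elim x)
    have "0 \<le> \<eta> * x" using \<eta>(1) elim(2) by simp
    then have "x * (1 + \<eta>) \<in> {(1 - \<eta>) * x..(1 + \<eta>) * x}" by (auto simp: algebra_simps)
    with elim(1) show ?case by blast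
  qed
  have iter: "\<forall>\<^sub>F x in at_top. (1/2) ^ n * f x \<le> f (x * (1 + \<eta>) ^ n)" for n
  proof (induction n)
    case (Suc n)
    have "filterlim (\<lambda>x. x * (1 + \<eta>)) at_top at_top"
      using \<eta>(1) by (intro filterlim_mult_at_top) simp
    from eventually_compose_filterlim[OF Suc this] step show ?case
    proof eventually_elim
      case (elim x)
      have "(1/2) ^ n * (1/2 * f x) \<le> (1/2) ^ n * f (x * (1 + \<eta>))"
        using elim(2) by (intro mult_left_mono) auto
      also have "\<dots> \<le> f (x * (1 + \<eta>) * (1 + \<eta>) ^ n)" by (rule elim)
      finally show ?case by (simp only: mult_ac power_Suc)
    qed
  qed simp
  obtain n where n: "y < (1 + \<eta>) ^ n" using real_arch_pow[of "1 + \<eta>" y] \<eta>(1) by auto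
  have "\<forall>\<^sub>F x in at_top. (1/2) ^ n / C * f x \<le> f (x * y)"
    using iter[of n] eventually_ge_at_top[of x0]
  proof eventually_elim
    case (elim x)
    have x: "x > 0" using elim C by simp
    have "x * 1 \<le> x * y" "x * y \<le> x * (1 + \<eta>) ^ n" using y n x by (auto intro!: mult_left_mono)
    then have "f (x * (1 + \<eta>) ^ n) \<le> C * f (x * y)" using elim by (intro C(4)) auto
    then have "(1/2) ^ n * f x \<le> C * f (x * y)" using elim by linarith
    then show ?case using C(1) by (simp add: field_simps)
  qed
  from ratio_liminf_ge[OF ev this] have "ereal ((1/2) ^ n / C) \<le> ratio_liminf f y" .
  moreover have "0 < ereal ((1/2) ^ n / C)" using C(1) by simp
  ultimately show "0 < ratio_liminf f y" by (rule less_le_trans[rotated])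
qed

text \<open>Finiteness is what domination gives already for \<epsilon> = 1/2.\<close>

lemma O_regularly_varying_L_index:
  assumes "O_regularly_varying f" "almost_decreasing f"
  obtains L where "L_index f = ereal L" "L \<ge> 1"
proof -
  obtain C x1 :: real where C: "C > 0" "x1 > 0" "\<And>x u. x \<ge> x1 \<Longrightarrow> u \<ge> 1/2 * x \<Longrightarrow> f u \<le> C * f x"
    using O_regularly_varying_dominated[OF assms, of "1/2"] by auto
  have ev: "eventually_positive f" using assms(1) by (simp add: O_regularly_varying_def)
  have "L_index f \<le> ereal C"
  proof (rule L_index_le[OF ev, of "1/2"])
    show "\<forall>\<^sub>F x in at_top. \<forall>z\<in>{(1 - 1/2) * x..(1 + 1/2) * x}. f z \<le> C * f x"
      using eventually_ge_at_top[of x1] by eventually_elim (auto intro: C)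
  qed auto
  with L_index_ge_1[OF ev] that show ?thesis by (cases "L_index f") auto
qed

text \<open>Positivity comes from the same domination with \<open>x\<close> and \<open>z\<close>
  exchanged, since \<open>z \<le> 3/2 * x\<close> implies \<open>x \<ge> 1/2 * z\<close>.\<close>

lemma O_regularly_varying_l_index:
  assumes "O_regularly_varying f" "almost_decreasing f"
  obtains l where "l_index f = ereal l" "0 < l" "l \<le> 1"
proof -
  obtain C x1 :: real where C: "C > 0" "x1 > 0" "\<And>x u. x \<ge> x1 \<Longrightarrow> u \<ge> 1/2 * x \<Longrightarrow> f u \<le> C * f x"
    using O_regularly_varying_dominated[OF assms, of "1/2"] by auto
  have ev: "eventually_positive f" using assms(1) by (simp add: O_regularly_varying_def)
  have "ereal (1 / C) \<le> l_index f"
  proof (rule l_index_ge[OF ev, of "1/2"])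
    show "\<forall>\<^sub>F x in at_top. \<forall>z\<in>{(1 - 1/2) * x..(1 + 1/2) * x}. 1 / C * f x \<le> f z"
      using eventually_ge_at_top[of "2 * x1"]
    proof eventually_elim
      case (elim x)
      show ?case
      proof
        fix z assume "z \<in> {(1 - 1/2) * x..(1 + 1/2) * x}"
        then have "f x \<le> C * f z" using elim C(2) by (intro C(3)) auto
        then show "1 / C * f x \<le> f z" using C(1) by (simp add: field_simps)
      qed
    qed
  qed auto
  moreover have "0 < ereal (1 / C)" using C by simp
  ultimately have "0 < l_index f" by (rule less_le_trans[rotated])
  with l_index_le_1[OF ev] that show ?thesis by (cases "l_index f") auto
qed

section \<open>Sums of a fixed number of terms\<close>

lemma measure_le_integral:
  fixes g :: "'b \<Rightarrow> real"
  assumes "finite_measure N" and A: "A \<in> sets N" and g: "integrable N g"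
    "\<And>x. x \<in> space N \<Longrightarrow> 0 \<le> g x" "\<And>x. x \<in> A \<Longrightarrow> 1 \<le> g x"
  shows "measure N A \<le> (\<integral>x. g x \<partial>N)"
proof -
  interpret finite_measure N by fact
  have "measure N A = (\<integral>x. indicator A x \<partial>N)" using A sets.sets_into_space by (simp add: Int_absorb2)
  also have "\<dots> \<le> (\<integral>x. g x \<partial>N)"
    using A g by (intro integral_mono integrable_real_indicator) (auto simp: emeasure_eq_measure split: split_indicator)
  finally show ?thesis .
qed

text \<open>Compare both sides after multiplication by \<open>1 - u\<close>: the right one becomes
  \<open>1 - u ^ 3 \<ge> 1\<close>, the left one is at most
  \<open>exp (-u) * exp u = 1\<close>.\<close>

lemma exp_quadratic_bound_nonpos:
  fixes u :: real
  assumes "u \<le> 0"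
  shows "exp u \<le> 1 + u + u\<^sup>2"
proof -
  have "(1 - u) * (1 + u + u\<^sup>2) = 1 - u ^ 3" by (simp add: algebra_simps power2_eq_square power3_eq_cube)
  moreover have "u ^ 3 \<le> 0" using assms by (simp add: power3_eq_cube mult_nonneg_nonpos mult_nonpos_nonpos)
  ultimately have "1 \<le> (1 - u) * (1 + u + u\<^sup>2)" by simp
  moreover have "(1 - u) * exp u \<le> exp (-u) * exp u"
    using exp_ge_add_one_self[of "-u"] by (intro mult_right_mono) auto
  then have "(1 - u) * exp u \<le> 1" by (simp add: exp_minus)
  ultimately have "(1 - u) * exp u \<le> (1 - u) * (1 + u + u\<^sup>2)" by linarith
  then show ?thesis using assms by (simp add: mult_le_cancel_left)
qed

text \<open>Interpolating between the exponents 1 and 2 is what lets the estimate use \<open>r\<close> moments only.\<close>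

lemma exp_powr_bound:
  fixes u :: real
  assumes u: "0 \<le> u" "u \<le> B" and r: "0 < r" "r \<le> 2"
  shows "exp u \<le> 1 + u + u powr r * exp B"
proof (cases "u \<le> 1")
  case True
  have "u\<^sup>2 \<le> u powr r"
  proof (cases "u = 0")
    case False
    then have "u powr 2 \<le> u powr r" using True u r by (intro powr_mono') auto
    then show ?thesis using u False by (simp add: powr_numeral)
  qed simp
  also have "\<dots> = u powr r * 1" by simp
  also have "\<dots> \<le> u powr r * exp B" using u by (intro mult_left_mono) auto
  finally show ?thesis using exp_bound[OF u(1) True] by linarith
next
  case False
  have "1 * exp B \<le> u powr r * exp B"
    using False r by (intro mult_right_mono ge_one_powr_ge_zero) auto
  moreover have "exp u \<le> exp B" using u by simp
  ultimately show ?thesis using u by linarith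
qed

text \<open>Each range of \<open>x\<close> uses what is integrable there. Moderate negative values
  admit a quadratic remainder; below \<open>-K\<close> the exponential is at most 1 and the two
  linear terms cancel; positive values are capped at \<open>a\<close> and use the power
  \<open>r\<close>.\<close>

lemma exp_min_bound:
  fixes x :: real
  assumes h: "0 < h" and a: "0 \<le> a" and K: "0 \<le> K" and r: "0 < r" "r \<le> 2"
  shows "exp (h * min x a) \<le> 1 + h * x + h * (\<bar>x\<bar> * indicator {x. K < \<bar>x\<bar>} x) + h\<^sup>2 * K\<^sup>2
     + h powr r * exp (h * a) * max 0 x powr r"
proof (cases "x \<le> 0")
  case True
  have e: "min x a = x" using True a by simp
  have hx: "h * x \<le> 0" using h True by (simp add: mult_nonneg_nonpos)
  show ?thesis
  proof (cases "K < \<bar>x\<bar>")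
    case True': True
    have "exp (h * x) \<le> 1" using hx by simp
    moreover have "0 \<le> h\<^sup>2 * K\<^sup>2" by simp
    moreover have "h * x + h * (\<bar>x\<bar> * indicator {x. K < \<bar>x\<bar>} x) = 0" using True True' by simp
    moreover have "h powr r * exp (h * a) * max 0 x powr r = 0" using True by (simp add: max_def)
    ultimately show ?thesis unfolding e by linarith
  next
    case False
    have "exp (h * x) \<le> 1 + h * x + (h * x)\<^sup>2" using hx by (rule exp_quadratic_bound_nonpos)
    moreover have "x\<^sup>2 \<le> K\<^sup>2" using False K by (metis abs_le_square_iff abs_of_nonneg not_less)
    then have "(h * x)\<^sup>2 \<le> h\<^sup>2 * K\<^sup>2" by (simp add: power_mult_distrib mult_left_mono)
    ultimately show ?thesis using True False unfolding e by (simp add: max_def)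
  qed
next
  case False
  let ?u = "h * min x a"
  have u: "0 \<le> ?u" "?u \<le> h * a" "?u \<le> h * x" using False a h by auto
  have "exp ?u \<le> 1 + ?u + ?u powr r * exp (h * a)" by (rule exp_powr_bound[OF u(1,2) r])
  moreover have "?u powr r \<le> (h * x) powr r" using u r by (intro powr_mono2) auto
  then have "?u powr r * exp (h * a) \<le> (h * x) powr r * exp (h * a)" by (intro mult_right_mono) auto
  moreover have "(h * x) powr r * exp (h * a) = h powr r * x powr r * exp (h * a)"
    using h False by (simp add: powr_mult)
  moreover have "0 \<le> h * (\<bar>x\<bar> * indicator {x. K < \<bar>x\<bar>} x)" using h by simp
  moreover have "0 \<le> h\<^sup>2 * K\<^sup>2" by simp
  ultimately have "exp ?u \<le> 1 + h * x + h * (\<bar>x\<bar> * indicator {x. K < \<bar>x\<bar>} x) + h\<^sup>2 * K\<^sup>2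
     + h powr r * x powr r * exp (h * a)" using u by linarith
  then show ?thesis using False by (simp add: max_def mult_ac)
qed

section \<open>Translates of \<Delta> and the product space of the summands\<close>

lemma mem_translate_Delta: "v \<in> translate y (Delta T) \<longleftrightarrow> y < v \<and> ereal (v - y) \<le> T"
proof
  assume "y < v \<and> ereal (v - y) \<le> T"
  then show "v \<in> translate y (Delta T)"
    unfolding translate_def Delta_def by (intro CollectI exI[of _ "v - y"]) auto
qed (auto simp: translate_def Delta_def)

lemma translate_Delta_borel[measurable]: "translate y (Delta T) \<in> sets borel"
proof -
  have "translate y (Delta T) = {v\<in>space borel. y < v \<and> ereal (v - y) \<le> T}"
    by (auto simp: mem_translate_Delta)
  also have "\<dots> \<in> sets borel" by measurable
  finally show ?thesis .
qed

lemma pred_translate_Delta[measurable (raw)]: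
  fixes g g' :: "'b \<Rightarrow> real"
  assumes [measurable]: "g \<in> borel_measurable M" "g' \<in> borel_measurable M"
  shows "Measurable.pred M (\<lambda>x. g x \<in> translate (g' x) (Delta T))"
  unfolding mem_translate_Delta by measurable

text \<open>The cap \<open>r \<le> 2\<close> serves the interpolation in
  \<open>exp_powr_bound\<close>; a higher moment is lowered to order 2 by
  \<open>powr_moment_le_2\<close>.\<close>

locale heavy_local =
  fixes F :: "real measure" and T :: ereal and r \<mu> :: real
  assumes prob: "prob_space F" and sets_F[measurable_cong, simp]: "sets F = sets borel"
    and integrable_id: "integrable F (\<lambda>x. x)" and mean: "\<mu> = (\<integral>x. x \<partial>F)"
    and r: "1 < r" "r \<le> 2" and moment: "integrable F (\<lambda>x. max 0 x powr r)"
    and AD: "almost_decreasing (F_Delta F T)" and OR: "O_regularly_varying (F_Delta F T)"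
begin

sublocale prob_space F by (rule prob)

sublocale PP: product_prob_space "\<lambda>_::nat. F" UNIV
  by unfold_locales

abbreviation f :: "real \<Rightarrow> real" where "f \<equiv> F_Delta F T"

abbreviation P :: "nat set \<Rightarrow> (nat \<Rightarrow> real) measure" where "P I \<equiv> PiM I (\<lambda>_. F)"

text \<open>Index sets are arbitrary rather than initial segments, so that removing the summand
  \<open>k\<close> leads to \<open>I - {k}\<close> without renumbering.\<close>

abbreviation sum_prob :: "nat set \<Rightarrow> real \<Rightarrow> real" where
  "sum_prob I y \<equiv> measure (P I) {x\<in>space (P I). (\<Sum>i\<in>I. x i) \<in> translate y (Delta T)}"

abbreviation deviation :: "nat set \<Rightarrow> real \<Rightarrow> real" where
  "deviation I b \<equiv> measure (P I) {x\<in>space (P I). b < \<bar>(\<Sum>i\<in>I. x i) - real (card I) * \<mu>\<bar>}"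

abbreviation truncated_tail :: "nat set \<Rightarrow> real \<Rightarrow> real \<Rightarrow> real" where
  "truncated_tail I a z \<equiv>
    measure (P I) {x\<in>space (P I). (\<forall>i\<in>I. x i \<le> a) \<and> real (card I) * \<mu> + z < (\<Sum>i\<in>I. x i)}"

lemma space_F[simp]: "space F = UNIV"
  using sets_eq_imp_space_eq[OF sets_F] by simp

lemma borel_measurable_F[simp]: "g \<in> borel_measurable F \<longleftrightarrow> g \<in> borel_measurable borel"
  by (simp cong: measurable_cong_sets)

lemma prob_UNIV[simp]: "measure F UNIV = 1"
  using prob_space by simp

lemma prob_space_P: "prob_space (P I)"
  by (rule prob_space_PiM) (rule prob)

lemma measurable_PiM_component[measurable]: "i \<in> I \<Longrightarrow> (\<lambda>x. x i) \<in> borel_measurable (P I)"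
  using measurable_component_singleton[of i I "\<lambda>_. F"] by simp

lemma f_nonneg: "0 \<le> f x" by (simp add: F_Delta_def)

lemma eventually_pos: "eventually_positive f"
  by (rule almost_decreasing_positive[OF AD])

lemma measure_component:
  assumes "i \<in> I" and [measurable]: "A \<in> sets borel"
  shows "measure (P I) {x\<in>space (P I). x i \<in> A} = measure F A"
proof -
  have "distr (P I) F (\<lambda>x. x i) = F"
    using assms prob by (intro distr_PiM_component) auto
  then have "measure F A = measure (distr (P I) F (\<lambda>x. x i)) A" by simp
  also have "\<dots> = measure (P I) ((\<lambda>x. x i) -` A \<inter> space (P I))"
    using assms by (intro measure_distr) auto
  also have "(\<lambda>x. x i) -` A \<inter> space (P I) = {x\<in>space (P I). x i \<in> A}" by auto
  finally show ?thesis by simp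
qed

lemma integral_component:
  fixes g :: "real \<Rightarrow> real"
  assumes i: "i \<in> I" and g: "integrable F g"
  shows "integrable (P I) (\<lambda>x. g (x i))" "(\<integral>x. g (x i) \<partial>P I) = (\<integral>x. g x \<partial>F)"
proof -
  have d: "distr (P I) F (\<lambda>x. x i) = F"
    using assms prob by (intro distr_PiM_component) auto
  have m: "(\<lambda>x. x i) \<in> measurable (P I) F" using i by measurable
  have gm: "g \<in> borel_measurable F" using g by simp
  from g have "integrable (distr (P I) F (\<lambda>x. x i)) g" using d by simp
  then show "integrable (P I) (\<lambda>x. g (x i))" using integrable_distr_eq[OF m gm] by simp
  show "(\<integral>x. g (x i) \<partial>P I) = (\<integral>x. g x \<partial>F)"
    using integral_distr[OF m gm] d by simp
qed

text \<open>This is conditioning on all summands except the one with index \<open>k\<close>: the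
  inner integral is over its value alone.\<close>

lemma measure_insert_nn_integral:
  assumes "finite I" "k \<in> I" and A: "A \<in> sets (P I)"
  shows "emeasure (P I) A = (\<integral>\<^sup>+x. (\<integral>\<^sup>+v. indicator A (x(k := v)) \<partial>F) \<partial>P (I - {k}))"
proof -
  have I: "insert k (I - {k}) = I" using assms by auto
  have "emeasure (P I) A = (\<integral>\<^sup>+x. indicator A x \<partial>P (insert k (I - {k})))"
    using A I by simp
  also have "\<dots> = (\<integral>\<^sup>+x. (\<integral>\<^sup>+v. indicator A (x(k := v)) \<partial>F) \<partial>P (I - {k}))"
    using assms I by (intro PP.product_nn_integral_insert) auto
  finally show ?thesis .
qed

definition tailmom :: real where "tailmom = (\<integral>x. max 0 x powr r \<partial>F)"

lemma tailmom_nonneg: "0 \<le> tailmom"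
  unfolding tailmom_def by (intro integral_nonneg_AE) auto

lemma tail_bound:
  assumes "a > 0"
  shows "measure F {a<..} \<le> tailmom * a powr (-r)"
proof -
  have "measure F {a<..} \<le> measure F {x\<in>space F. a powr r \<le> max 0 x powr r}"
    using assms r by (intro finite_measure_mono) (auto intro!: powr_mono2)
  also have "\<dots> \<le> tailmom / (a powr r)"
    unfolding tailmom_def
    by (rule integral_Markov_inequality_measure[where A = UNIV]) (use moment assms in auto)
  finally show ?thesis by (simp add: powr_minus divide_inverse)
qed

lemma f_le_tail: "f x \<le> measure F {x<..}"
  unfolding F_Delta_def by (intro finite_measure_mono) (auto simp: mem_translate_Delta)

lemma f_le: "a > 0 \<Longrightarrow> f a \<le> tailmom * a powr (-r)"
  using f_le_tail[of a] tail_bound[of a] by linarith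

section \<open>Weak law of large numbers, uniform in the number of terms\<close>

lemma truncation:
  assumes "\<epsilon> > 0"
  obtains K where "K > 0" "(\<integral>x. \<bar>x\<bar> * indicator {x. K < \<bar>x\<bar>} x \<partial>F) \<le> \<epsilon>"
proof -
  have "(\<lambda>n. \<integral>x. \<bar>x\<bar> * indicator {x. real n < \<bar>x\<bar>} x \<partial>F) \<longlonglongrightarrow> (\<integral>x. 0 \<partial>F)"
  proof (rule integral_dominated_convergence[where w = "\<lambda>x. \<bar>x\<bar>"])
    show "AE x in F. (\<lambda>n. \<bar>x\<bar> * indicator {x. real n < \<bar>x\<bar>} x) \<longlonglongrightarrow> 0"
    proof (rule AE_I2)
      fix x :: real
      have "\<forall>\<^sub>F n in sequentially. \<bar>x\<bar> * indicator {x. real n < \<bar>x\<bar>} x = 0"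
        using eventually_ge_at_top[of "nat \<lceil>\<bar>x\<bar>\<rceil>"]
        by eventually_elim (auto simp: indicator_def not_less nat_le_iff ceiling_le_iff)
      then show "(\<lambda>n. \<bar>x\<bar> * indicator {x. real n < \<bar>x\<bar>} x) \<longlonglongrightarrow> 0"
        by (rule tendsto_eventually)
    qed
    show "integrable F (\<lambda>x. \<bar>x\<bar>)" using integrable_id by simp
    show "(\<lambda>x. \<bar>x\<bar> * indicator {x. real n < \<bar>x\<bar>} x) \<in> borel_measurable F" for n
      unfolding borel_measurable_F by measurable
  qed (auto split: split_indicator)
  then have "\<forall>\<^sub>F n in sequentially. (\<integral>x. \<bar>x\<bar> * indicator {x. real n < \<bar>x\<bar>} x \<partial>F) < \<epsilon>"
    using assms by (intro order_tendstoD(2)) auto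
  then have "\<forall>\<^sub>F n in sequentially. n > 0 \<and> (\<integral>x. \<bar>x\<bar> * indicator {x. real n < \<bar>x\<bar>} x \<partial>F) < \<epsilon>"
    by (intro eventually_conj eventually_gt_at_top)
  then obtain n :: nat where "n > 0" "(\<integral>x. \<bar>x\<bar> * indicator {x. real n < \<bar>x\<bar>} x \<partial>F) < \<epsilon>"
    unfolding eventually_sequentially by blast
  then show ?thesis by (intro that[of "real n"]) auto
qed

lemma integrable_tail_abs: "integrable F (\<lambda>x. \<bar>x\<bar> * indicator {x. K < \<bar>x\<bar>} x)"
proof (rule Bochner_Integration.integrable_bound[OF integrable_id])
  show "(\<lambda>x. \<bar>x\<bar> * indicator {x. K < \<bar>x\<bar>} x) \<in> borel_measurable F"
    unfolding borel_measurable_F by measurable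
qed (auto split: split_indicator)

text \<open>Integrating out one coordinate at a time, the cross term vanishes because
  \<open>a\<close> has mean zero. Boundedness of \<open>a\<close> provides every integrability that
  Fubini needs.\<close>

lemma integral_square_sum:
  fixes a :: "real \<Rightarrow> real"
  assumes [measurable]: "a \<in> borel_measurable borel" and bd: "\<And>x. \<bar>a x\<bar> \<le> B"
    and zero: "(\<integral>x. a x \<partial>F) = 0" and "finite I"
  shows "integrable (P I) (\<lambda>x. (\<Sum>i\<in>I. a (x i))\<^sup>2) \<and> (\<integral>x. (\<Sum>i\<in>I. a (x i))\<^sup>2 \<partial>P I) \<le> real (card I) * B\<^sup>2"
  using \<open>finite I\<close>
proof (induction I rule: finite_induct)
  case (insert k I)
  have B: "0 \<le> B" using bd[of 0] by simp
  have ia: "integrable F a" by (rule integrable_const_bound[of _ B]) (use bd in \<open>simp_all\<close>)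
  have ia2: "integrable F (\<lambda>x. (a x)\<^sup>2)"
    by (rule integrable_const_bound[of _ "B\<^sup>2"]) (use bd B in \<open>auto simp: abs_le_square_iff[symmetric]\<close>)
  have a2: "(\<integral>x. (a x)\<^sup>2 \<partial>F) \<le> B\<^sup>2"
    using bd B by (intro integral_le_const ia2) (auto simp: abs_le_square_iff[symmetric])
  interpret PI: prob_space "P (insert k I)" by (rule prob_space_P)
  interpret PJ: prob_space "P I" by (rule prob_space_P)
  have s: "\<bar>\<Sum>i\<in>insert k I. a (x i)\<bar> \<le> real (card (insert k I)) * B" for x :: "nat \<Rightarrow> real"
  proof -
    have "\<bar>\<Sum>i\<in>insert k I. a (x i)\<bar> \<le> (\<Sum>i\<in>insert k I. \<bar>a (x i)\<bar>)" by (rule sum_abs)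
    also have "\<dots> \<le> (\<Sum>i\<in>insert k I. B)" by (intro sum_mono bd)
    finally show ?thesis by simp
  qed
  have int: "integrable (P (insert k I)) (\<lambda>x. (\<Sum>i\<in>insert k I. a (x i))\<^sup>2)"
  proof (rule PI.integrable_const_bound[of _ "(real (card (insert k I)) * B)\<^sup>2"])
    show "AE x in P (insert k I). norm ((\<Sum>i\<in>insert k I. a (x i))\<^sup>2) \<le> (real (card (insert k I)) * B)\<^sup>2"
      using s B by (intro AE_I2) (auto simp: abs_le_square_iff[symmetric])
    show "(\<lambda>x. (\<Sum>i\<in>insert k I. a (x i))\<^sup>2) \<in> borel_measurable (P (insert k I))"
      by measurable
  qed
  have "(\<integral>x. (\<Sum>i\<in>insert k I. a (x i))\<^sup>2 \<partial>P (insert k I))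
      = (\<integral>x. (\<integral>y. (\<Sum>i\<in>insert k I. a ((x(k := y)) i))\<^sup>2 \<partial>F) \<partial>P I)"
    by (rule PP.product_integral_insert[OF insert(1,2) int])
  also have "\<dots> = (\<integral>x. (\<integral>y. (a y)\<^sup>2 \<partial>F) + (\<Sum>i\<in>I. a (x i))\<^sup>2 \<partial>P I)"
  proof (intro Bochner_Integration.integral_cong refl)
    fix x
    have *: "(\<Sum>i\<in>insert k I. a ((x(k := y)) i)) = a y + (\<Sum>i\<in>I. a (x i))" for y
    proof -
      have "(\<Sum>i\<in>I. a ((x(k := y)) i)) = (\<Sum>i\<in>I. a (x i))"
        using insert(2) by (intro sum.cong) auto
      then show ?thesis using insert(1,2) by simp
    qed
    have "(\<integral>y. (\<Sum>i\<in>insert k I. a ((x(k := y)) i))\<^sup>2 \<partial>F)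
        = (\<integral>y. (a y)\<^sup>2 + (2 * (\<Sum>i\<in>I. a (x i))) * a y + (\<Sum>i\<in>I. a (x i))\<^sup>2 \<partial>F)"
      unfolding * by (intro Bochner_Integration.integral_cong refl) (simp add: power2_sum mult_ac)
    also have "\<dots> = (\<integral>y. (a y)\<^sup>2 \<partial>F) + (2 * (\<Sum>i\<in>I. a (x i))) * (\<integral>y. a y \<partial>F) + (\<Sum>i\<in>I. a (x i))\<^sup>2"
      using ia ia2 by (simp add: prob_space)
    finally show "(\<integral>y. (\<Sum>i\<in>insert k I. a ((x(k := y)) i))\<^sup>2 \<partial>F) = (\<integral>y. (a y)\<^sup>2 \<partial>F) + (\<Sum>i\<in>I. a (x i))\<^sup>2"
      using zero by simp
  qed
  also have "\<dots> = (\<integral>y. (a y)\<^sup>2 \<partial>F) + (\<integral>x. (\<Sum>i\<in>I. a (x i))\<^sup>2 \<partial>P I)"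
    using insert.IH by (simp add: PJ.prob_space)
  also have "\<dots> \<le> real (card (insert k I)) * B\<^sup>2"
    using insert.IH a2 insert(1,2) by (simp add: algebra_simps)
  finally show ?case using int by simp
qed simp

text \<open>A variance need not exist, so each summand is cut at level \<open>K\<close>. The bounded
  centred part obeys Chebyshev's inequality, the rest Markov's; \<open>card I \<le> z / c\<close>
  makes both bounds depend on \<open>z\<close> only.\<close>

lemma weak_law:
  assumes c: "c > 0" and \<eta>: "\<eta> > 0" and \<epsilon>: "\<epsilon> > 0"
  obtains z0 where "z0 > 0" "\<And>z I. z \<ge> z0 \<Longrightarrow> finite I \<Longrightarrow> c * real (card I) \<le> z \<Longrightarrow>
    deviation I (\<eta> * z) \<le> \<epsilon>"
proof -
  \<comment> \<open>Chosen so that the Markov part contributes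
    \<open>4 * e / (\<eta> * c) = \<epsilon> / 2\<close>; the second entry of \<open>z0\<close>
    below does the same for the Chebyshev part.\<close>
  define e where "e = \<eta> * c * \<epsilon> / 8"
  have e: "e > 0" using assms by (simp add: e_def)
  obtain K where K: "K > 0" "(\<integral>x. \<bar>x\<bar> * indicator {x. K < \<bar>x\<bar>} x \<partial>F) \<le> e"
    using truncation[OF e] by blast
  define g where "g x = x * indicator {x. \<bar>x\<bar> \<le> K} x" for x :: real
  define k where "k x = x * indicator {x. K < \<bar>x\<bar>} x" for x :: real
  have gkm[measurable]: "g \<in> borel_measurable borel" "k \<in> borel_measurable borel"
    unfolding g_def k_def by measurable
  have gk: "x = g x + k x" for x by (auto simp: g_def k_def indicator_def)
  have kabs: "\<bar>k x\<bar> = \<bar>x\<bar> * indicator {x. K < \<bar>x\<bar>} x" for x by (auto simp: k_def indicator_def)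
  have ig: "integrable F g" by (rule integrable_const_bound[of _ K]) (use K in \<open>simp_all add: g_def split: split_indicator\<close>)
  have ika: "integrable F (\<lambda>x. \<bar>k x\<bar>)" unfolding kabs by (rule integrable_tail_abs)
  have ik: "integrable F k" by (rule Bochner_Integration.integrable_bound[OF ika]) auto
  define m where "m = (\<integral>x. g x \<partial>F)"
  define \<kappa> where "\<kappa> = (\<integral>x. k x \<partial>F)"
  have \<mu>eq: "\<mu> = m + \<kappa>" unfolding mean m_def \<kappa>_def
    using Bochner_Integration.integral_add[OF ig ik] gk by simp
  have \<kappa>: "\<bar>\<kappa>\<bar> \<le> e" unfolding \<kappa>_def using integral_abs_bound[of F k] K(2) by (simp add: kabs)
  have ka_int: "(\<integral>x. \<bar>k x\<bar> \<partial>F) \<le> e" using K(2) by (simp add: kabs)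
  have gb: "\<bar>g x\<bar> \<le> K" for x using K by (auto simp: g_def indicator_def)
  have mb: "\<bar>m\<bar> \<le> K"
  proof -
    have "\<bar>m\<bar> \<le> (\<integral>x. \<bar>g x\<bar> \<partial>F)" unfolding m_def by (rule integral_abs_bound)
    also have "\<dots> \<le> K" using ig gb by (intro integral_le_const) auto
    finally show ?thesis .
  qed
  have ab: "\<bar>g x - m\<bar> \<le> 2 * K" for x using gb[of x] mb by linarith
  have a0: "(\<integral>x. g x - m \<partial>F) = 0" using ig by (simp add: m_def prob_space)
  define z0 where "z0 = max 1 (32 * K\<^sup>2 / (\<eta>\<^sup>2 * c * \<epsilon>))"
  show ?thesis
  proof (rule that[of z0])
    fix z :: real and I :: "nat set"
    assume z: "z0 \<le> z" and I: "finite I" "c * real (card I) \<le> z"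
    have z0: "z > 0" using z by (simp add: z0_def)
    interpret PI: prob_space "P I" by (rule prob_space_P)
    let ?A = "\<lambda>x. \<Sum>i\<in>I. g (x i) - m" and ?B = "\<lambda>x. (\<Sum>i\<in>I. \<bar>k (x i)\<bar>) + real (card I) * e"
    \<comment> \<open>If the deviation exceeds \<open>\<eta> * z\<close>, then \<open>?A\<close> or
      \<open>?B\<close> reaches half of it, so \<open>?G\<close> dominates the indicator of the
      event. The summand \<open>card I * e\<close> in \<open>?B\<close> accounts for the mean of the
      cut-off parts.\<close>
    let ?G = "\<lambda>x. 4 / (\<eta> * z)\<^sup>2 * (?A x)\<^sup>2 + 2 / (\<eta> * z) * ?B x"
    have sq: "integrable (P I) (\<lambda>x. (?A x)\<^sup>2)" "(\<integral>x. (?A x)\<^sup>2 \<partial>P I) \<le> real (card I) * (2 * K)\<^sup>2"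
      using integral_square_sum[OF _ ab a0 I(1)] by auto
    have kk: "integrable (P I) (\<lambda>x. \<bar>k (x i)\<bar>)" "(\<integral>x. \<bar>k (x i)\<bar> \<partial>P I) = (\<integral>x. \<bar>k x\<bar> \<partial>F)" if "i \<in> I" for i
      using integral_component[OF that ika] by auto
    have iB: "integrable (P I) ?B" using kk by (intro Bochner_Integration.integrable_add Bochner_Integration.integrable_sum) auto
    have "(\<integral>x. ?B x \<partial>P I) = (\<Sum>i\<in>I. (\<integral>x. \<bar>k (x i)\<bar> \<partial>P I)) + real (card I) * e"
      using kk(1) by (subst Bochner_Integration.integral_add) (auto simp: PI.prob_space intro!: Bochner_Integration.integral_sum)
    also have "\<dots> \<le> (\<Sum>i\<in>I. e) + real (card I) * e"
      using kk(2) ka_int by (intro add_right_mono sum_mono) auto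
    finally have B: "(\<integral>x. ?B x \<partial>P I) \<le> 2 * real (card I) * e" by (simp add: mult_ac)
    have "deviation I (\<eta> * z) \<le> (\<integral>x. ?G x \<partial>P I)"
    proof (rule measure_le_integral)
      show "finite_measure (P I)" by (rule PI.finite_measure_axioms)
      show "integrable (P I) ?G" by (intro Bochner_Integration.integrable_add[OF integrable_mult_right[OF sq(1)] integrable_mult_right[OF iB]])
      show "{x \<in> space (P I). \<eta> * z < \<bar>sum x I - real (card I) * \<mu>\<bar>} \<in> sets (P I)" by measurable
      have Bn: "0 \<le> ?B x" for x using e by (intro add_nonneg_nonneg sum_nonneg) auto
      show "0 \<le> ?G x" for x
      proof -
        have "0 \<le> 2 / (\<eta> * z) * ?B x" by (rule mult_nonneg_nonneg[OF _ Bn]) (use \<eta> z0 in auto)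
        moreover have "0 \<le> 4 / (\<eta> * z)\<^sup>2 * (?A x)\<^sup>2" by (intro mult_nonneg_nonneg) auto
        ultimately show ?thesis by linarith
      qed
      fix x assume "x \<in> {x \<in> space (P I). \<eta> * z < \<bar>sum x I - real (card I) * \<mu>\<bar>}"
      then have "\<eta> * z < \<bar>(\<Sum>i\<in>I. x i) - real (card I) * \<mu>\<bar>" by simp
      also have "(\<Sum>i\<in>I. x i) - real (card I) * \<mu> = ?A x + ((\<Sum>i\<in>I. k (x i)) - real (card I) * \<kappa>)"
      proof -
        have "(\<Sum>i\<in>I. x i) = (\<Sum>i\<in>I. g (x i) + k (x i))" by (intro sum.cong refl gk)
        then show ?thesis unfolding \<mu>eq by (simp add: sum.distrib sum_subtractf algebra_simps)
      qed
      finally have "\<eta> * z < \<bar>?A x\<bar> + \<bar>(\<Sum>i\<in>I. k (x i)) - real (card I) * \<kappa>\<bar>" by linarith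
      moreover have "\<bar>(\<Sum>i\<in>I. k (x i)) - real (card I) * \<kappa>\<bar> \<le> ?B x"
      proof -
        have "\<bar>\<Sum>i\<in>I. k (x i)\<bar> \<le> (\<Sum>i\<in>I. \<bar>k (x i)\<bar>)" by (rule sum_abs)
        moreover have "\<bar>real (card I) * \<kappa>\<bar> \<le> real (card I) * e" using \<kappa> by (simp add: abs_mult mult_left_mono)
        ultimately show ?thesis by linarith
      qed
      ultimately have "\<eta> * z / 2 \<le> \<bar>?A x\<bar> \<or> \<eta> * z / 2 \<le> ?B x" by linarith
      then show "1 \<le> ?G x"
      proof
        assume a: "\<eta> * z / 2 \<le> \<bar>?A x\<bar>"
        have "(\<eta> * z / 2)\<^sup>2 \<le> (?A x)\<^sup>2" using a \<eta> z0 by (intro abs_le_square_iff[THEN iffD1]) auto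
        then have "1 \<le> 4 / (\<eta> * z)\<^sup>2 * (?A x)\<^sup>2" using \<eta> z0 by (simp add: field_simps power2_eq_square)
        moreover have "0 \<le> 2 / (\<eta> * z) * ?B x" by (rule mult_nonneg_nonneg[OF _ Bn]) (use \<eta> z0 in auto)
        ultimately show ?thesis by linarith
      next
        assume a: "\<eta> * z / 2 \<le> ?B x"
        have "2 / (\<eta> * z) * (\<eta> * z / 2) \<le> 2 / (\<eta> * z) * ?B x" using a \<eta> z0 by (intro mult_left_mono) auto
        then have "1 \<le> 2 / (\<eta> * z) * ?B x" using \<eta> z0 by simp
        moreover have "0 \<le> 4 / (\<eta> * z)\<^sup>2 * (?A x)\<^sup>2" by (intro mult_nonneg_nonneg) auto
        ultimately show ?thesis by linarith
      qed
    qed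
    also have "\<dots> = 4 / (\<eta> * z)\<^sup>2 * (\<integral>x. (?A x)\<^sup>2 \<partial>P I) + 2 / (\<eta> * z) * (\<integral>x. ?B x \<partial>P I)"
      by (subst Bochner_Integration.integral_add[OF integrable_mult_right[OF sq(1)] integrable_mult_right[OF iB]])
         (simp only: integral_mult_right_zero)
    also have "\<dots> \<le> 4 / (\<eta> * z)\<^sup>2 * (real (card I) * (2 * K)\<^sup>2) + 2 / (\<eta> * z) * (2 * real (card I) * e)"
      using sq(2) B \<eta> z0 by (intro add_mono mult_left_mono) auto
    also have "\<dots> \<le> 4 / (\<eta> * z)\<^sup>2 * (z / c * (2 * K)\<^sup>2) + 2 / (\<eta> * z) * (2 * (z / c) * e)"
      using I(2) c \<eta> z0 e by (intro add_mono mult_left_mono mult_right_mono) (auto simp: field_simps)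
    also have "\<dots> = 16 * K\<^sup>2 / (\<eta>\<^sup>2 * c) / z + 4 * e / (\<eta> * c)"
      using z0 \<eta> c by (simp add: field_simps power2_eq_square)
    also have "4 * e / (\<eta> * c) = \<epsilon> / 2" using \<eta> c by (simp add: e_def)
    also have "16 * K\<^sup>2 / (\<eta>\<^sup>2 * c) / z \<le> \<epsilon> / 2"
    proof -
      have "32 * K\<^sup>2 / (\<eta>\<^sup>2 * c * \<epsilon>) \<le> z" using z by (simp add: z0_def)
      then show ?thesis using z0 \<eta> c \<epsilon> by (simp add: field_simps)
    qed
    finally show "deviation I (\<eta> * z) \<le> \<epsilon>" by simp
  qed (simp add: z0_def)
qed

section \<open>Exponential bounds for truncated summands\<close>

lemma exp_moment_bound:
  assumes h: "0 < h" and a: "0 \<le> a" and K: "0 \<le> K"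
    and e: "(\<integral>x. \<bar>x\<bar> * indicator {x. K < \<bar>x\<bar>} x \<partial>F) \<le> e"
  shows "(\<integral>\<^sup>+x. ennreal (exp (h * min x a)) \<partial>F)
    \<le> ennreal (exp (h * \<mu> + (h * e + h\<^sup>2 * K\<^sup>2 + h powr r * exp (h * a) * tailmom)))"
proof -
  let ?b = "\<lambda>x. 1 + h * x + h * (\<bar>x\<bar> * indicator {x. K < \<bar>x\<bar>} x) + h\<^sup>2 * K\<^sup>2
     + h powr r * exp (h * a) * max 0 x powr r"
  have le: "exp (h * min x a) \<le> ?b x" for x using exp_min_bound[OF h a K] r by simp
  have int: "integrable F ?b"
    by (intro Bochner_Integration.integrable_add integrable_mult_right integrable_tail_abs integrable_id moment) auto
  have "(\<integral>\<^sup>+x. ennreal (exp (h * min x a)) \<partial>F) \<le> (\<integral>\<^sup>+x. ennreal (?b x) \<partial>F)"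
    by (intro nn_integral_mono ennreal_leI le)
  also have "\<dots> = ennreal (\<integral>x. ?b x \<partial>F)"
    by (intro nn_integral_eq_integral int AE_I2) (use le in \<open>meson exp_ge_zero order_trans\<close>)
  also have "(\<integral>x. ?b x \<partial>F) = 1 + h * \<mu> + h * (\<integral>x. \<bar>x\<bar> * indicator {x. K < \<bar>x\<bar>} x \<partial>F) + h\<^sup>2 * K\<^sup>2
     + h powr r * exp (h * a) * tailmom"
    using integrable_id integrable_tail_abs[of K] moment
    by (simp add: mean tailmom_def)
  also have "\<dots> \<le> 1 + (h * \<mu> + (h * e + h\<^sup>2 * K\<^sup>2 + h powr r * exp (h * a) * tailmom))"
    using h e by simp
  also have "\<dots> \<le> exp (h * \<mu> + (h * e + h\<^sup>2 * K\<^sup>2 + h powr r * exp (h * a) * tailmom))"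
    by (rule exp_ge_add_one_self)
  finally show ?thesis by (simp add: ennreal_leI)
qed

text \<open>Chernoff's inequality for the capped variables \<open>min (x i) a\<close>: on the event
  considered the cap changes nothing, while the product of exponential moments factorises by
  independence.\<close>

lemma truncated_sum_exp_bound:
  assumes h: "0 < h" and a: "0 \<le> a" and K: "0 \<le> K" and I: "finite I"
    and e: "(\<integral>x. \<bar>x\<bar> * indicator {x. K < \<bar>x\<bar>} x \<partial>F) \<le> e"
  shows "truncated_tail I a z
    \<le> exp (- h * z + real (card I) * (h * e + h\<^sup>2 * K\<^sup>2 + h powr r * exp (h * a) * tailmom))"
proof -
  interpret PI: prob_space "P I" by (rule prob_space_P)
  define R where "R = h * e + h\<^sup>2 * K\<^sup>2 + h powr r * exp (h * a) * tailmom"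
  let ?n = "real (card I)"
  let ?A = "{x\<in>space (P I). (\<forall>i\<in>I. x i \<le> a) \<and> ?n * \<mu> + z < (\<Sum>i\<in>I. x i)}"
  have A: "?A \<in> sets (P I)" using I by measurable
  have "emeasure (P I) ?A = (\<integral>\<^sup>+x. indicator ?A x \<partial>P I)" using A by simp
  also have "\<dots> \<le> (\<integral>\<^sup>+x. ennreal (exp (- h * (?n * \<mu> + z))) * (\<Prod>i\<in>I. ennreal (exp (h * min (x i) a))) \<partial>P I)"
  proof (rule nn_integral_mono)
    fix x
    show "indicator ?A x \<le> ennreal (exp (- h * (?n * \<mu> + z))) * (\<Prod>i\<in>I. ennreal (exp (h * min (x i) a)))"
    proof (cases "x \<in> ?A")
      case True
      then have m: "(\<Sum>i\<in>I. min (x i) a) = (\<Sum>i\<in>I. x i)" by (intro sum.cong) auto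
      have "(\<Prod>i\<in>I. ennreal (exp (h * min (x i) a))) = ennreal (exp (h * (\<Sum>i\<in>I. x i)))"
        using I by (simp add: prod_ennreal exp_sum sum_distrib_left m[symmetric])
      then have "ennreal (exp (- h * (?n * \<mu> + z))) * (\<Prod>i\<in>I. ennreal (exp (h * min (x i) a)))
          = ennreal (exp (h * ((\<Sum>i\<in>I. x i) - (?n * \<mu> + z))))"
        by (simp add: ennreal_mult'[symmetric] exp_add[symmetric] algebra_simps)
      also have "\<dots> \<ge> ennreal 1" using True h by (intro ennreal_leI) auto
      finally show ?thesis using True by simp
    qed simp
  qed
  also have "\<dots> = ennreal (exp (- h * (?n * \<mu> + z))) * (\<integral>\<^sup>+x. (\<Prod>i\<in>I. ennreal (exp (h * min (x i) a))) \<partial>P I)"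
    using I by (intro nn_integral_cmult) measurable
  also have "(\<integral>\<^sup>+x. (\<Prod>i\<in>I. ennreal (exp (h * min (x i) a))) \<partial>P I)
      = (\<Prod>i\<in>I. (\<integral>\<^sup>+x. ennreal (exp (h * min x a)) \<partial>F))"
    using I by (intro PP.product_nn_integral_prod) simp_all
  also have "\<dots> \<le> (\<Prod>i\<in>I. ennreal (exp (h * \<mu> + R)))"
    unfolding R_def by (intro prod_mono_ennreal exp_moment_bound h a K e)
  also have "\<dots> = ennreal (exp (?n * (h * \<mu> + R)))"
    by (simp add: ennreal_power exp_of_nat_mult[symmetric])
  also have "ennreal (exp (- h * (?n * \<mu> + z))) * ennreal (exp (?n * (h * \<mu> + R))) = ennreal (exp (- h * z + ?n * R))"
    by (simp add: ennreal_mult'[symmetric] exp_add[symmetric] algebra_simps)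
  finally have "emeasure (P I) ?A \<le> ennreal (exp (- h * z + ?n * R))"
    by (simp add: mult_left_mono)
  then show ?thesis unfolding R_def[symmetric] by (simp add: PI.emeasure_eq_measure)
qed

text \<open>With \<open>h = M * ln z / z\<close> the main factor is \<open>z powr (-M)\<close>. The
  three correction terms, summed over at most \<open>z / c\<close> summands, contribute at most
  \<open>ln z + 2\<close> to the exponent.\<close>

lemma truncated_sum_bound:
  assumes c: "c > 0" and s: "s \<ge> 0"
  obtains \<theta> z0 where "0 < \<theta>" "\<theta> \<le> 1/4" "z0 > 0"
    "\<And>z I. z \<ge> z0 \<Longrightarrow> finite I \<Longrightarrow> c * real (card I) \<le> z \<Longrightarrow>
      truncated_tail I (\<theta> * z) z \<le> z powr (-s)"
proof -
  \<comment> \<open>Of the two extra units, one cancels the correction \<open>ln z\<close>; the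
    other absorbs the constant 2, which is why \<open>exp 2 \<le> z\<close> is required
    below.\<close>
  define M where "M = s + 2"
  have M: "M > 0" using s by (simp add: M_def)
  \<comment> \<open>Then \<open>z / c * h * e\<close> equals exactly \<open>ln z\<close>.\<close>
  define e where "e = c / M"
  have e: "e > 0" using c M by (simp add: e_def)
  obtain K where K: "K > 0" "(\<integral>x. \<bar>x\<bar> * indicator {x. K < \<bar>x\<bar>} x \<partial>F) \<le> e"
    using truncation[OF e] by blast
  \<comment> \<open>The cap inflates the moment term by \<open>z powr (\<theta> * M)\<close>, at
    most half of the gain \<open>z powr (r - 1)\<close> on the exponent scale. The bound 1/4 keeps
    \<open>\<theta> * z\<close> below every point near \<open>z\<close> at which a jump may have to
    land.\<close>
  define \<theta> where "\<theta> = min (1/4) ((r - 1) / (2 * M))"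
  have \<theta>: "0 < \<theta>" "\<theta> \<le> 1/4" "\<theta> * M \<le> (r - 1) / 2" using M r by (auto simp: \<theta>_def min_def field_simps)
  define m where "m = M powr r * tailmom / c"
  define d where "d = (r - 1) / 2"
  have d: "d > 0" using r by (simp add: d_def)
  have r0: "r > 0" using r by simp
  have "((\<lambda>z. M\<^sup>2 * K\<^sup>2 / c * ((ln z)\<^sup>2 / z)) \<longlongrightarrow> M\<^sup>2 * K\<^sup>2 / c * 0) at_top"
    by (intro tendsto_mult tendsto_const) real_asymp
  then have 1: "\<forall>\<^sub>F z in at_top. M\<^sup>2 * K\<^sup>2 / c * ((ln z)\<^sup>2 / z) < 1"
    by (rule order_tendstoD) simp
  have "((\<lambda>z::real. m * (ln z powr r * z powr (-d))) \<longlongrightarrow> m * 0) at_top"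
    by (intro tendsto_mult tendsto_const) (use d r0 in real_asymp)
  then have 2: "\<forall>\<^sub>F z in at_top. m * (ln z powr r * z powr (-d)) < 1"
    by (rule order_tendstoD) simp
  have "\<forall>\<^sub>F z in at_top. M\<^sup>2 * K\<^sup>2 / c * ((ln z)\<^sup>2 / z) < 1 \<and> m * (ln z powr r * z powr (-d)) < 1 \<and> exp 2 \<le> z"
    by (intro eventually_conj 1 2 eventually_ge_at_top)
  then obtain z0 where z0: "\<And>z. z \<ge> z0 \<Longrightarrow> M\<^sup>2 * K\<^sup>2 / c * ((ln z)\<^sup>2 / z) < 1 \<and> m * (ln z powr r * z powr (-d)) < 1 \<and> exp 2 \<le> z"
    unfolding eventually_at_top_linorder by blast
  show ?thesis
  proof (rule that[OF \<theta>(1,2), of "max 1 z0"])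
    fix z :: real and I :: "nat set"
    assume z: "max 1 z0 \<le> z" and I: "finite I" "c * real (card I) \<le> z"
    have zz: "M\<^sup>2 * K\<^sup>2 / c * ((ln z)\<^sup>2 / z) < 1" "m * (ln z powr r * z powr (-d)) < 1" "exp 2 \<le> z"
      using z0[of z] z by auto
    have zp: "z > 0" using z by simp
    have lz: "ln z \<ge> 2" using zz(3) zp by (simp add: ln_ge_iff)
    let ?n = "real (card I)"
    have n: "0 \<le> ?n" "?n \<le> z / c" using I c by (auto simp: field_simps)
    define h where "h = M * ln z / z"
    have h: "h > 0" unfolding h_def using M lz zp by (intro divide_pos_pos mult_pos_pos) linarith+
    have a: "0 \<le> \<theta> * z" using \<theta> zp by simp
    have t1: "?n * (h * e) \<le> ln z"
    proof -
      have "?n * (h * e) \<le> z / c * (h * e)" using n h e by (intro mult_right_mono) auto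
      also have "\<dots> = ln z" using zp c M by (simp add: h_def e_def)
      finally show ?thesis .
    qed
    have t2: "?n * (h\<^sup>2 * K\<^sup>2) \<le> 1"
    proof -
      have "?n * (h\<^sup>2 * K\<^sup>2) \<le> z / c * (h\<^sup>2 * K\<^sup>2)" using n by (intro mult_right_mono) auto
      also have "\<dots> = M\<^sup>2 * K\<^sup>2 / c * ((ln z)\<^sup>2 / z)" using zp c by (simp add: h_def field_simps power2_eq_square)
      finally show ?thesis using zz(1) by linarith
    qed
    have t3: "?n * (h powr r * exp (h * (\<theta> * z)) * tailmom) \<le> 1"
    proof -
      have "exp (h * (\<theta> * z)) = z powr (\<theta> * M)" using zp by (simp add: h_def powr_def)
      also have "\<dots> \<le> z powr d" using \<theta>(3) z by (intro powr_mono) (auto simp: d_def)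
      finally have E: "exp (h * (\<theta> * z)) \<le> z powr d" .
      have H: "h powr r = M powr r * ln z powr r * z powr (-r)"
        unfolding h_def using M lz zp by (simp add: powr_divide powr_mult powr_minus field_simps)
      have "?n * (h powr r * exp (h * (\<theta> * z)) * tailmom) \<le> z / c * (h powr r * z powr d * tailmom)"
        using n E tailmom_nonneg by (intro mult_mono mult_right_mono mult_left_mono mult_nonneg_nonneg) auto
      also have "\<dots> = m * (ln z powr r * (z powr 1 * z powr (-r) * z powr d))"
        unfolding H m_def using zp by (simp add: field_simps)
      also have "z powr 1 * z powr (-r) * z powr d = z powr (-d)"
        unfolding powr_add[symmetric] by (rule arg_cong[where f = "(powr) z"]) (simp add: d_def field_simps)
      finally show ?thesis using zz(2) by linarith
    qed
    have "truncated_tail I (\<theta> * z) z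
      \<le> exp (- h * z + ?n * (h * e + h\<^sup>2 * K\<^sup>2 + h powr r * exp (h * (\<theta> * z)) * tailmom))"
      using K by (intro truncated_sum_exp_bound h a I) auto
    also have "\<dots> \<le> exp (- s * ln z)"
    proof -
      have "?n * (h * e + h\<^sup>2 * K\<^sup>2 + h powr r * exp (h * (\<theta> * z)) * tailmom) \<le> ln z + 1 + 1"
        using t1 t2 t3 by (simp add: distrib_left)
      moreover have "h * z = M * ln z" using zp by (simp add: h_def)
      moreover have "M * ln z = s * ln z + 2 * ln z" by (simp add: M_def algebra_simps)
      ultimately show ?thesis using lz by simp
    qed
    also have "\<dots> = z powr (-s)" using zp by (simp add: powr_def)
    finally show "truncated_tail I (\<theta> * z) z \<le> z powr (-s)" .
  qed simp
qed

section \<open>Conditioning on the other summands\<close>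

text \<open>Given the sum \<open>s\<close> of the other terms, the jump must exceed \<open>a\<close>
  and lie in the translate of \<Delta> by \<open>y - s\<close>. Raising the left end to the maximum
  of the two only shortens the distance to the jump, so it lies in the translate by that maximum.
  \<open>U1\<close> serves typical \<open>s\<close>, and \<open>U2\<close> all others.\<close>

lemma large_jump_bound:
  assumes I: "finite I" "k \<in> I" and U: "0 \<le> U1" "0 \<le> U2"
    and good: "\<And>s. \<bar>s - real (card (I - {k})) * \<mu>\<bar> \<le> b \<Longrightarrow> f (max (y - s) a) \<le> U1"
    and bad: "\<And>s. f (max (y - s) a) \<le> U2"
  shows "measure (P I) {x\<in>space (P I). a < x k \<and> (\<Sum>i\<in>I. x i) \<in> translate y (Delta T)} \<le> U1 +
    U2 * deviation (I - {k}) b"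
proof -
  interpret PI: prob_space "P I" by (rule prob_space_P)
  interpret PJ: prob_space "P (I - {k})" by (rule prob_space_P)
  let ?J = "I - {k}"
  let ?A = "{x\<in>space (P I). a < x k \<and> (\<Sum>i\<in>I. x i) \<in> translate y (Delta T)}"
  let ?B = "{x\<in>space (P ?J). b < \<bar>(\<Sum>i\<in>?J. x i) - real (card ?J) * \<mu>\<bar>}"
  have A: "?A \<in> sets (P I)" using I by measurable
  have B: "?B \<in> sets (P ?J)" by measurable
  have "emeasure (P I) ?A = (\<integral>\<^sup>+x. (\<integral>\<^sup>+v. indicator ?A (x(k := v)) \<partial>F) \<partial>P ?J)"
    by (rule measure_insert_nn_integral[OF I A])
  also have "\<dots> \<le> (\<integral>\<^sup>+x. ennreal U1 + ennreal U2 * indicator ?B x \<partial>P ?J)"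
  proof (rule nn_integral_mono)
    fix x assume x: "x \<in> space (P ?J)"
    let ?s = "\<Sum>i\<in>?J. x i"
    have "(\<integral>\<^sup>+v. indicator ?A (x(k := v)) \<partial>F) \<le> (\<integral>\<^sup>+v. indicator (translate (max (y - ?s) a) (Delta T)) v \<partial>F)"
    proof (rule nn_integral_mono)
      fix v
      have S: "(\<Sum>i\<in>I. (x(k := v)) i) = v + ?s"
        using I by (subst sum.remove[of _ k]) (auto intro!: sum.cong)
      show "indicator ?A (x(k := v)) \<le> (indicator (translate (max (y - ?s) a) (Delta T)) v :: ennreal)"
      proof (cases "x(k := v) \<in> ?A")
        case True
        then have "a < v" "y < v + ?s" "ereal (v + ?s - y) \<le> T" using S by (auto simp: mem_translate_Delta)
        moreover have "ereal (v - max (y - ?s) a) \<le> ereal (v + ?s - y)" by auto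
        ultimately have "max (y - ?s) a < v" "ereal (v - max (y - ?s) a) \<le> T"
          by (auto intro: order_trans simp del: ereal_less_eq)
        then have "v \<in> translate (max (y - ?s) a) (Delta T)"
          unfolding mem_translate_Delta by blast
        then show ?thesis by (auto split: split_indicator)
      qed simp
    qed
    also have "\<dots> = ennreal (f (max (y - ?s) a))"
      by (simp add: F_Delta_def emeasure_eq_measure)
    also have "\<dots> \<le> ennreal U1 + ennreal U2 * indicator ?B x"
    proof (cases "x \<in> ?B")
      case True
      have "ennreal (f (max (y - ?s) a)) \<le> ennreal U2" by (intro ennreal_leI bad)
      also have "\<dots> \<le> ennreal U1 + ennreal U2 * indicator ?B x" using True by simp
      finally show ?thesis .
    next
      case False
      then show ?thesis using x by (auto intro!: ennreal_leI good)
    qed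
    finally show "(\<integral>\<^sup>+v. indicator ?A (x(k := v)) \<partial>F) \<le> ennreal U1 + ennreal U2 * indicator ?B x" .
  qed
  also have "\<dots> = ennreal U1 + ennreal U2 * emeasure (P ?J) ?B"
    using B by (simp add: nn_integral_add nn_integral_cmult PJ.emeasure_space_1)
  also have "\<dots> = ennreal (U1 + U2 * measure (P ?J) ?B)"
    using U by (subst ennreal_plus) (auto simp: PJ.emeasure_eq_measure ennreal_mult)
  finally show ?thesis
    unfolding PI.emeasure_eq_measure using U by (subst (asm) ennreal_le_iff) auto
qed

text \<open>The restriction to typical values of the other summands involves only the coordinates in
  \<open>I - {k}\<close>, hence factors out. Capping these summands at \<open>a\<close> is what
  makes the events for different \<open>k\<close> disjoint later.\<close>

lemma single_jump_bound:
  assumes I: "finite I" "k \<in> I" and U: "0 \<le> U"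
    and good: "\<And>s. \<bar>s - real (card (I - {k})) * \<mu>\<bar> \<le> b \<Longrightarrow> U \<le> f (y - s)"
  shows "U * measure (P (I - {k})) {x\<in>space (P (I - {k})). \<bar>(\<Sum>i\<in>I - {k}. x i) - real (card (I - {k})) * \<mu>\<bar> \<le> b \<and> (\<forall>i\<in>I - {k}. x i \<le> a)}
   \<le> measure (P I) {x\<in>space (P I). (\<bar>(\<Sum>i\<in>I - {k}. x i) - real (card (I - {k})) * \<mu>\<bar> \<le> b \<and> (\<forall>i\<in>I - {k}. x i \<le> a))
       \<and> (\<Sum>i\<in>I. x i) \<in> translate y (Delta T)}"
proof -
  interpret PI: prob_space "P I" by (rule prob_space_P)
  interpret PJ: prob_space "P (I - {k})" by (rule prob_space_P)
  let ?J = "I - {k}"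
  let ?Q = "\<lambda>x::nat \<Rightarrow> real. \<bar>(\<Sum>i\<in>?J. x i) - real (card ?J) * \<mu>\<bar> \<le> b \<and> (\<forall>i\<in>?J. x i \<le> a)"
  let ?A = "{x\<in>space (P I). ?Q x \<and> (\<Sum>i\<in>I. x i) \<in> translate y (Delta T)}"
  let ?B = "{x\<in>space (P ?J). ?Q x}"
  have A: "?A \<in> sets (P I)" using I by measurable
  have B: "?B \<in> sets (P ?J)" using I by measurable
  have "ennreal (U * measure (P ?J) ?B) = (\<integral>\<^sup>+x. ennreal U * indicator ?B x \<partial>P ?J)"
    using U B by (simp add: nn_integral_cmult PJ.emeasure_eq_measure ennreal_mult')
  also have "\<dots> \<le> (\<integral>\<^sup>+x. (\<integral>\<^sup>+v. indicator ?A (x(k := v)) \<partial>F) \<partial>P ?J)"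
  proof (rule nn_integral_mono)
    fix x assume x: "x \<in> space (P ?J)"
    let ?s = "\<Sum>i\<in>?J. x i"
    show "ennreal U * indicator ?B x \<le> (\<integral>\<^sup>+v. indicator ?A (x(k := v)) \<partial>F)"
    proof (cases "x \<in> ?B")
      case True
      then have Q: "?Q x" by simp
      have "ennreal U \<le> ennreal (f (y - ?s))" using Q by (intro ennreal_leI good) auto
      also have "\<dots> = (\<integral>\<^sup>+v. indicator (translate (y - ?s) (Delta T)) v \<partial>F)"
        by (simp add: F_Delta_def emeasure_eq_measure)
      also have "\<dots> \<le> (\<integral>\<^sup>+v. indicator ?A (x(k := v)) \<partial>F)"
      proof (rule nn_integral_mono)
        fix v
        have S: "(\<Sum>i\<in>I. (x(k := v)) i) = v + ?s"
          using I by (subst sum.remove[of _ k]) (auto intro!: sum.cong)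
        have S': "(\<Sum>i\<in>?J. (x(k := v)) i) = ?s" by (intro sum.cong) auto
        have sp: "x(k := v) \<in> space (P I)"
          using x I by (auto simp: space_PiM PiE_iff extensional_def)
        show "indicator (translate (y - ?s) (Delta T)) v \<le> (indicator ?A (x(k := v)) :: ennreal)"
        proof (cases "v \<in> translate (y - ?s) (Delta T)")
          case True
          then have "v + ?s \<in> translate y (Delta T)" by (auto simp: mem_translate_Delta algebra_simps)
          moreover have "?Q (x(k := v))" using Q S' by auto
          ultimately have "x(k := v) \<in> ?A" using S sp by simp
          then show ?thesis unfolding indicator_simps(1)[OF True] by (subst indicator_simps(1)) auto
        qed simp
      qed
      finally show ?thesis using True by simp
    qed simp
  qed
  also have "\<dots> = emeasure (P I) ?A"
    by (rule measure_insert_nn_integral[OF I A, symmetric])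
  finally show ?thesis by (simp add: PI.emeasure_eq_measure)
qed

section \<open>Sharp bounds for local probabilities of sums\<close>

text \<open>A union bound over the index of a summand above \<open>\<theta> * z\<close>, plus the
  event that there is none. Typical jumps cost \<open>K1 * f z\<close> each; the gap between
  \<open>K1\<close> and \<open>K\<close> pays for everything else.\<close>

lemma sum_upper_bound:
  assumes c: "c > 0" and K: "L_index f < ereal K"
  obtains z0 where "z0 > 0" "\<And>z I. z \<ge> z0 \<Longrightarrow> finite I \<Longrightarrow> c * real (card I) \<le> z \<Longrightarrow>
    sum_prob I (z + real (card I) * \<mu>)
      \<le> real (card I) * (K * f z)"
proof -
  obtain L where L: "L_index f = ereal L" "L \<ge> 1" using O_regularly_varying_L_index[OF OR AD] by blast
  define K1 where "K1 = (L + K) / 2"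
  have K1: "L < K1" "K1 < K" using K L by (auto simp: K1_def)
  obtain \<eta>' where \<eta>': "\<eta>' > 0" "\<forall>\<^sub>F x in at_top. \<forall>z\<in>{(1 - \<eta>') * x..(1 + \<eta>') * x}. f z \<le> K1 * f x"
    using L_index_lessD[OF eventually_pos, of K1] L K1 by auto
  obtain s c0 x2 where s: "0 \<le> s" "c0 > 0" "x2 > 0" "\<And>x. x \<ge> x2 \<Longrightarrow> c0 * x powr (-s) \<le> f x"
    using O_regularly_varying_power_bound[OF OR AD] by metis
  \<comment> \<open>One power more than the lower bound on \<open>f\<close>, so that the event
    without a large summand has probability at most \<open>f z / (c0 * z)\<close>.\<close>
  obtain \<theta> z1 where \<theta>: "0 < \<theta>" "\<theta> \<le> 1/4" "z1 > 0"
    "\<And>z I. z \<ge> z1 \<Longrightarrow> finite I \<Longrightarrow> c * real (card I) \<le> z \<Longrightarrow>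
      truncated_tail I (\<theta> * z) z \<le> z powr (-(s + 1))"
    by (rule truncated_sum_bound[OF c, of "s + 1"]) (use s(1) in simp, rule that)
  obtain C x1 where C: "C > 0" "x1 > 0" "\<And>x u. x \<ge> x1 \<Longrightarrow> u \<ge> \<theta> * x \<Longrightarrow> f u \<le> C * f x"
    using O_regularly_varying_dominated[OF OR AD \<theta>(1)] by metis
  \<comment> \<open>At most half of \<open>\<eta>'\<close>: besides the deviation
    \<open>\<eta> * z\<close>, the mean \<mu> of the removed summand shifts the landing point, again
    by at most \<open>\<eta> * z\<close>. The bound by 1/2 keeps this point above
    \<open>\<theta> * z\<close>.\<close>
  define \<eta> where "\<eta> = min \<eta>' (1/2) / 2"
  have \<eta>: "\<eta> > 0" "2 * \<eta> \<le> \<eta>'" "2 * \<eta> \<le> 1/2" using \<eta>' by (auto simp: \<eta>_def)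
  \<comment> \<open>An atypical sum of the others then costs \<open>C * f z * \<epsilon>\<close>,
    half of the gap \<open>(K - K1) * f z\<close>; the other half is left for the event without a
    large summand.\<close>
  define \<epsilon> where "\<epsilon> = (K - K1) / (2 * C)"
  have \<epsilon>: "\<epsilon> > 0" using K1 C by (simp add: \<epsilon>_def)
  obtain z2 where z2: "z2 > 0" "\<And>z I. z \<ge> z2 \<Longrightarrow> finite I \<Longrightarrow> c * real (card I) \<le> z \<Longrightarrow>
    deviation I (\<eta> * z) \<le> \<epsilon>"
    by (rule weak_law[OF c \<eta>(1) \<epsilon>]) (rule that)
  obtain z3 where z3: "\<And>x z. x \<ge> z3 \<Longrightarrow> z \<in> {(1 - \<eta>') * x..(1 + \<eta>') * x} \<Longrightarrow> f z \<le> K1 * f x"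
    using \<eta>'(2) unfolding eventually_at_top_linorder by metis
  define z0 where "z0 = max 1 (max x1 (max x2 (max z1 (max z2 (max z3 (max (\<bar>\<mu>\<bar> / \<eta>) (2 / (c0 * (K - K1)))))))))"
  show ?thesis
  proof (rule that[of z0])
    show "0 < z0" unfolding z0_def less_max_iff_disj by simp
    fix z and I :: "nat set" assume z: "z0 \<le> z" and I: "finite I" "c * real (card I) \<le> z"
    have zz: "z \<ge> 1" "z \<ge> x1" "z \<ge> x2" "z \<ge> z1" "z \<ge> z2" "z \<ge> z3" "z \<ge> \<bar>\<mu>\<bar> / \<eta>" "z \<ge> 2 / (c0 * (K - K1))"
      using z unfolding z0_def max.bounded_iff by blast+
    interpret PI: prob_space "P I" by (rule prob_space_P)
    let ?n = "real (card I)"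
    let ?y = "z + ?n * \<mu>"
    let ?D = "{x\<in>space (P I). (\<Sum>i\<in>I. x i) \<in> translate ?y (Delta T)}"
    let ?S = "{x\<in>space (P I). (\<forall>i\<in>I. x i \<le> \<theta> * z) \<and> ?n * \<mu> + z < (\<Sum>i\<in>I. x i)}"
    let ?B = "\<lambda>k. {x\<in>space (P I). \<theta> * z < x k \<and> (\<Sum>i\<in>I. x i) \<in> translate ?y (Delta T)}"
    have fz: "f z > 0"
      using s(2) s(4)[OF zz(3)] zz(1) by (smt (verit) mult_pos_pos powr_gt_zero)
    show "measure (P I) ?D \<le> ?n * (K * f z)"
    proof (cases "I = {}")
      case True
      then have "?D = {}" using zz by (auto simp: mem_translate_Delta)
      then have "measure (P I) ?D = 0" by (simp only: measure_empty)
      then show ?thesis using True by (metis card.empty mult_zero_left of_nat_0 order_refl)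
    next
      case False
      then have n1: "?n \<ge> 1" using I by (simp add: Suc_le_eq card_gt_0_iff)
      have S: "?S \<in> sets (P I)" using I by measurable
      have B: "?B k \<in> sets (P I)" if "k \<in> I" for k using I that by measurable
      have sub: "?D \<subseteq> ?S \<union> (\<Union>k\<in>I. ?B k)"
        by (auto simp: mem_translate_Delta not_le add.commute)
      have "measure (P I) ?D \<le> measure (P I) (?S \<union> (\<Union>k\<in>I. ?B k))"
        using sub S B I by (intro PI.finite_measure_mono sets.Un sets.finite_UN) auto
      also have "\<dots> \<le> measure (P I) ?S + measure (P I) (\<Union>k\<in>I. ?B k)"
        using S B I by (intro measure_Un_le sets.finite_UN) auto
      also have "measure (P I) (\<Union>k\<in>I. ?B k) \<le> (\<Sum>k\<in>I. measure (P I) (?B k))"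
        using B I by (intro measure_UNION_le) auto
      also have "\<dots> \<le> (\<Sum>k\<in>I. (K1 + (K - K1) / 2) * f z)"
      proof (rule sum_mono)
        fix k assume k: "k \<in> I"
        let ?J = "I - {k}"
        have cJ: "real (card ?J) = ?n - 1" using k I n1 by (simp add: of_nat_diff)
        have "measure (P I) (?B k) \<le> K1 * f z + C * f z * deviation ?J (\<eta> * z)"
        proof (rule large_jump_bound[OF I(1) k])
          show "0 \<le> K1 * f z" "0 \<le> C * f z" using K1 L C fz by auto
          show "f (max (?y - s) (\<theta> * z)) \<le> C * f z" for s using C zz by auto
          fix s assume s: "\<bar>s - real (card ?J) * \<mu>\<bar> \<le> \<eta> * z"
          have "\<bar>\<mu>\<bar> \<le> \<eta> * z" using zz(7) \<eta> by (simp add: field_simps)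
          then have w: "\<bar>(?y - s) - z\<bar> \<le> 2 * \<eta> * z" using s unfolding cJ by (simp add: algebra_simps abs_le_iff)
          have "2 * \<eta> * z \<le> 1/2 * z" "2 * \<eta> * z \<le> \<eta>' * z" "\<theta> * z \<le> 1/4 * z" using \<eta> \<theta> zz by (auto intro!: mult_right_mono)
          with w zz(1) have "\<theta> * z \<le> ?y - s" "?y - s \<in> {(1 - \<eta>') * z..(1 + \<eta>') * z}"
            unfolding atLeastAtMost_iff left_diff_distrib distrib_right abs_le_iff by linarith+
          then show "f (max (?y - s) (\<theta> * z)) \<le> K1 * f z" using z3[OF zz(6)] by (simp add: max_def)
        qed
        also have "\<dots> \<le> K1 * f z + C * f z * \<epsilon>"
        proof -
          have "c * real (card ?J) \<le> z" using I c unfolding cJ by (simp add: right_diff_distrib)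
          then show ?thesis using z2(2)[of z ?J] zz I C fz by (intro add_left_mono mult_left_mono) auto
        qed
        also have "\<dots> = (K1 + (K - K1) / 2) * f z" using C by (simp add: \<epsilon>_def field_simps)
        finally show "measure (P I) (?B k) \<le> (K1 + (K - K1) / 2) * f z" .
      qed
      also have "\<dots> = ?n * ((K1 + (K - K1) / 2) * f z)" by simp
      also have "measure (P I) ?S \<le> z powr (-(s + 1))" using \<theta>(4) zz I by auto
      also have "z powr (-(s + 1)) \<le> (K - K1) / 2 * f z"
      proof -
        have "z powr (-(s + 1)) = z powr (-s) / z" using zz(1) by (simp add: powr_diff)
        also have "\<dots> \<le> (f z / c0) / z" using s(4)[OF zz(3)] s(2) zz(1) by (intro divide_right_mono) (auto simp: field_simps)
        also have "\<dots> = f z / (c0 * z)" by simp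
        also have "\<dots> \<le> (K - K1) / 2 * f z"
        proof -
          have "2 \<le> z * (c0 * (K - K1))" using zz(8) s(2) K1 by (simp add: pos_divide_le_eq)
          then have "1 / (c0 * z) \<le> (K - K1) / 2" using s(2) zz(1) by (simp add: field_simps)
          then have "1 / (c0 * z) * f z \<le> (K - K1) / 2 * f z" using fz by (intro mult_right_mono) auto
          then show ?thesis by simp
        qed
        finally show ?thesis .
      qed
      \<comment> \<open>Because \<open>I\<close> is nonempty, the remainder can be charged to the
        factor \<open>card I\<close>. The empty sum was set apart: it equals 0 and misses the
        translate, as \<open>z > 0\<close>.\<close>
      also have "(K - K1) / 2 * f z \<le> ?n * ((K - K1) / 2 * f z)"
        using n1 K1 fz mult_right_mono[OF n1, of "(K - K1) / 2 * f z"] by simp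
      finally show ?thesis by (simp add: field_simps)
    qed
  qed
qed

text \<open>Requiring all summands but one to stay below \<open>z / 2\<close> makes the single-jump
  events disjoint, so their probabilities simply add up and no inclusion-exclusion correction
  arises.\<close>

lemma sum_lower_bound:
  assumes c: "c > 0" and K: "ereal K < l_index f" "0 < K"
  obtains z0 where "z0 > 0" "\<And>z I. z \<ge> z0 \<Longrightarrow> finite I \<Longrightarrow> c * real (card I) \<le> z \<Longrightarrow>
    real (card I) * (K * f z) \<le>
    sum_prob I (z + real (card I) * \<mu>)"
proof -
  obtain l where l: "l_index f = ereal l" using O_regularly_varying_l_index[OF OR AD] by blast
  define K1 where "K1 = (l + K) / 2"
  have K1: "K1 < l" "K < K1" using K l by (auto simp: K1_def)
  obtain \<eta>' where \<eta>': "\<eta>' > 0" "\<forall>\<^sub>F x in at_top. \<forall>z\<in>{(1 - \<eta>') * x..(1 + \<eta>') * x}. K1 * f x \<le> f z"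
    using l_index_greaterD[OF eventually_pos, of K1] l K1 by auto
  define \<eta> where "\<eta> = min \<eta>' (1/2) / 2"
  have \<eta>: "\<eta> > 0" "2 * \<eta> \<le> \<eta>'" "2 * \<eta> \<le> 1/2" using \<eta>' by (auto simp: \<eta>_def)
  \<comment> \<open>The other summands are typical with probability at least
    \<open>1 - 2 * \<epsilon> = K / K1\<close>, which turns the constant \<open>K1\<close> into
    \<open>K\<close>.\<close>
  define \<epsilon> where "\<epsilon> = (1 - K / K1) / 2"
  have \<epsilon>: "\<epsilon> > 0" using K1 K by (simp add: \<epsilon>_def)
  obtain z2 where z2: "z2 > 0" "\<And>z I. z \<ge> z2 \<Longrightarrow> finite I \<Longrightarrow> c * real (card I) \<le> z \<Longrightarrow>
    deviation I (\<eta> * z) \<le> \<epsilon>"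
    by (rule weak_law[OF c \<eta>(1) \<epsilon>]) (rule that)
  obtain z3 where z3: "\<And>x z. x \<ge> z3 \<Longrightarrow> z \<in> {(1 - \<eta>') * x..(1 + \<eta>') * x} \<Longrightarrow> K1 * f x \<le> f z"
    using \<eta>'(2) unfolding eventually_at_top_linorder by metis
  \<comment> \<open>Prepares the estimate that no other summand exceeds \<open>z / 2\<close>: there
    are at most \<open>z / c\<close> of them, each doing so with probability
    \<open>O(z powr (-r))\<close>.\<close>
  have r1: "r - 1 > 0" using r by simp
  have "((\<lambda>z::real. tailmom * 2 powr r / c * z powr (-(r - 1))) \<longlongrightarrow> tailmom * 2 powr r / c * 0) at_top"
    by (intro tendsto_mult tendsto_const) (use r1 in real_asymp)
  then have "\<forall>\<^sub>F z in at_top. tailmom * 2 powr r / c * z powr (-(r - 1)) < \<epsilon>"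
    by (rule order_tendstoD) (use \<epsilon> in simp)
  then obtain z4 where z4: "\<And>z. z \<ge> z4 \<Longrightarrow> tailmom * 2 powr r / c * z powr (-(r - 1)) < \<epsilon>"
    unfolding eventually_at_top_linorder by blast
  define z0 where "z0 = max 1 (max z2 (max z3 (max z4 (max (\<bar>\<mu>\<bar> / \<eta>) (8 * \<bar>\<mu>\<bar>)))))"
  show ?thesis
  proof (rule that[of z0])
    show "0 < z0" unfolding z0_def less_max_iff_disj by simp
    fix z and I :: "nat set" assume z: "z0 \<le> z" and I: "finite I" "c * real (card I) \<le> z"
    have zz: "z \<ge> 1" "z \<ge> z2" "z \<ge> z3" "z \<ge> z4" "z \<ge> \<bar>\<mu>\<bar> / \<eta>" "z \<ge> 8 * \<bar>\<mu>\<bar>"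
      using z unfolding z0_def max.bounded_iff by blast+
    have \<mu>z: "\<bar>\<mu>\<bar> \<le> \<eta> * z" using zz(5) \<eta> by (simp add: field_simps)
    have \<eta>z: "2 * \<eta> * z \<le> 1/2 * z" "2 * \<eta> * z \<le> \<eta>' * z" using \<eta> zz by (auto intro!: mult_right_mono)
    interpret PI: prob_space "P I" by (rule prob_space_P)
    let ?n = "real (card I)"
    let ?y = "z + ?n * \<mu>"
    let ?D = "{x\<in>space (P I). (\<Sum>i\<in>I. x i) \<in> translate ?y (Delta T)}"
    let ?Q = "\<lambda>k x. \<bar>(\<Sum>i\<in>I - {k}. x i) - real (card (I - {k})) * \<mu>\<bar> \<le> \<eta> * z \<and> (\<forall>i\<in>I - {k}. x i \<le> z / 2)"
    let ?A = "\<lambda>k. {x\<in>space (P I). ?Q k x \<and> (\<Sum>i\<in>I. x i) \<in> translate ?y (Delta T)}"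
    have cJ: "real (card (I - {k})) = ?n - 1" if "k \<in> I" for k
    proof -
      have "card I \<ge> 1" using that I by (auto simp: Suc_le_eq card_gt_0_iff)
      then show ?thesis using that I by (simp add: of_nat_diff)
    qed
    have A: "?A k \<in> sets (P I)" if "k \<in> I" for k using I that by measurable
    \<comment> \<open>The jump is at least \<open>z + \<mu> - \<eta> * z\<close>, where
      \<open>\<eta> * z \<le> z / 4\<close> and \<open>\<bar>\<mu>\<bar> \<le> z / 8\<close>; hence
      the entry \<open>8 * \<bar>\<mu>\<bar>\<close> in \<open>z0\<close>.\<close>
    have big: "z / 2 < x k" if x: "x \<in> ?A k" and k: "k \<in> I" for x k
    proof -
      have "(\<Sum>i\<in>I. x i) = x k + (\<Sum>i\<in>I - {k}. x i)" using I k by (simp add: sum.remove)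
      moreover have "?y < (\<Sum>i\<in>I. x i)" "\<bar>(\<Sum>i\<in>I - {k}. x i) - (?n - 1) * \<mu>\<bar> \<le> \<eta> * z"
        using x cJ[OF k] by (auto simp: mem_translate_Delta)
      ultimately have "z + \<mu> - \<eta> * z < x k" by (auto simp: algebra_simps abs_le_iff)
      moreover have "\<eta> * z \<le> 1/4 * z" using \<eta>z by simp
      ultimately show ?thesis using zz(6) zz(1) by linarith
    qed
    have disj: "disjoint_family_on ?A I"
      unfolding disjoint_family_on_def
    proof (intro ballI impI, rule ccontr)
      fix j k assume jk: "j \<in> I" "k \<in> I" "j \<noteq> k" "?A j \<inter> ?A k \<noteq> {}"
      then obtain x where x: "x \<in> ?A j" "x \<in> ?A k" by blast
      then have "z / 2 < x j" "x j \<le> z / 2" using big[OF x(1) jk(1)] jk by auto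
      then show False by simp
    qed
    have one: "K * f z \<le> measure (P I) (?A k)" if k: "k \<in> I" for k
    proof -
      let ?J = "I - {k}"
      interpret PJ: prob_space "P ?J" by (rule prob_space_P)
      let ?G = "{x\<in>space (P ?J). ?Q k x}"
      let ?B1 = "{x\<in>space (P ?J). \<eta> * z < \<bar>(\<Sum>i\<in>?J. x i) - real (card ?J) * \<mu>\<bar>}"
      let ?B2 = "\<lambda>i. {x\<in>space (P ?J). x i \<in> {z/2<..}}"
      have cJz: "c * real (card ?J) \<le> z" using I c cJ[OF k] by (simp add: right_diff_distrib)
      have m: "?B1 \<in> sets (P ?J)" "?G \<in> sets (P ?J)" "\<And>i. i \<in> ?J \<Longrightarrow> ?B2 i \<in> sets (P ?J)"
        using I by measurable
      have "1 = measure (P ?J) (space (P ?J))" using PJ.prob_space by simp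
      also have "\<dots> \<le> measure (P ?J) (?G \<union> (?B1 \<union> (\<Union>i\<in>?J. ?B2 i)))"
        using m I by (intro PJ.finite_measure_mono sets.Un sets.finite_UN) (auto simp: not_le)
      also have "\<dots> \<le> measure (P ?J) ?G + measure (P ?J) (?B1 \<union> (\<Union>i\<in>?J. ?B2 i))"
        using m I by (intro measure_Un_le sets.Un sets.finite_UN) auto
      also have "measure (P ?J) (?B1 \<union> (\<Union>i\<in>?J. ?B2 i)) \<le> measure (P ?J) ?B1 + measure (P ?J) (\<Union>i\<in>?J. ?B2 i)"
        using m I by (intro measure_Un_le sets.finite_UN) auto
      also have "measure (P ?J) (\<Union>i\<in>?J. ?B2 i) \<le> (\<Sum>i\<in>?J. measure (P ?J) (?B2 i))"
        using m I by (intro measure_UNION_le) auto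
      also have "(\<Sum>i\<in>?J. measure (P ?J) (?B2 i)) = real (card ?J) * measure F {z/2<..}"
        using measure_component[of _ ?J "{z/2<..}"] by simp
      also have "measure (P ?J) ?B1 \<le> \<epsilon>" using z2(2)[of z ?J] zz I cJz by auto
      also have "real (card ?J) * measure F {z/2<..} \<le> z / c * (tailmom * (z / 2) powr (-r))"
        using cJz c zz tail_bound[of "z/2"] tailmom_nonneg by (intro mult_mono) (auto simp: field_simps)
      also have "\<dots> = tailmom * 2 powr r / c * (z powr 1 * z powr (-r))"
        using zz(1) by (simp add: powr_divide powr_minus field_simps)
      also have "z powr 1 * z powr (-r) = z powr (-(r - 1))" unfolding powr_add[symmetric] by simp
      also have "tailmom * 2 powr r / c * z powr (-(r - 1)) \<le> \<epsilon>" using z4[OF zz(4)] by simp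
      finally have "1 - 2 * \<epsilon> \<le> measure (P ?J) ?G" by simp
      moreover have "1 - 2 * \<epsilon> = K / K1" using K K1 by (simp add: \<epsilon>_def field_simps)
      ultimately have "K / K1 \<le> measure (P ?J) ?G" by (simp only:)
      then have "K \<le> K1 * measure (P ?J) ?G" using K K1 by (simp add: field_simps)
      then have "K * f z \<le> (K1 * measure (P ?J) ?G) * f z" by (intro mult_right_mono f_nonneg)
      also have "\<dots> = K1 * f z * measure (P ?J) ?G" by (simp only: mult_ac)
      also have "\<dots> \<le> measure (P I) (?A k)"
      proof (rule single_jump_bound[OF I(1) k])
        show "0 \<le> K1 * f z" using K K1 f_nonneg by simp
        fix s assume s: "\<bar>s - real (card ?J) * \<mu>\<bar> \<le> \<eta> * z"
        then have w: "\<bar>(?y - s) - z\<bar> \<le> 2 * \<eta> * z" using \<mu>z unfolding cJ[OF k] by (simp add: algebra_simps abs_le_iff)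
        with \<eta>z have "?y - s \<in> {(1 - \<eta>') * z..(1 + \<eta>') * z}"
          unfolding atLeastAtMost_iff left_diff_distrib distrib_right abs_le_iff by linarith
        then show "K1 * f z \<le> f (?y - s)" by (rule z3[OF zz(3)])
      qed
      finally show ?thesis .
    qed
    have "?n * (K * f z) = (\<Sum>k\<in>I. K * f z)" by simp
    also have "\<dots> \<le> (\<Sum>k\<in>I. measure (P I) (?A k))" by (intro sum_mono one)
    also have "\<dots> = measure (P I) (\<Union>k\<in>I. ?A k)"
      using A disj I by (intro PI.finite_measure_finite_Union[symmetric]) auto
    also have "\<dots> \<le> measure (P I) ?D"
    proof (rule PI.finite_measure_mono)
      show "?D \<in> sets (P I)" by measurable
    qed auto
    finally show "?n * (K * f z) \<le> measure (P I) ?D" .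
  qed
qed

end

section \<open>Reduction of the random sum to a mixture over product measures\<close>

lemma measure_sum_iid:
  assumes M: "prob_space M" and X: "iid M X F" and I: "finite I" and A[measurable]: "A \<in> sets borel"
  shows "measure M {\<omega>\<in>space M. (\<Sum>i\<in>I. X i \<omega>) \<in> A}
    = measure (PiM I (\<lambda>_. F)) {x\<in>space (PiM I (\<lambda>_. F)). (\<Sum>i\<in>I. x i) \<in> A}"
proof -
  interpret prob_space M by fact
  have ind: "indep_vars (\<lambda>_. borel) X UNIV" and F: "distr M borel (X k) = F" for k
    using X by (auto simp: iid_def)
  have rv[measurable]: "X k \<in> borel_measurable M" for k using ind by (auto simp: indep_vars_def)
  have sF[measurable_cong]: "sets F = sets borel" using F[of 0] by (metis sets_distr)
  interpret F: prob_space F using F[of 0] rv[of 0] prob_space_distr by metis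
  interpret PI: prob_space "PiM I (\<lambda>_. F)" by (intro prob_space_PiM F.prob_space_axioms)
  show ?thesis
  proof (cases "I = {}")
    case True
    then show ?thesis using prob_space PI.prob_space by (cases "0 \<in> A") auto
  next
    case False
    let ?Y = "\<lambda>\<omega>. \<lambda>i\<in>I. X i \<omega>"
    have "indep_vars (\<lambda>_. borel) X I" using ind by (rule indep_vars_subset) auto
    then have d: "distr M (PiM I (\<lambda>_. borel)) ?Y = PiM I (\<lambda>_. F)"
      using indep_vars_iff_distr_eq_PiM[where I = I and M' = "\<lambda>_. borel" and X = X] False rv by (simp add: F)
    have sp: "space (PiM I (\<lambda>_. F)) = space (PiM I (\<lambda>_. borel :: real measure))"
      by (rule sets_eq_imp_space_eq) (simp add: sF cong: sets_PiM_cong)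
    have B: "{x\<in>space (PiM I (\<lambda>_. borel :: real measure)). (\<Sum>i\<in>I. x i) \<in> A} \<in> sets (PiM I (\<lambda>_. borel))"
      using I by measurable
    have "measure (PiM I (\<lambda>_. F)) {x\<in>space (PiM I (\<lambda>_. F)). (\<Sum>i\<in>I. x i) \<in> A}
       = measure (distr M (PiM I (\<lambda>_. borel)) ?Y) {x\<in>space (PiM I (\<lambda>_. borel :: real measure)). (\<Sum>i\<in>I. x i) \<in> A}"
      unfolding d sp ..
    also have "\<dots> = measure M (?Y -` {x\<in>space (PiM I (\<lambda>_. borel :: real measure)). (\<Sum>i\<in>I. x i) \<in> A} \<inter> space M)"
      using B by (intro measure_distr) measurable
    also have "?Y -` {x\<in>space (PiM I (\<lambda>_. borel :: real measure)). (\<Sum>i\<in>I. x i) \<in> A} \<inter> space M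
       = {\<omega>\<in>space M. (\<Sum>i\<in>I. X i \<omega>) \<in> A}"
      by (auto simp: space_PiM cong: sum.cong)
    finally show ?thesis by simp
  qed
qed

text \<open>Split the event according to the value \<open>n\<close> of \<open>N t\<close>. The
  partial sum of length \<open>n\<close> belongs to the sigma-algebra of the summands and
  \<open>N t = n\<close> to that of the process, so each piece factors.\<close>

lemma random_sum_mixture:
  assumes M: "prob_space M" and X: "iid M X F" and N: "counting_process M N"
    and ind: "independent_processes M X N" and t: "0 \<le> t" and A[measurable]: "A \<in> sets borel"
  defines "q \<equiv> \<lambda>n. measure (PiM {1..n} (\<lambda>_. F)) {x\<in>space (PiM {1..n} (\<lambda>_. F)). (\<Sum>i\<in>{1..n}. x i) \<in> A}"
  shows "measure M {\<omega>\<in>space M. random_sum X N t \<omega> \<in> A} = (\<integral>\<omega>. q (N t \<omega>) \<partial>M)"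
proof -
  interpret prob_space M by fact
  have indv: "indep_vars (\<lambda>_. borel) X UNIV" using X by (auto simp: iid_def)
  have rv[measurable]: "X k \<in> borel_measurable M" for k using indv by (auto simp: indep_vars_def)
  have Nt[measurable]: "N t \<in> measurable M (count_space UNIV)" using N t by (auto simp: counting_process_def)
  have q: "q n = measure M {\<omega>\<in>space M. (\<Sum>i\<in>{1..n}. X i \<omega>) \<in> A}" for n
    unfolding q_def by (rule measure_sum_iid[OF M X _ A, symmetric]) simp
  define GX where "GX = generated_sigma M borel UNIV X"
  define GN where "GN = generated_sigma M (count_space UNIV) {0..} N"
  have indGX: "indep_set GX GN" using ind by (simp add: independent_processes_def GX_def GN_def)
  have SN: "{\<omega>\<in>space M. N t \<omega> = n} \<in> GN" for n
    unfolding GN_def generated_sigma_def using t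
    by (intro sigma_sets.Basic UN_I[of t]) (auto intro!: exI[of _ "{n}"])
  have SX: "{\<omega>\<in>space M. (\<Sum>i\<in>{1..n}. X i \<omega>) \<in> A} \<in> GX" for n
  proof -
    \<comment> \<open>Measurability has to be checked with respect to the sigma-algebra generated by
      the summands, not merely the one of \<open>M\<close>; the coordinates are measurable there by
      construction.\<close>
    define G where "G = (\<Union>k::nat. {X k -` B \<inter> space M | B. B \<in> sets (borel::real measure)})"
    have G: "G \<subseteq> Pow (space M)" by (auto simp: G_def)
    have [measurable]: "X k \<in> borel_measurable (sigma (space M) G)" for k
    proof (rule measurableI)
      fix B :: "real set" assume "B \<in> sets borel"
      then show "X k -` B \<inter> space (sigma (space M) G) \<in> sets (sigma (space M) G)"
        using G by (auto simp: G_def intro!: sigma_sets.Basic)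
    qed simp
    have "{\<omega>\<in>space (sigma (space M) G). (\<Sum>i\<in>{1..n}. X i \<omega>) \<in> A} \<in> sets (sigma (space M) G)"
      by measurable
    then show ?thesis using G by (simp add: GX_def generated_sigma_def G_def)
  qed
  define E where "E n = {\<omega>\<in>space M. N t \<omega> = n}" for n
  define S where "S n = {\<omega>\<in>space M. (\<Sum>i\<in>{1..n}. X i \<omega>) \<in> A}" for n
  have [measurable]: "E n \<in> sets M" "S n \<in> sets M" for n unfolding E_def S_def by measurable
  have prod: "prob (S n \<inter> E n) = q n * prob (E n)" for n
    using indep_setD[OF indGX SX[of n] SN[of n]] by (simp add: q S_def E_def)
  have "{\<omega>\<in>space M. random_sum X N t \<omega> \<in> A} = (\<Union>n. S n \<inter> E n)"
    by (auto simp: random_sum_def S_def E_def)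
  moreover have "emeasure M (\<Union>n. S n \<inter> E n) = (\<Sum>n. emeasure M (S n \<inter> E n))"
    by (rule suminf_emeasure[symmetric]) (auto simp: disjoint_family_on_def E_def)
  ultimately have "emeasure M {\<omega>\<in>space M. random_sum X N t \<omega> \<in> A} = (\<Sum>n. ennreal (q n) * emeasure M (E n))"
    by (simp add: emeasure_eq_measure prod ennreal_mult q)
  also have "\<dots> = (\<Sum>n. (\<integral>\<^sup>+\<omega>. ennreal (q n) * indicator (E n) \<omega> \<partial>M))"
    by (simp add: nn_integral_cmult)
  also have "\<dots> = (\<integral>\<^sup>+\<omega>. (\<Sum>n. ennreal (q n) * indicator (E n) \<omega>) \<partial>M)"
    by (rule nn_integral_suminf[symmetric]) measurable
  also have "\<dots> = (\<integral>\<^sup>+\<omega>. ennreal (q (N t \<omega>)) \<partial>M)"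
  proof (rule nn_integral_cong)
    fix \<omega> assume w: "\<omega> \<in> space M"
    have "(\<Sum>n. ennreal (q n) * indicator (E n) \<omega>) = (\<Sum>n\<in>{N t \<omega>}. ennreal (q n) * indicator (E n) \<omega>)"
      using w by (intro suminf_finite) (auto simp: E_def)
    then show "(\<Sum>n. ennreal (q n) * indicator (E n) \<omega>) = ennreal (q (N t \<omega>))"
      using w by (simp add: E_def)
  qed
  also have "\<dots> = ennreal (\<integral>\<omega>. q (N t \<omega>) \<partial>M)"
  proof (rule nn_integral_eq_integral)
    show "integrable M (\<lambda>\<omega>. q (N t \<omega>))"
    proof (rule integrable_const_bound[of _ 1])
      show "(\<lambda>\<omega>. q (N t \<omega>)) \<in> borel_measurable M" by measurable
    qed (auto simp: q)
  qed (auto simp: q)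
  finally show ?thesis
    by (simp add: emeasure_eq_measure q)
qed

text \<open>\<open>Z - m\<close> has mean zero, so its positive and negative parts have equal
  expectation. Control of one tail of \<open>N t\<close> therefore gives convergence in
  mean.\<close>

lemma mean_absolute_deviation:
  fixes Z :: "'a \<Rightarrow> real"
  assumes M: "prob_space M" and Z: "integrable M Z" and m: "m = (\<integral>\<omega>. Z \<omega> \<partial>M)"
  shows "(\<integral>\<omega>. \<bar>Z \<omega> - m\<bar> \<partial>M) = 2 * (\<integral>\<omega>. max 0 (Z \<omega> - m) \<partial>M)"
    "(\<integral>\<omega>. \<bar>Z \<omega> - m\<bar> \<partial>M) = 2 * (\<integral>\<omega>. max 0 (m - Z \<omega>) \<partial>M)"
proof -
  interpret prob_space M by fact
  have i: "integrable M (\<lambda>\<omega>. Z \<omega> - m)" "integrable M (\<lambda>\<omega>. m - Z \<omega>)" using Z by auto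
  have z: "(\<integral>\<omega>. Z \<omega> - m \<partial>M) = 0" using Z by (simp add: m prob_space)
  have i': "integrable M (\<lambda>\<omega>. max 0 (Z \<omega> - m))" "integrable M (\<lambda>\<omega>. max 0 (m - Z \<omega>))"
    using i by auto
  have "(\<integral>\<omega>. \<bar>Z \<omega> - m\<bar> \<partial>M) = (\<integral>\<omega>. 2 * max 0 (Z \<omega> - m) - (Z \<omega> - m) \<partial>M)"
    by (intro Bochner_Integration.integral_cong) (auto simp: max_def)
  also have "\<dots> = 2 * (\<integral>\<omega>. max 0 (Z \<omega> - m) \<partial>M) - (\<integral>\<omega>. Z \<omega> - m \<partial>M)"
    using i i' by (subst Bochner_Integration.integral_diff) auto
  finally show "(\<integral>\<omega>. \<bar>Z \<omega> - m\<bar> \<partial>M) = 2 * (\<integral>\<omega>. max 0 (Z \<omega> - m) \<partial>M)" using z by simp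
  have "(\<integral>\<omega>. \<bar>Z \<omega> - m\<bar> \<partial>M) = (\<integral>\<omega>. 2 * max 0 (m - Z \<omega>) + (Z \<omega> - m) \<partial>M)"
    by (intro Bochner_Integration.integral_cong) (auto simp: max_def)
  also have "\<dots> = 2 * (\<integral>\<omega>. max 0 (m - Z \<omega>) \<partial>M) + (\<integral>\<omega>. Z \<omega> - m \<partial>M)"
    using i i' by (subst Bochner_Integration.integral_add) auto
  finally show "(\<integral>\<omega>. \<bar>Z \<omega> - m\<bar> \<partial>M) = 2 * (\<integral>\<omega>. max 0 (m - Z \<omega>) \<partial>M)" using z by simp
qed

section \<open>Local probabilities at the level x + \<mu> m for n near and far from m\<close>

context heavy_local
begin

definition iid_prob :: "nat \<Rightarrow> real \<Rightarrow> real" where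
  "iid_prob n y = sum_prob {1..n} y"

lemma iid_prob_nonneg: "0 \<le> iid_prob n y" by (simp add: iid_prob_def)

lemma iid_prob_le_1: "iid_prob n y \<le> 1"
  unfolding iid_prob_def using prob_space.prob_le_1[OF prob_space_P] by blast

lemma iid_prob_upper:
  assumes "c > 0" "L_index f < ereal K"
  obtains z0 where "z0 > 0" "\<And>z n. z \<ge> z0 \<Longrightarrow> c * real n \<le> z \<Longrightarrow> iid_prob n (z + real n * \<mu>) \<le> real n * (K * f z)"
proof -
  obtain z0 where z0: "z0 > 0" "\<And>z I. z \<ge> z0 \<Longrightarrow> finite I \<Longrightarrow> c * real (card I) \<le> z \<Longrightarrow>
    sum_prob I (z + real (card I) * \<mu>)
      \<le> real (card I) * (K * f z)"
    by (rule sum_upper_bound[OF assms]) (rule that)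
  show ?thesis using z0(2)[of _ "{1.._}"] by (intro that[OF z0(1)]) (simp add: iid_prob_def)
qed

lemma iid_prob_lower:
  assumes "c > 0" "ereal K < l_index f" "0 < K"
  obtains z0 where "z0 > 0" "\<And>z n. z \<ge> z0 \<Longrightarrow> c * real n \<le> z \<Longrightarrow> real n * (K * f z) \<le> iid_prob n (z + real n * \<mu>)"
proof -
  obtain z0 where z0: "z0 > 0" "\<And>z I. z \<ge> z0 \<Longrightarrow> finite I \<Longrightarrow> c * real (card I) \<le> z \<Longrightarrow>
    real (card I) * (K * f z) \<le>
    sum_prob I (z + real (card I) * \<mu>)"
    by (rule sum_lower_bound[OF assms]) (rule that)
  show ?thesis using z0(2)[of _ "{1.._}"] by (intro that[OF z0(1)]) (simp add: iid_prob_def)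
qed

text \<open>With \<open>z = x + \<mu> * (m - n)\<close>, the displacement is at most
  \<open>\<bar>\<mu>\<bar> * \<delta> * m \<le> \<eta> * x / 4\<close>, because
  \<open>m \<le> x / \<gamma>\<close>. Large \<open>x\<close> makes the shift from \<open>x\<close>
  to \<open>x + \<mu>\<close> equally harmless.\<close>

lemma near_mean_range:
  assumes \<gamma>: "\<gamma> > 0" and \<eta>: "\<eta> > 0" "\<eta> \<le> 1/2"
  obtains \<delta> x0 where "0 < \<delta>" "\<delta> < 1" "x0 > 0"
    "\<And>x m n. x \<ge> x0 \<Longrightarrow> 0 \<le> m \<Longrightarrow> x \<ge> \<gamma> * m \<Longrightarrow> \<bar>n - m\<bar> \<le> \<delta> * m \<Longrightarrow>
      x + \<mu> * m - n * \<mu> \<in> {(1 - \<eta>) * (x + \<mu>)..(1 + \<eta>) * (x + \<mu>)} \<and>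
      \<gamma> / 8 * n \<le> x + \<mu> * m - n * \<mu> \<and> x / 4 \<le> x + \<mu> * m - n * \<mu> \<and> x / 2 \<le> x + \<mu>"
proof -
  \<comment> \<open>\<open>\<bar>\<mu>\<bar> + 1\<close> instead of \<open>\<bar>\<mu>\<bar>\<close>
    also covers mean zero; the bound 1/2 ensures \<open>n \<le> 2 * m\<close>.\<close>
  define \<delta> where "\<delta> = min (1/2) (\<eta> * \<gamma> / (4 * (\<bar>\<mu>\<bar> + 1)))"
  have d: "0 < \<delta>" "\<delta> < 1" using \<gamma> \<eta> by (auto simp: \<delta>_def)
  have "\<bar>\<mu>\<bar> * \<delta> \<le> (\<bar>\<mu>\<bar> + 1) * (\<eta> * \<gamma> / (4 * (\<bar>\<mu>\<bar> + 1)))"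
    using d by (intro mult_mono) (auto simp: \<delta>_def)
  also have "\<dots> = \<eta> * \<gamma> / 4" by (simp add: field_simps)
  finally have d\<mu>: "\<bar>\<mu>\<bar> * \<delta> \<le> \<eta> * \<gamma> / 4" .
  show ?thesis
  proof (rule that[OF d])
    show "0 < 4 * (\<bar>\<mu>\<bar> + 1) / \<eta>" using \<eta> by simp
    fix x m n :: real
    assume x: "x \<ge> 4 * (\<bar>\<mu>\<bar> + 1) / \<eta>" "0 \<le> m" "x \<ge> \<gamma> * m" and n: "\<bar>n - m\<bar> \<le> \<delta> * m"
    have x0: "x > 0" using x(1) \<eta> by (smt (verit) divide_pos_pos)
    have \<eta>x: "\<eta> * x \<ge> 4 * (\<bar>\<mu>\<bar> + 1)" using x(1) \<eta> by (simp add: field_simps)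
    have \<eta>x2: "\<eta> * x \<le> 1/2 * x" using \<eta> x0 by (intro mult_right_mono) auto
    have "\<bar>\<mu> * (m - n)\<bar> \<le> \<bar>\<mu>\<bar> * (\<delta> * m)" using n by (simp add: abs_mult mult_left_mono)
    also have "\<dots> = (\<bar>\<mu>\<bar> * \<delta>) * m" by simp
    also have "\<dots> \<le> (\<eta> * \<gamma> / 4) * m" using d\<mu> x by (intro mult_right_mono) auto
    also have "\<dots> = \<eta> / 4 * (\<gamma> * m)" by simp
    also have "\<dots> \<le> \<eta> / 4 * x" using x \<eta> by (intro mult_left_mono) auto
    finally have w: "\<bar>\<mu> * (m - n)\<bar> \<le> \<eta> * x / 4" by simp
    have \<eta>\<mu>: "\<bar>\<eta> * \<mu>\<bar> \<le> \<bar>\<mu>\<bar> / 2" using mult_right_mono[OF \<eta>(2), of "\<bar>\<mu>\<bar>"] \<eta> by (simp add: abs_mult)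
    have e: "x + \<mu> * m - n * \<mu> = x + \<mu> * (m - n)" by (simp add: algebra_simps)
    have 1: "x + \<mu> * m - n * \<mu> \<in> {(1 - \<eta>) * (x + \<mu>)..(1 + \<eta>) * (x + \<mu>)}"
    proof -
      have lo: "(1 - \<eta>) * (x + \<mu>) = x + \<mu> - \<eta> * x - \<eta> * \<mu>" by (simp add: algebra_simps)
      have hi: "(1 + \<eta>) * (x + \<mu>) = x + \<mu> + \<eta> * x + \<eta> * \<mu>" by (simp add: algebra_simps)
      have arith: "x + b - E - g \<le> x + W \<and> x + W \<le> x + b + E + g"
        if "\<bar>W\<bar> \<le> E / 4" "4 * (\<bar>b\<bar> + 1) \<le> E" "\<bar>g\<bar> \<le> \<bar>b\<bar> / 2" for b E g W :: real
        using that unfolding abs_le_iff by (intro conjI) (auto simp: abs_if split: if_splits)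
      show ?thesis unfolding e atLeastAtMost_iff lo hi by (rule arith[OF w \<eta>x \<eta>\<mu>])
    qed
    have 2: "x / 2 \<le> x + \<mu>" using \<eta>x \<eta>x2 abs_ge_minus_self[of \<mu>] abs_ge_zero[of \<mu>] by (simp add: distrib_left)
    have 3: "3/4 * x \<le> x + \<mu> * m - n * \<mu>" unfolding e using w \<eta>x2 by linarith
    have "\<delta> * m \<le> 1 * m" using d x by (intro mult_right_mono) auto
    then have "n \<le> 2 * m" using n by linarith
    then have "\<gamma> / 8 * n \<le> \<gamma> / 8 * (2 * m)" using \<gamma> by (intro mult_left_mono) auto
    then have "\<gamma> / 8 * n \<le> x / 4" using x by simp
    then show "x + \<mu> * m - n * \<mu> \<in> {(1 - \<eta>) * (x + \<mu>)..(1 + \<eta>) * (x + \<mu>)} \<and>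
      \<gamma> / 8 * n \<le> x + \<mu> * m - n * \<mu> \<and> x / 4 \<le> x + \<mu> * m - n * \<mu> \<and> x / 2 \<le> x + \<mu>"
      using 1 2 3 x0 by auto
  qed
qed

lemma iid_prob_near_mean:
  assumes \<gamma>: "\<gamma> > 0" and K: "L_index f < ereal K" and k: "ereal k < l_index f" "0 < k"
  obtains \<delta> x0 where "0 < \<delta>" "\<delta> < 1" "x0 > 0"
    "\<And>x m n. x \<ge> x0 \<Longrightarrow> 0 \<le> m \<Longrightarrow> x \<ge> \<gamma> * m \<Longrightarrow> \<bar>real n - m\<bar> \<le> \<delta> * m \<Longrightarrow>
      iid_prob n (x + \<mu> * m) \<in> {real n * (k\<^sup>2 * f (x + \<mu>))..real n * (K\<^sup>2 * f (x + \<mu>))}"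
proof -
  have K1: "K > 1" using le_less_trans[OF L_index_ge_1[OF eventually_pos] K] by (simp add: one_ereal_def)
  obtain \<eta>1 where \<eta>1: "\<eta>1 > 0" "\<forall>\<^sub>F x in at_top. \<forall>z\<in>{(1 - \<eta>1) * x..(1 + \<eta>1) * x}. f z \<le> K * f x"
    using L_index_lessD[OF eventually_pos K] by blast
  obtain \<eta>2 where \<eta>2: "\<eta>2 > 0" "\<forall>\<^sub>F x in at_top. \<forall>z\<in>{(1 - \<eta>2) * x..(1 + \<eta>2) * x}. k * f x \<le> f z"
    using l_index_greaterD[OF eventually_pos k(1)] by blast
  obtain x1 where x1: "\<And>x z. x \<ge> x1 \<Longrightarrow> z \<in> {(1 - \<eta>1) * x..(1 + \<eta>1) * x} \<Longrightarrow> f z \<le> K * f x"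
      "\<And>x z. x \<ge> x1 \<Longrightarrow> z \<in> {(1 - \<eta>2) * x..(1 + \<eta>2) * x} \<Longrightarrow> k * f x \<le> f z"
    using eventually_conj[OF \<eta>1(2) \<eta>2(2)] unfolding eventually_at_top_linorder by blast
  define \<eta> where "\<eta> = min (min \<eta>1 \<eta>2) (1/2)"
  have \<eta>: "\<eta> > 0" "\<eta> \<le> 1/2" "\<eta> \<le> \<eta>1" "\<eta> \<le> \<eta>2" using \<eta>1 \<eta>2 by (auto simp: \<eta>_def)
  obtain \<delta> x2 where d: "0 < \<delta>" "\<delta> < 1" "x2 > 0" and R:
    "\<And>x m n. x \<ge> x2 \<Longrightarrow> 0 \<le> m \<Longrightarrow> x \<ge> \<gamma> * m \<Longrightarrow> \<bar>n - m\<bar> \<le> \<delta> * m \<Longrightarrow>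
      x + \<mu> * m - n * \<mu> \<in> {(1 - \<eta>) * (x + \<mu>)..(1 + \<eta>) * (x + \<mu>)} \<and>
      \<gamma> / 8 * n \<le> x + \<mu> * m - n * \<mu> \<and> x / 4 \<le> x + \<mu> * m - n * \<mu> \<and> x / 2 \<le> x + \<mu>"
    by (rule near_mean_range[OF \<gamma> \<eta>(1,2)]) (rule that)
  have g8: "\<gamma> / 8 > 0" using \<gamma> by simp
  obtain z0 where z0: "z0 > 0" "\<And>z n. z \<ge> z0 \<Longrightarrow> \<gamma> / 8 * real n \<le> z \<Longrightarrow> iid_prob n (z + real n * \<mu>) \<le> real n * (K * f z)"
    using iid_prob_upper[OF g8 K] by blast
  obtain z1 where z1: "z1 > 0" "\<And>z n. z \<ge> z1 \<Longrightarrow> \<gamma> / 8 * real n \<le> z \<Longrightarrow> real n * (k * f z) \<le> iid_prob n (z + real n * \<mu>)"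
    using iid_prob_lower[OF g8 k] by blast
  define x3 where "x3 = max x2 (max (2 * \<bar>x1\<bar>) (4 * max z0 z1))"
  show ?thesis
  proof (rule that[OF d(1,2)])
    show "0 < x3" using d by (simp add: x3_def)
    fix x m :: real and n :: nat
    assume x: "x3 \<le> x" "0 \<le> m" "\<gamma> * m \<le> x" "\<bar>real n - m\<bar> \<le> \<delta> * m"
    have xx: "x2 \<le> x" "2 * \<bar>x1\<bar> \<le> x" "4 * z0 \<le> x" "4 * z1 \<le> x" using x(1) by (auto simp: x3_def)
    note R = R[OF xx(1) x(2-4)]
    let ?z = "x + \<mu> * m - real n * \<mu>"
    have x\<mu>: "0 \<le> x + \<mu>" "x1 \<le> x + \<mu>" using R xx d by auto
    have "?z \<in> {(1 - \<eta>i) * (x + \<mu>)..(1 + \<eta>i) * (x + \<mu>)}" if "\<eta> \<le> \<eta>i" for \<eta>i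
      using R scaled_interval_mono[OF x\<mu>(1) that] by blast
    then have fz: "f ?z \<le> K * f (x + \<mu>)" "k * f (x + \<mu>) \<le> f ?z" using x1[OF x\<mu>(2)] \<eta> by blast+
    have "real n * (k * (k * f (x + \<mu>))) \<le> real n * (k * f ?z)"
      using fz(2) k by (intro mult_left_mono) auto
    also have "\<dots> \<le> iid_prob n (?z + real n * \<mu>)" using R xx by (intro z1) auto
    finally have 1: "real n * (k * (k * f (x + \<mu>))) \<le> iid_prob n (x + \<mu> * m)" by simp
    have "iid_prob n (?z + real n * \<mu>) \<le> real n * (K * f ?z)" using R xx by (intro z0) auto
    also have "\<dots> \<le> real n * (K * (K * f (x + \<mu>)))" using fz(1) K1 by (intro mult_left_mono) auto
    finally show "iid_prob n (x + \<mu> * m) \<in> {real n * (k\<^sup>2 * f (x + \<mu>))..real n * (K\<^sup>2 * f (x + \<mu>))}"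
      using 1 by (simp add: power2_eq_square mult_ac)
  qed
qed

text \<open>For large \<open>x\<close> one has \<open>x + \<mu> \<le> 2 * x\<close>, so domination
  with the halved factor \<open>a / 2\<close> is based at \<open>x + \<mu>\<close>.\<close>

lemma f_dominated_shift:
  assumes a: "a > 0"
  obtains C x0 where "C > 0" "x0 > 0" "\<And>x u. x \<ge> x0 \<Longrightarrow> u \<ge> a * x \<Longrightarrow> f u \<le> C * f (x + \<mu>)"
proof -
  have a2: "a / 2 > 0" using a by simp
  obtain C x1 where C: "C > 0" "x1 > 0" "\<And>x u. x \<ge> x1 \<Longrightarrow> u \<ge> a / 2 * x \<Longrightarrow> f u \<le> C * f x"
    using O_regularly_varying_dominated[OF OR AD a2] by metis
  show ?thesis
  proof (rule that[OF C(1)])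
    show "x1 + \<bar>\<mu>\<bar> > 0" using C by simp
    fix x u assume x: "x1 + \<bar>\<mu>\<bar> \<le> x" "a * x \<le> u"
    have "a / 2 * (x + \<mu>) \<le> a / 2 * (2 * x)" using x a C(2) by (intro mult_left_mono) auto
    also have "\<dots> \<le> u" using x by simp
    finally show "f u \<le> C * f (x + \<mu>)" using x by (intro C(3)) auto
  qed
qed

text \<open>For indices away from the mean only the order of magnitude matters, so any constant
  above the index will do and \<open>f z\<close> is replaced by \<open>f (x + \<mu>)\<close> through
  domination.\<close>

lemma iid_prob_crude:
  assumes a: "a > 0" and c: "c > 0"
  obtains C x0 where "C > 0" "x0 > 0" "\<And>x z n. x \<ge> x0 \<Longrightarrow> z \<ge> a * x \<Longrightarrow> c * real n \<le> z \<Longrightarrow>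
    iid_prob n (z + real n * \<mu>) \<le> C * real n * f (x + \<mu>)"
proof -
  obtain L where L: "L_index f = ereal L" "L \<ge> 1" using O_regularly_varying_L_index[OF OR AD] by blast
  then have "L_index f < ereal (L + 1)" by simp
  then obtain z0 where z0: "z0 > 0" "\<And>z n. z \<ge> z0 \<Longrightarrow> c * real n \<le> z \<Longrightarrow> iid_prob n (z + real n * \<mu>) \<le> real n * ((L + 1) * f z)"
    using iid_prob_upper[OF c] by blast
  obtain C x1 where C: "C > 0" "x1 > 0" "\<And>x u. x \<ge> x1 \<Longrightarrow> u \<ge> a * x \<Longrightarrow> f u \<le> C * f (x + \<mu>)"
    using f_dominated_shift[OF a] by metis
  show ?thesis
  proof (rule that[of "(L + 1) * C" "max x1 (z0 / a)"])
    show "0 < (L + 1) * C" "0 < max x1 (z0 / a)" using L C by auto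
    fix x z :: real and n :: nat
    assume x: "max x1 (z0 / a) \<le> x" "a * x \<le> z" "c * real n \<le> z"
    have "z0 \<le> a * x" using x a by (simp add: field_simps)
    then have "iid_prob n (z + real n * \<mu>) \<le> real n * ((L + 1) * f z)" using x by (intro z0) auto
    also have "\<dots> \<le> real n * ((L + 1) * (C * f (x + \<mu>)))"
      using L x by (intro mult_left_mono C(3)) auto
    finally show "iid_prob n (z + real n * \<mu>) \<le> (L + 1) * C * real n * f (x + \<mu>)" by (simp add: mult_ac)
  qed
qed

text \<open>For \<mu> \<ge> 0 the level \<open>z = x + \<mu> * (m - n)\<close> falls as
  \<open>n\<close> grows, but stays at least \<open>x / 2\<close> while \<open>n \<le> m\<close> or
  \<open>n \<le> b * x\<close>. Beyond both, the trivial bound 1 is used.\<close>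

lemma iid_prob_crude_nonneg_mean:
  assumes \<mu>: "\<mu> \<ge> 0" and \<gamma>: "\<gamma> > 0"
  obtains C b x0 where "C > 0" "b > 0" "x0 > 0" "\<And>x m n. x \<ge> x0 \<Longrightarrow> x \<ge> \<gamma> * m \<Longrightarrow> 0 \<le> m \<Longrightarrow>
    iid_prob n (x + \<mu> * m) \<le> C * real n * f (x + \<mu>) + of_bool (m < real n \<and> b * x < real n)"
proof -
  define b where "b = 1 / (2 * (\<mu> + 1))"
  have b: "b > 0" "\<mu> * b \<le> 1/2" using \<mu> by (auto simp: b_def field_simps)
  \<comment> \<open>The entry \<gamma> gives \<open>c * n \<le> z\<close> for
    \<open>n \<le> m\<close>, and \<open>c * b \<le> 1/2\<close> does so for
    \<open>n \<le> b * x\<close>.\<close>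
  define c where "c = min \<gamma> (1 / (2 * b))"
  have c: "c > 0" "c \<le> \<gamma>" "c * b \<le> 1/2" using \<gamma> b by (auto simp: c_def min_def field_simps)
  obtain C x0 where C: "C > 0" "x0 > 0" "\<And>x z n. x \<ge> x0 \<Longrightarrow> z \<ge> 1/2 * x \<Longrightarrow> c * real n \<le> z \<Longrightarrow>
    iid_prob n (z + real n * \<mu>) \<le> C * real n * f (x + \<mu>)"
    by (rule iid_prob_crude[of "1/2" c]) (use c that in auto)
  show ?thesis
  proof (rule that[OF C(1) b(1) C(2)])
    fix x m :: real and n :: nat
    assume x: "x0 \<le> x" "\<gamma> * m \<le> x" "0 \<le> m"
    have x0: "x > 0" using x C by simp
    let ?z = "x + \<mu> * m - real n * \<mu>"
    have zn: "?z + real n * \<mu> = x + \<mu> * m" by simp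
    have nn: "0 \<le> C * real n * f (x + \<mu>)" using C f_nonneg by simp
    consider "real n \<le> m" | "real n \<le> b * x" | "m < real n" "b * x < real n" by linarith
    then show "iid_prob n (x + \<mu> * m) \<le> C * real n * f (x + \<mu>) + of_bool (m < real n \<and> b * x < real n)"
    proof cases
      case 1
      have "\<mu> * real n \<le> \<mu> * m" using 1 \<mu> by (intro mult_left_mono)
      then have zx: "x \<le> ?z" by (simp add: mult.commute)
      have "c * real n \<le> \<gamma> * m" using 1 c x by (intro mult_mono) auto
      then have "iid_prob n (?z + real n * \<mu>) \<le> C * real n * f (x + \<mu>)" using zx x x0 by (intro C(3)) auto
      then show ?thesis using zn by simp
    next
      case 2
      have "\<mu> * real n \<le> \<mu> * (b * x)" using 2 \<mu> by (intro mult_left_mono)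
      also have "\<dots> = (\<mu> * b) * x" by simp
      also have "\<dots> \<le> 1/2 * x" using b x0 by (intro mult_right_mono) auto
      finally have "\<mu> * real n \<le> 1/2 * x" .
      moreover have "0 \<le> \<mu> * m" using \<mu> x by simp
      ultimately have zx: "1/2 * x \<le> ?z" by (simp add: mult.commute)
      have "c * real n \<le> c * (b * x)" using 2 c by (intro mult_left_mono) auto
      also have "\<dots> = (c * b) * x" by simp
      also have "\<dots> \<le> 1/2 * x" using c x0 by (intro mult_right_mono) auto
      finally have "iid_prob n (?z + real n * \<mu>) \<le> C * real n * f (x + \<mu>)" using zx x x0 by (intro C(3)) auto
      then show ?thesis using zn by simp
    next
      case 3
      then show ?thesis using iid_prob_le_1[of n "x + \<mu> * m"] nn by simp
    qed
  qed
qed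

text \<open>For \<mu> < 0 the level \<open>z\<close> grows with \<open>n\<close>, so large
  \<open>n\<close> are harmless. For \<open>n < m\<close> it can drop by
  \<open>\<bar>\<mu>\<bar> * m\<close>, which matters only if
  \<open>x < 2 * \<bar>\<mu>\<bar> * m\<close>.\<close>

lemma iid_prob_crude_neg_mean:
  assumes \<mu>: "\<mu> < 0" and \<gamma>: "\<gamma> > 0"
  obtains C x0 where "C > 0" "x0 > 0" "\<And>x m n. x \<ge> x0 \<Longrightarrow> x \<ge> \<gamma> * m \<Longrightarrow> 0 \<le> m \<Longrightarrow>
    iid_prob n (x + \<mu> * m) \<le> C * real n * f (x + \<mu>) + of_bool (real n < m \<and> x < 2 * \<bar>\<mu>\<bar> * m)"
proof -
  \<comment> \<open>For \<open>n \<ge> m\<close>, the part \<open>n - m\<close> is paid by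
    \<open>\<bar>\<mu>\<bar>\<close> and the part \<open>m\<close> by \<gamma>; for smaller
    \<open>n\<close> only \<open>z \<ge> x / 2\<close> is known, hence
    \<open>\<gamma> / 2\<close>.\<close>
  define c where "c = min (\<gamma> / 2) \<bar>\<mu>\<bar>"
  have c: "c > 0" "c \<le> \<gamma> / 2" "c \<le> - \<mu>" "c \<le> \<gamma>" using \<gamma> \<mu> by (auto simp: c_def)
  obtain C x0 where C: "C > 0" "x0 > 0" "\<And>x z n. x \<ge> x0 \<Longrightarrow> z \<ge> 1/2 * x \<Longrightarrow> c * real n \<le> z \<Longrightarrow>
    iid_prob n (z + real n * \<mu>) \<le> C * real n * f (x + \<mu>)"
    by (rule iid_prob_crude[of "1/2" c]) (use c that in auto)
  show ?thesis
  proof (rule that[OF C(1,2)])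
    fix x m :: real and n :: nat
    assume x: "x0 \<le> x" "\<gamma> * m \<le> x" "0 \<le> m"
    have x0: "x > 0" using x C by simp
    let ?z = "x + \<mu> * m - real n * \<mu>"
    have zn: "?z + real n * \<mu> = x + \<mu> * m" by simp
    have nn: "0 \<le> C * real n * f (x + \<mu>)" using C f_nonneg by simp
    consider "m \<le> real n" | "real n < m" "2 * \<bar>\<mu>\<bar> * m \<le> x" | "real n < m" "x < 2 * \<bar>\<mu>\<bar> * m" by linarith
    then show "iid_prob n (x + \<mu> * m) \<le> C * real n * f (x + \<mu>) + of_bool (real n < m \<and> x < 2 * \<bar>\<mu>\<bar> * m)"
    proof cases
      case 1
      have e: "?z = x + (- \<mu>) * (real n - m)" by (simp add: algebra_simps)
      have "0 \<le> (- \<mu>) * (real n - m)" using 1 \<mu> by (intro mult_nonneg_nonneg) auto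
      then have zx: "x \<le> ?z" unfolding e by simp
      have "c * (real n - m) \<le> (- \<mu>) * (real n - m)" using c 1 by (intro mult_right_mono) auto
      moreover have "c * m \<le> \<gamma> * m" using c x by (intro mult_right_mono) auto
      ultimately have "c * real n \<le> ?z" unfolding e using x by (simp add: right_diff_distrib)
      then have "iid_prob n (?z + real n * \<mu>) \<le> C * real n * f (x + \<mu>)" using zx x x0 by (intro C(3)) auto
      then show ?thesis using zn by simp
    next
      case 2
      have "- (\<mu> * m) \<le> 1/2 * x" using 2 \<mu> by simp
      moreover have "real n * \<mu> \<le> 0" using \<mu> by (simp add: mult_nonneg_nonpos)
      ultimately have zx: "1/2 * x \<le> ?z" by simp
      have "c * real n \<le> \<gamma> / 2 * m" using 2 c x \<gamma> by (intro mult_mono) auto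
      then have "c * real n \<le> 1/2 * x" using x by simp
      then have "iid_prob n (?z + real n * \<mu>) \<le> C * real n * f (x + \<mu>)" using zx x by (intro C(3)) auto
      then show ?thesis using zn by simp
    next
      case 3
      then show ?thesis using iid_prob_le_1[of n "x + \<mu> * m"] nn by simp
    qed
  qed
qed

text \<open>Markov's inequality gives \<open>f x = O(x powr (-r))\<close>, so a lower bound cannot
  decay more slowly. This is the source of \<open>p > 1\<close> when the mean is
  nonnegative.\<close>

lemma power_bound_exponent:
  assumes c: "c > 0" and le: "\<And>x. x \<ge> x2 \<Longrightarrow> c * x powr (-s) \<le> f x"
  shows "r \<le> s"
proof (rule ccontr)
  assume "\<not> r \<le> s"
  then have rs: "s - r < 0" by simp
  have "((\<lambda>x::real. tailmom * x powr (s - r)) \<longlongrightarrow> tailmom * 0) at_top"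
    by (intro tendsto_mult tendsto_const) (use rs in real_asymp)
  then have "\<forall>\<^sub>F x in at_top. tailmom * x powr (s - r) < c"
    by (rule order_tendstoD) (use c in simp)
  then have "\<forall>\<^sub>F x in at_top. tailmom * x powr (s - r) < c \<and> x2 \<le> x \<and> 0 < x"
    by (intro eventually_conj eventually_ge_at_top eventually_gt_at_top)
  then obtain x where x: "tailmom * x powr (s - r) < c" "x2 \<le> x" "0 < x"
    unfolding eventually_at_top_linorder by blast
  have "c * x powr (-s) \<le> tailmom * x powr (-r)" using le[OF x(2)] f_le[OF x(3)] by linarith
  then have "c * x powr (-s) * x powr s \<le> tailmom * x powr (-r) * x powr s" by (intro mult_right_mono) auto
  then have "c \<le> tailmom * x powr (s - r)"
    using x(3) by (simp add: mult.assoc powr_add[symmetric])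
  with x(1) show False by simp
qed

end

section \<open>Random number of terms\<close>

lemma unif_lesssimI:
  assumes "\<And>k. 1 < k \<Longrightarrow> \<forall>\<^sub>F t in at_top. \<forall>x\<in>D t. a t x / b t x \<le> ereal k"
  shows "unif_lesssim D a b"
  unfolding unif_lesssim_def
proof (rule ccontr)
  let ?l = "Limsup at_top (\<lambda>t. SUP x\<in>D t. a t x / b t x)"
  assume "\<not> ?l \<le> 1"
  then obtain k where k: "1 < ereal k" "ereal k < ?l" using ereal_dense2[of 1 ?l] by (auto simp: not_le)
  have "?l \<le> ereal k"
  proof (rule Limsup_bounded)
    show "\<forall>\<^sub>F t in at_top. (SUP x\<in>D t. a t x / b t x) \<le> ereal k"
      using assms[of k] k(1) by (auto elim!: eventually_mono intro!: SUP_least simp: one_ereal_def)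
  qed
  with k(2) show False by simp
qed

text \<open>Expressed through the distribution function, which is monotone. It feeds the
  measure-theoretic argument behind \<open>uniform_increments\<close>.\<close>

lemma F_Delta_borel_measurable:
  assumes F: "prob_space F" and sF: "sets F = sets borel" and T: "0 < T"
  shows "F_Delta F T \<in> borel_measurable borel"
proof -
  interpret prob_space F by fact
  have m: "(\<lambda>x. measure F {..x}) \<in> borel_measurable borel"
    by (intro borel_measurable_mono monoI finite_measure_mono) (auto simp: sF)
  have sp: "space F = UNIV" using sets_eq_imp_space_eq[OF sF] by simp
  show ?thesis
  proof (cases T)
    case (real d)
    have d: "0 < d" using T real by simp
    have "F_Delta F T x = measure F {..x + d} - measure F {..x}" for x
    proof -
      have "translate x (Delta T) = {..x + d} - {..x}"
        using real by (auto simp: mem_translate_Delta)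
      then show ?thesis unfolding F_Delta_def
        using d by (simp add: finite_measure_Diff sF)
    qed
    then have "F_Delta F T = (\<lambda>x. measure F {..x + d} - measure F {..x})" by auto
    also have "\<dots> \<in> borel_measurable borel"
      using measurable_compose[OF _ m, of "\<lambda>x. x + d"] m by simp
    finally show ?thesis .
  next
    case PInf
    have "F_Delta F T x = 1 - measure F {..x}" for x
    proof -
      have "translate x (Delta T) = space F - {..x}"
        using PInf by (auto simp: mem_translate_Delta sp)
      then show ?thesis unfolding F_Delta_def by (simp add: prob_compl sF)
    qed
    then have "F_Delta F T = (\<lambda>x. 1 - measure F {..x})" by auto
    also have "\<dots> \<in> borel_measurable borel" using m by simp
    finally show ?thesis .
  next
    case MInf
    then show ?thesis using T by simp
  qed
qed

text \<open>The summands enter only through \<open>iid_prob\<close>, so the locale keeps just the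
  law of each \<open>N t\<close> and its mean.\<close>

locale random_index = heavy_local F T r \<mu> for F T r \<mu> +
  fixes M :: "'a measure" and N :: "real \<Rightarrow> 'a \<Rightarrow> nat" and lam :: "real \<Rightarrow> real"
  assumes prob_M: "prob_space M"
    and N_meas: "\<And>t. 0 \<le> t \<Longrightarrow> N t \<in> measurable M (count_space UNIV)"
    and N_int: "\<And>t. 0 \<le> t \<Longrightarrow> integrable M (\<lambda>\<omega>. real (N t \<omega>))"
    and N_mean: "\<And>t. 0 \<le> t \<Longrightarrow> lam t = (\<integral>\<omega>. real (N t \<omega>) \<partial>M)"
    and lam_lim: "filterlim lam at_top at_top"
begin

sublocale M: prob_space M by (rule prob_M)

text \<open>By \<open>random_sum_mixture\<close> this is the probability that the centred random sum
  lies in the translate of \<Delta> by \<open>x\<close>.\<close>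

definition mixture_prob :: "real \<Rightarrow> real \<Rightarrow> real" where
  "mixture_prob t x = (\<integral>\<omega>. iid_prob (N t \<omega>) (x + \<mu> * lam t) \<partial>M)"

abbreviation tail_power :: "real \<Rightarrow> real \<Rightarrow> real \<Rightarrow> 'a \<Rightarrow> real" where
  "tail_power p \<delta> t \<equiv> \<lambda>\<omega>. real (N t \<omega>) powr p * indicator {\<omega>. real (N t \<omega>) > (1 + \<delta>) * lam t} \<omega>"

abbreviation abs_dev :: "real \<Rightarrow> real" where
  "abs_dev t \<equiv> \<integral>\<omega>. \<bar>real (N t \<omega>) - lam t\<bar> \<partial>M"

abbreviation far_prob :: "real \<Rightarrow> real \<Rightarrow> (nat \<Rightarrow> bool) \<Rightarrow> real" where
  "far_prob \<delta> t A \<equiv> measure M {\<omega>\<in>space M. \<delta> * lam t < \<bar>real (N t \<omega>) - lam t\<bar> \<and> A (N t \<omega>)}"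

lemma lam_ge: "\<forall>\<^sub>F t in at_top. c \<le> lam t"
  using lam_lim by (simp add: filterlim_at_top)

lemma abs_dev_integrable: "0 \<le> t \<Longrightarrow> integrable M (\<lambda>\<omega>. \<bar>real (N t \<omega>) - lam t\<bar>)"
  using N_int[of t] by (intro integrable_abs Bochner_Integration.integrable_diff) auto

lemma iid_prob_N_integrable:
  assumes t: "0 \<le> t"
  shows "integrable M (\<lambda>\<omega>. iid_prob (N t \<omega>) y)"
proof (rule M.integrable_const_bound[of _ 1])
  show "(\<lambda>\<omega>. iid_prob (N t \<omega>) y) \<in> borel_measurable M"
    by (rule measurable_compose[OF N_meas[OF t], of "\<lambda>n. iid_prob n y" borel]) simp
qed (auto simp: iid_prob_nonneg iid_prob_le_1)

section \<open>Concentration of N(t) in mean\<close>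

text \<open>Where \<open>N t\<close> exceeds its mean and \<open>p > 1\<close>, it is at most
  \<open>lam t powr (1 - p)\<close> times its \<open>p\<close>-th power. The tail assumption then
  bounds the upper part by \<open>o(lam t)\<close>, apart from the tolerance
  \<open>d * lam t\<close>.\<close>

lemma L1_upper_tail:
  assumes p: "p > 1"
    and int: "\<And>\<delta>. \<delta> > 0 \<Longrightarrow> \<forall>\<^sub>F t in at_top. integrable M (tail_power p \<delta> t)"
    and O: "\<And>\<delta>. \<delta> > 0 \<Longrightarrow> (\<lambda>t. integral\<^sup>L M (tail_power p \<delta> t)) \<in> O[at_top](lam)"
    and \<epsilon>: "\<epsilon> > 0"
  shows "\<forall>\<^sub>F t in at_top. abs_dev t \<le> \<epsilon> * lam t"
proof -
  \<comment> \<open>The two contributions \<open>d * lam t\<close> are doubled when passing from the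
    upper part to the absolute deviation.\<close>
  define d where "d = \<epsilon> / 4"
  have d: "d > 0" using \<epsilon> by (simp add: d_def)
  obtain c where c: "c > 0" "\<forall>\<^sub>F t in at_top. norm (integral\<^sup>L M (tail_power p d t)) \<le> c * norm (lam t)"
    using landau_o.bigE[OF O[OF d]] by blast
  have p1: "1 - p < 0" using p by simp
  have "((\<lambda>u::real. c * u powr (1 - p)) \<longlongrightarrow> c * 0) at_top"
    by (intro tendsto_mult tendsto_const) (use p1 in real_asymp)
  then have "\<forall>\<^sub>F u in at_top. c * u powr (1 - p) < d"
    by (rule order_tendstoD) (use d in simp)
  then have "\<forall>\<^sub>F t in at_top. c * lam t powr (1 - p) < d"
    by (rule eventually_compose_filterlim[OF _ lam_lim])
  with c(2) int[OF d] lam_ge[of 1] eventually_ge_at_top[of 0] show ?thesis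
  proof eventually_elim
    case (elim t)
    let ?Z = "tail_power p d t"
    have "(\<integral>\<omega>. max 0 (real (N t \<omega>) - lam t) \<partial>M) \<le> (\<integral>\<omega>. d * lam t + lam t powr (1 - p) * ?Z \<omega> \<partial>M)"
    proof (rule integral_mono)
      show "integrable M (\<lambda>\<omega>. max 0 (real (N t \<omega>) - lam t))" using N_int[of t] elim by auto
      show "integrable M (\<lambda>\<omega>. d * lam t + lam t powr (1 - p) * ?Z \<omega>)"
        by (intro Bochner_Integration.integrable_add integrable_mult_right elim(2)) auto
      fix \<omega>
      show "max 0 (real (N t \<omega>) - lam t) \<le> d * lam t + lam t powr (1 - p) * ?Z \<omega>"
      proof (cases "real (N t \<omega>) > (1 + d) * lam t")
        case True
        have "1 * lam t \<le> (1 + d) * lam t" using elim d by (intro mult_right_mono) auto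
        then have n: "lam t \<le> real (N t \<omega>)" using True by linarith
        have "real (N t \<omega>) = real (N t \<omega>) powr (1 - p) * real (N t \<omega>) powr p"
          using n elim by (simp add: powr_add[symmetric])
        also have "\<dots> \<le> lam t powr (1 - p) * real (N t \<omega>) powr p"
          using n elim p by (intro mult_right_mono powr_mono2') auto
        finally have "real (N t \<omega>) \<le> lam t powr (1 - p) * ?Z \<omega>" using True by simp
        moreover have "0 \<le> d * lam t" using d elim by simp
        ultimately show ?thesis using n elim by simp
      next
        case False
        moreover have "0 \<le> d * lam t" using d elim by simp
        ultimately show ?thesis by (simp add: distrib_right)
      qed
    qed
    also have "\<dots> = d * lam t + lam t powr (1 - p) * (\<integral>\<omega>. ?Z \<omega> \<partial>M)"
      using elim(2) by (simp add: M.prob_space)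
    also have "\<dots> \<le> d * lam t + lam t powr (1 - p) * (c * lam t)"
      using elim(1,3) by (intro add_left_mono mult_left_mono) auto
    also have "\<dots> = d * lam t + (c * lam t powr (1 - p)) * lam t" by simp
    also have "\<dots> \<le> d * lam t + d * lam t" using elim by (intro add_left_mono mult_right_mono) auto
    finally have "2 * (\<integral>\<omega>. max 0 (real (N t \<omega>) - lam t) \<partial>M) \<le> \<epsilon> * lam t" by (simp add: d_def)
    then show ?case
      using mean_absolute_deviation(1)[OF prob_M N_int[OF elim(4)] N_mean[OF elim(4)]] by simp
  qed
qed

lemma f_lam_small:
  assumes "\<epsilon> > 0"
  shows "\<forall>\<^sub>F t in at_top. lam t * f (lam t) \<le> \<epsilon>"
proof -
  have r1: "1 - r < 0" using r by simp
  have "((\<lambda>u::real. tailmom * u powr (1 - r)) \<longlongrightarrow> tailmom * 0) at_top"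
    by (intro tendsto_mult tendsto_const) (use r1 in real_asymp)
  then have "\<forall>\<^sub>F u in at_top. tailmom * u powr (1 - r) < \<epsilon>"
    by (rule order_tendstoD) (use assms in simp)
  then have "\<forall>\<^sub>F t in at_top. tailmom * lam t powr (1 - r) < \<epsilon>"
    by (rule eventually_compose_filterlim[OF _ lam_lim])
  with lam_ge[of 1] show ?thesis
  proof eventually_elim
    case (elim t)
    have "lam t * f (lam t) \<le> lam t * (tailmom * lam t powr (-r))"
      using elim f_le[of "lam t"] by (intro mult_left_mono) auto
    also have "\<dots> = tailmom * (lam t powr 1 * lam t powr (-r))" using elim by simp
    also have "\<dots> = tailmom * lam t powr (1 - r)" unfolding powr_add[symmetric] by simp
    finally show ?case using elim by linarith
  qed
qed

text \<open>The lower part is at most \<open>lam t\<close>, so a vanishing probability of the lower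
  tail is enough; it vanishes because \<open>lam t * f (lam t)\<close> tends to 0.\<close>

lemma L1_lower_tail:
  assumes o: "\<And>\<delta>. 0 < \<delta> \<Longrightarrow> \<delta> < 1 \<Longrightarrow> (\<lambda>t. measure M {\<omega>\<in>space M. real (N t \<omega>) \<le> (1 - \<delta>) * lam t})
              \<in> o[at_top](\<lambda>t. lam t * f (lam t))"
    and \<epsilon>: "\<epsilon> > 0"
  shows "\<forall>\<^sub>F t in at_top. abs_dev t \<le> \<epsilon> * lam t"
proof -
  define d where "d = min (1/2) (\<epsilon> / 4)"
  have d: "0 < d" "d < 1" "4 * d \<le> \<epsilon>" using \<epsilon> by (auto simp: d_def)
  have "\<forall>\<^sub>F t in at_top. norm (measure M {\<omega>\<in>space M. real (N t \<omega>) \<le> (1 - d) * lam t}) \<le> 1 * norm (lam t * f (lam t))"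
    by (rule landau_o.smallD[OF o[OF d(1,2)]]) simp
  with f_lam_small[OF d(1)] lam_ge[of 1] eventually_ge_at_top[of 0] show ?thesis
  proof eventually_elim
    case (elim t)
    let ?A = "{\<omega>\<in>space M. real (N t \<omega>) \<le> (1 - d) * lam t}"
    have [measurable]: "N t \<in> measurable M (count_space UNIV)" using N_meas elim by simp
    have A: "?A \<in> sets M" by measurable
    have mA: "measure M ?A \<le> d" using elim f_nonneg by simp
    have "(\<integral>\<omega>. max 0 (lam t - real (N t \<omega>)) \<partial>M) \<le> (\<integral>\<omega>. d * lam t + lam t * indicator ?A \<omega> \<partial>M)"
    proof (rule integral_mono)
      show "integrable M (\<lambda>\<omega>. max 0 (lam t - real (N t \<omega>)))" using N_int[of t] elim by auto
      show "integrable M (\<lambda>\<omega>. d * lam t + lam t * indicator ?A \<omega>)"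
        using A by (intro Bochner_Integration.integrable_add integrable_mult_right integrable_real_indicator) (auto simp: M.emeasure_eq_measure)
      fix \<omega> assume "\<omega> \<in> space M"
      moreover have "0 \<le> d * lam t" using d elim by simp
      ultimately show "max 0 (lam t - real (N t \<omega>)) \<le> d * lam t + lam t * indicator ?A \<omega>"
        using elim by (auto simp: left_diff_distrib split: split_indicator)
    qed
    also have "\<dots> = d * lam t + lam t * measure M ?A"
      using A sets.sets_into_space[OF A] by (simp add: M.prob_space Int_absorb2 M.emeasure_eq_measure)
    also have "\<dots> \<le> d * lam t + lam t * d" using mA elim by (intro add_left_mono mult_left_mono) auto
    finally have "2 * (\<integral>\<omega>. max 0 (lam t - real (N t \<omega>)) \<partial>M) \<le> (4 * d) * lam t" by simp
    also have "\<dots> \<le> \<epsilon> * lam t" using d elim by (intro mult_right_mono) auto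
    finally show ?case
      using mean_absolute_deviation(2)[OF prob_M N_int[OF elim(3)] N_mean[OF elim(3)]] by simp
  qed
qed

text \<open>Away from the mean, a bound linear in \<open>n\<close> becomes one linear in the
  deviation, to which concentration in mean applies.\<close>

lemma far_from_mean_bound:
  fixes n m \<delta> :: real
  assumes "\<delta> > 0" "m \<ge> 0" "\<delta> * m < \<bar>n - m\<bar>"
  shows "n \<le> (1 + 1 / \<delta>) * \<bar>n - m\<bar>"
proof -
  have "m \<le> \<bar>n - m\<bar> / \<delta>" using assms by (simp add: field_simps)
  then have "n \<le> \<bar>n - m\<bar> + \<bar>n - m\<bar> / \<delta>" by linarith
  then show ?thesis by (simp add: distrib_right)
qed

section \<open>Averaging over the number of terms\<close>

text \<open>\<open>B t x\<close> marks the indices for which only the trivial bound 1 is available.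
  Keeping it abstract lets both signs of the mean share one argument, with \<open>rem\<close> the
  sole place where they differ.\<close>

lemma mixture_prob_upper:
  assumes \<gamma>: "\<gamma> > 0" and K: "L_index f < ereal K" and C: "C \<ge> 0"
    and L1: "\<And>\<epsilon>. \<epsilon> > 0 \<Longrightarrow> \<forall>\<^sub>F t in at_top. abs_dev t \<le> \<epsilon> * lam t"
    and crude: "\<forall>\<^sub>F t in at_top. \<forall>x\<ge>\<gamma> * lam t. \<forall>n. iid_prob n (x + \<mu> * lam t) \<le> C * real n * f (x + \<mu>) + of_bool (B t x n)"
    and rem: "\<And>\<delta> \<epsilon>. 0 < \<delta> \<Longrightarrow> \<delta> < 1 \<Longrightarrow> \<epsilon> > 0 \<Longrightarrow> \<forall>\<^sub>F t in at_top. \<forall>x\<ge>\<gamma> * lam t.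
      far_prob \<delta> t (B t x) \<le> \<epsilon> * (lam t * f (x + \<mu>))"
    and \<epsilon>: "\<epsilon> > 0"
  shows "\<forall>\<^sub>F t in at_top. \<forall>x\<ge>\<gamma> * lam t. mixture_prob t x \<le> (K\<^sup>2 + \<epsilon>) * (lam t * f (x + \<mu>))"
proof -
  obtain l where "l_index f = ereal l" "0 < l" using O_regularly_varying_l_index[OF OR AD] by blast
  \<comment> \<open>\<open>iid_prob_near_mean\<close> asks for a lower constant too; half of the
    positive index is admissible.\<close>
  then have l: "ereal (l / 2) < l_index f" "0 < l / 2" by auto
  obtain \<delta> x0 where d: "0 < \<delta>" "\<delta> < 1" "x0 > 0" and both:
    "\<And>x m n. x \<ge> x0 \<Longrightarrow> 0 \<le> m \<Longrightarrow> x \<ge> \<gamma> * m \<Longrightarrow> \<bar>real n - m\<bar> \<le> \<delta> * m \<Longrightarrow>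
      iid_prob n (x + \<mu> * m) \<in> {real n * ((l / 2)\<^sup>2 * f (x + \<mu>))..real n * (K\<^sup>2 * f (x + \<mu>))}"
    by (rule iid_prob_near_mean[OF \<gamma> K l]) (rule that)
  note near = both[unfolded atLeastAtMost_iff, THEN conjunct2]
  define w where "w = C * (1 + 1 / \<delta>)"
  have w: "w \<ge> 0" using C d by (simp add: w_def)
  define e where "e = \<epsilon> / 2 / (w + 1)"
  have e: "e > 0" "w * e \<le> \<epsilon> / 2" using \<epsilon> w by (auto simp: e_def field_simps)
  have e2: "\<epsilon> / 2 > 0" using \<epsilon> by simp
  show ?thesis
    using L1[OF e(1)] crude rem[OF d(1,2) e2] lam_ge[of 1] lam_ge[of "x0 / \<gamma>"] eventually_ge_at_top[of 0]
  proof eventually_elim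
    case (elim t)
    have [measurable]: "N t \<in> measurable M (count_space UNIV)" using N_meas elim by simp
    show ?case
    proof (intro allI impI)
      fix x assume x: "\<gamma> * lam t \<le> x"
      have xx: "x \<ge> x0" using x elim(5) \<gamma> by (simp add: field_simps)
      let ?v = "f (x + \<mu>)"
      let ?A = "{\<omega>\<in>space M. \<delta> * lam t < \<bar>real (N t \<omega>) - lam t\<bar> \<and> B t x (N t \<omega>)}"
      \<comment> \<open>The three terms dominate near indices, far indices under the crude bound,
        and the marked far indices, respectively.\<close>
      let ?G = "\<lambda>\<omega>. K\<^sup>2 * ?v * real (N t \<omega>) + w * ?v * \<bar>real (N t \<omega>) - lam t\<bar> + indicator ?A \<omega>"
      have A: "?A \<in> sets M" by measurable
      have iN: "integrable M (\<lambda>\<omega>. real (N t \<omega>))" using N_int elim by simp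
      have iD: "integrable M (\<lambda>\<omega>. \<bar>real (N t \<omega>) - lam t\<bar>)" using abs_dev_integrable elim by simp
      have iA: "integrable M (indicator ?A :: 'a \<Rightarrow> real)"
        using A by (intro integrable_real_indicator) (auto simp: M.emeasure_eq_measure)
      have "mixture_prob t x \<le> (\<integral>\<omega>. ?G \<omega> \<partial>M)"
        unfolding mixture_prob_def
      proof (rule integral_mono)
        show "integrable M (\<lambda>\<omega>. iid_prob (N t \<omega>) (x + \<mu> * lam t))" using elim by (intro iid_prob_N_integrable)
        show "integrable M ?G" by (intro Bochner_Integration.integrable_add integrable_mult_right iN iD iA)
        fix \<omega> assume \<omega>: "\<omega> \<in> space M"
        let ?n = "N t \<omega>"
        show "iid_prob ?n (x + \<mu> * lam t) \<le> ?G \<omega>"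
        proof (cases "\<bar>real ?n - lam t\<bar> \<le> \<delta> * lam t")
          case True
          have "iid_prob ?n (x + \<mu> * lam t) \<le> real ?n * (K\<^sup>2 * ?v)"
            using elim True by (intro near xx x) auto
          moreover have "0 \<le> w * ?v * \<bar>real ?n - lam t\<bar>" using w f_nonneg by simp
          moreover have "(0::real) \<le> indicator ?A \<omega>" by simp
          moreover have "real ?n * (K\<^sup>2 * ?v) = K\<^sup>2 * ?v * real ?n" by simp
          ultimately show ?thesis by linarith
        next
          case False
          then have far: "\<delta> * lam t < \<bar>real ?n - lam t\<bar>" by simp
          have "C * real ?n * ?v \<le> C * ((1 + 1 / \<delta>) * \<bar>real ?n - lam t\<bar>) * ?v"
            using far_from_mean_bound[OF d(1) _ far] elim C f_nonneg by (intro mult_right_mono mult_left_mono) auto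
          also have "\<dots> = w * ?v * \<bar>real ?n - lam t\<bar>" by (simp add: w_def)
          finally have 1: "C * real ?n * ?v \<le> w * ?v * \<bar>real ?n - lam t\<bar>" .
          have 2: "of_bool (B t x ?n) = (indicator ?A \<omega> :: real)" using far \<omega> by (auto simp: indicator_def)
          have 3: "0 \<le> K\<^sup>2 * ?v * real ?n" using f_nonneg by simp
          have "iid_prob ?n (x + \<mu> * lam t) \<le> C * real ?n * ?v + of_bool (B t x ?n)" using elim(2) x by blast
          then show ?thesis using 1 2 3 by linarith
        qed
      qed
      also have "\<dots> = K\<^sup>2 * ?v * lam t + w * ?v * abs_dev t + measure M ?A"
      proof -
        have "(\<integral>\<omega>. ?G \<omega> \<partial>M) = (\<integral>\<omega>. K\<^sup>2 * ?v * real (N t \<omega>) \<partial>M) + (\<integral>\<omega>. w * ?v * \<bar>real (N t \<omega>) - lam t\<bar> \<partial>M) + (\<integral>\<omega>. indicator ?A \<omega> \<partial>M)"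
          unfolding Bochner_Integration.integral_add[OF integrable_mult_right[OF iN] integrable_mult_right[OF iD], symmetric]
          by (rule Bochner_Integration.integral_add[OF Bochner_Integration.integrable_add[OF
                integrable_mult_right[OF iN] integrable_mult_right[OF iD]] iA])
        moreover have "(\<integral>\<omega>. indicator ?A \<omega> \<partial>M) = measure M ?A"
          using sets.sets_into_space[OF A] by (simp add: Int_absorb2)
        ultimately show ?thesis using N_mean[of t] elim by simp
      qed
      also have "\<dots> \<le> K\<^sup>2 * ?v * lam t + w * ?v * (e * lam t) + \<epsilon> / 2 * (lam t * ?v)"
        using elim(1,3) x w f_nonneg by (intro add_mono mult_left_mono order_refl) auto
      also have "\<dots> = (K\<^sup>2 + w * e + \<epsilon> / 2) * (lam t * ?v)" by (simp add: algebra_simps)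
      also have "\<dots> \<le> (K\<^sup>2 + \<epsilon>) * (lam t * ?v)"
        using e(2) elim f_nonneg by (intro mult_right_mono mult_nonneg_nonneg) auto
      finally show "mixture_prob t x \<le> (K\<^sup>2 + \<epsilon>) * (lam t * ?v)" .
    qed
  qed
qed

text \<open>Far indices need no estimate: \<open>w\<close> is so large that the minorant
  \<open>K\<^sup>2 * n - w * \<bar>n - lam t\<bar>\<close> is nonpositive there. Hence the sign of
  \<mu> is irrelevant here.\<close>

lemma mixture_prob_lower:
  assumes \<gamma>: "\<gamma> > 0" and K: "ereal K < l_index f" "0 < K"
    and L1: "\<And>\<epsilon>. \<epsilon> > 0 \<Longrightarrow> \<forall>\<^sub>F t in at_top. abs_dev t \<le> \<epsilon> * lam t"
    and \<epsilon>: "\<epsilon> > 0"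
  shows "\<forall>\<^sub>F t in at_top. \<forall>x\<ge>\<gamma> * lam t. (K\<^sup>2 - \<epsilon>) * (lam t * f (x + \<mu>)) \<le> mixture_prob t x"
proof -
  obtain L where "L_index f = ereal L" using O_regularly_varying_L_index[OF OR AD] by blast
  then have L: "L_index f < ereal (L + 1)" by simp
  obtain \<delta> x0 where d: "0 < \<delta>" "\<delta> < 1" "x0 > 0" and both:
    "\<And>x m n. x \<ge> x0 \<Longrightarrow> 0 \<le> m \<Longrightarrow> x \<ge> \<gamma> * m \<Longrightarrow> \<bar>real n - m\<bar> \<le> \<delta> * m \<Longrightarrow>
      iid_prob n (x + \<mu> * m) \<in> {real n * (K\<^sup>2 * f (x + \<mu>))..real n * ((L + 1)\<^sup>2 * f (x + \<mu>))}"
    by (rule iid_prob_near_mean[OF \<gamma> L K]) (rule that)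
  note near = both[unfolded atLeastAtMost_iff, THEN conjunct1]
  define w where "w = K\<^sup>2 * (1 + 1 / \<delta>)"
  have w: "w > 0" using K d by (auto simp: w_def intro!: mult_pos_pos add_pos_pos)
  define e where "e = \<epsilon> / w"
  have e: "e > 0" "w * e = \<epsilon>" using \<epsilon> w by (auto simp: e_def)
  show ?thesis
    using L1[OF e(1)] lam_ge[of 1] lam_ge[of "x0 / \<gamma>"] eventually_ge_at_top[of 0]
  proof eventually_elim
    case (elim t)
    have [measurable]: "N t \<in> measurable M (count_space UNIV)" using N_meas elim by simp
    show ?case
    proof (intro allI impI)
      fix x assume x: "\<gamma> * lam t \<le> x"
      have xx: "x \<ge> x0" using x elim(3) \<gamma> by (simp add: field_simps)
      let ?v = "f (x + \<mu>)"
      let ?G = "\<lambda>\<omega>. K\<^sup>2 * ?v * real (N t \<omega>) - w * ?v * \<bar>real (N t \<omega>) - lam t\<bar>"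
      have iN: "integrable M (\<lambda>\<omega>. real (N t \<omega>))" using N_int elim by simp
      have iD: "integrable M (\<lambda>\<omega>. \<bar>real (N t \<omega>) - lam t\<bar>)" using abs_dev_integrable elim by simp
      have "(K\<^sup>2 - \<epsilon>) * (lam t * ?v) = K\<^sup>2 * ?v * lam t - w * ?v * (e * lam t)"
        unfolding e(2)[symmetric] by (simp add: algebra_simps)
      also have "\<dots> \<le> K\<^sup>2 * ?v * lam t - w * ?v * abs_dev t"
        using elim(1) w f_nonneg by (intro diff_left_mono mult_left_mono) auto
      also have "\<dots> = (\<integral>\<omega>. ?G \<omega> \<partial>M)"
        by (subst Bochner_Integration.integral_diff[OF integrable_mult_right[OF iN] integrable_mult_right[OF iD]])
           (use N_mean[of t] elim in simp)
      also have "\<dots> \<le> mixture_prob t x"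
        unfolding mixture_prob_def
      proof (rule integral_mono)
        show "integrable M (\<lambda>\<omega>. iid_prob (N t \<omega>) (x + \<mu> * lam t))" using elim by (intro iid_prob_N_integrable)
        show "integrable M ?G" by (intro Bochner_Integration.integrable_diff integrable_mult_right iN iD)
        fix \<omega>
        let ?n = "N t \<omega>"
        show "?G \<omega> \<le> iid_prob ?n (x + \<mu> * lam t)"
        proof (cases "\<bar>real ?n - lam t\<bar> \<le> \<delta> * lam t")
          case True
          have "real ?n * (K\<^sup>2 * ?v) \<le> iid_prob ?n (x + \<mu> * lam t)"
            using elim True by (intro near xx x) auto
          moreover have "0 \<le> w * ?v * \<bar>real ?n - lam t\<bar>" using w f_nonneg by simp
          ultimately show ?thesis by (simp add: mult_ac)
        next
          case False
          then have far: "\<delta> * lam t < \<bar>real ?n - lam t\<bar>" by simp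
          have "K\<^sup>2 * ?v * real ?n \<le> K\<^sup>2 * ?v * ((1 + 1 / \<delta>) * \<bar>real ?n - lam t\<bar>)"
            using far_from_mean_bound[OF d(1) _ far] elim f_nonneg by (intro mult_left_mono) auto
          also have "\<dots> = w * ?v * \<bar>real ?n - lam t\<bar>" by (simp add: w_def)
          finally show ?thesis using iid_prob_nonneg[of ?n "x + \<mu> * lam t"] by linarith
        qed
      qed
      finally show "(K\<^sup>2 - \<epsilon>) * (lam t * ?v) \<le> mixture_prob t x" .
    qed
  qed
qed

section \<open>Indices covered only by the trivial bound\<close>

text \<open>Markov's inequality with the \<open>p\<close>-th power bounds the probability by a
  multiple of \<open>lam t * x powr (-p)\<close>. Since \<open>s < p\<close>, this is of smaller
  order than \<open>lam t * x powr (-s)\<close>, and so than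
  \<open>lam t * f (x + \<mu>)\<close>.\<close>

lemma remainder_nonneg_mean:
  assumes \<gamma>: "\<gamma> > 0" and b: "b > 0"
    and sp: "s < p" "0 \<le> s" and c0: "c0 > 0" "\<And>x. x \<ge> x2 \<Longrightarrow> c0 * x powr (-s) \<le> f x"
    and int: "\<forall>\<^sub>F t in at_top. integrable M (tail_power p \<delta> t)"
    and O: "(\<lambda>t. integral\<^sup>L M (tail_power p \<delta> t)) \<in> O[at_top](lam)"
    and \<epsilon>: "\<epsilon> > 0"
  shows "\<forall>\<^sub>F t in at_top. \<forall>x\<ge>\<gamma> * lam t.
      far_prob \<delta> t (\<lambda>n. lam t < real n \<and> b * x < real n)
        \<le> \<epsilon> * (lam t * f (x + \<mu>))"
proof -
  have p: "p > 0" using sp by simp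
  obtain c where c: "c > 0" "\<forall>\<^sub>F t in at_top. norm (integral\<^sup>L M (tail_power p \<delta> t)) \<le> c * norm (lam t)"
    using landau_o.bigE[OF O] by blast
  have sp': "s - p < 0" using sp by simp
  \<comment> \<open>Collects the constants; \<open>2 powr s\<close> comes from
    \<open>x + \<mu> \<le> 2 * x\<close>.\<close>
  define u where "u = c / b powr p * 2 powr s / c0"
  have "((\<lambda>x::real. u * x powr (s - p)) \<longlongrightarrow> u * 0) at_top"
    by (intro tendsto_mult tendsto_const) (use sp' in real_asymp)
  then have "\<forall>\<^sub>F x in at_top. u * x powr (s - p) < \<epsilon>"
    by (rule order_tendstoD) (use \<epsilon> in simp)
  then obtain x1 where x1: "\<And>x. x \<ge> x1 \<Longrightarrow> u * x powr (s - p) < \<epsilon>"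
    unfolding eventually_at_top_linorder by blast
  define X where "X = max 1 (max x1 (\<bar>x2\<bar> + 2 * \<bar>\<mu>\<bar>))"
  have main: "c * (b * x) powr (-p) \<le> \<epsilon> * f (x + \<mu>)" if x: "x \<ge> X" for x
  proof -
    have xx: "x \<ge> 1" "x \<ge> x1" "x \<ge> \<bar>x2\<bar> + 2 * \<bar>\<mu>\<bar>" using x by (auto simp: X_def)
    have a: "x2 \<le> x + \<mu>" "0 < x + \<mu>" "x + \<mu> \<le> 2 * x" using xx by linarith+
    have "c * (b * x) powr (-p) = c0 * (2 powr (-s) * x powr (-s)) * (u * x powr (s - p))"
      using xx b c0(1) by (simp add: u_def powr_mult powr_minus powr_diff field_simps)
    also have "\<dots> = c0 * (2 * x) powr (-s) * (u * x powr (s - p))"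
      using xx by (simp add: powr_mult)
    also have "\<dots> \<le> c0 * (2 * x) powr (-s) * \<epsilon>"
      using x1[OF xx(2)] c0(1) by (intro mult_left_mono) auto
    also have "\<dots> \<le> c0 * (x + \<mu>) powr (-s) * \<epsilon>"
      using a sp c0(1) \<epsilon> by (intro mult_right_mono mult_left_mono powr_mono2') auto
    also have "\<dots> \<le> f (x + \<mu>) * \<epsilon>" using c0(2)[OF a(1)] \<epsilon> by (intro mult_right_mono) auto
    finally show ?thesis by (simp add: mult.commute)
  qed
  show ?thesis
    using c(2) int lam_ge[of 1] lam_ge[of "X / \<gamma>"] eventually_ge_at_top[of 0]
  proof eventually_elim
    case (elim t)
    have [measurable]: "N t \<in> measurable M (count_space UNIV)" using N_meas elim by simp
    show ?case
    proof (intro allI impI)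
      fix x assume x: "\<gamma> * lam t \<le> x"
      have xx: "x \<ge> X" using x elim(4) \<gamma> by (simp add: field_simps)
      have xp: "x > 0" using xx by (simp add: X_def)
      let ?Z = "tail_power p \<delta> t"
      let ?A = "{\<omega>\<in>space M. \<delta> * lam t < \<bar>real (N t \<omega>) - lam t\<bar> \<and> (lam t < real (N t \<omega>) \<and> b * x < real (N t \<omega>))}"
      have "measure M ?A \<le> (\<integral>\<omega>. (b * x) powr (-p) * ?Z \<omega> \<partial>M)"
      proof (rule measure_le_integral)
        show "finite_measure M" by (rule M.finite_measure_axioms)
        show "?A \<in> sets M" by measurable
        show "integrable M (\<lambda>\<omega>. (b * x) powr (-p) * ?Z \<omega>)" by (intro integrable_mult_right elim(2))
        show "0 \<le> (b * x) powr (-p) * ?Z \<omega>" for \<omega> by simp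
        fix \<omega> assume \<omega>: "\<omega> \<in> ?A"
        then have n: "(1 + \<delta>) * lam t < real (N t \<omega>)" "b * x < real (N t \<omega>)" by (auto simp: distrib_right)
        have "(b * x) powr p \<le> real (N t \<omega>) powr p" using n b xp p by (intro powr_mono2) auto
        then have "(b * x) powr (-p) * (b * x) powr p \<le> (b * x) powr (-p) * real (N t \<omega>) powr p"
          by (intro mult_left_mono) auto
        moreover have "(b * x) powr (-p) * (b * x) powr p = 1" using b xp by (simp add: powr_add[symmetric])
        ultimately show "1 \<le> (b * x) powr (-p) * ?Z \<omega>" using n by simp
      qed
      also have "\<dots> = (b * x) powr (-p) * (\<integral>\<omega>. ?Z \<omega> \<partial>M)" by simp
      also have "\<dots> \<le> (b * x) powr (-p) * (c * lam t)"
        using elim(1,3) by (intro mult_left_mono) auto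
      also have "\<dots> = (c * (b * x) powr (-p)) * lam t" by simp
      also have "\<dots> \<le> (\<epsilon> * f (x + \<mu>)) * lam t" using main[OF xx] elim by (intro mult_right_mono) auto
      finally show "measure M ?A \<le> \<epsilon> * (lam t * f (x + \<mu>))" by (simp add: mult_ac)
    qed
  qed
qed

text \<open>The event is empty unless \<open>lam t > x / (2 * \<bar>\<mu>\<bar>)\<close>. Then
  \<open>f (lam t) \<le> C * f (x + \<mu>)\<close> by domination, which converts the assumed rate at
  \<open>lam t\<close> into one at \<open>x + \<mu>\<close>.\<close>

lemma remainder_neg_mean:
  assumes \<gamma>: "\<gamma> > 0" and \<mu>: "\<mu> < 0" and \<delta>: "0 < \<delta>" "\<delta> < 1"
    and o: "(\<lambda>t. measure M {\<omega>\<in>space M. real (N t \<omega>) \<le> (1 - \<delta>) * lam t}) \<in> o[at_top](\<lambda>t. lam t * f (lam t))"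
    and \<epsilon>: "\<epsilon> > 0"
  shows "\<forall>\<^sub>F t in at_top. \<forall>x\<ge>\<gamma> * lam t.
      far_prob \<delta> t (\<lambda>n. real n < lam t \<and> x < 2 * \<bar>\<mu>\<bar> * lam t)
        \<le> \<epsilon> * (lam t * f (x + \<mu>))"
proof -
  have a: "1 / (2 * \<bar>\<mu>\<bar>) > 0" using \<mu> by simp
  obtain C x0 where C: "C > 0" "x0 > 0" "\<And>x u. x \<ge> x0 \<Longrightarrow> u \<ge> 1 / (2 * \<bar>\<mu>\<bar>) * x \<Longrightarrow> f u \<le> C * f (x + \<mu>)"
    using f_dominated_shift[OF a] by metis
  have eC: "\<epsilon> / C > 0" using \<epsilon> C by simp
  show ?thesis
    using landau_o.smallD[OF o eC] lam_ge[of 1] lam_ge[of "x0 / \<gamma>"] eventually_ge_at_top[of 0]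
  proof eventually_elim
    case (elim t)
    have [measurable]: "N t \<in> measurable M (count_space UNIV)" using N_meas elim by simp
    show ?case
    proof (intro allI impI)
      fix x assume x: "\<gamma> * lam t \<le> x"
      have xx: "x \<ge> x0" using x elim(3) \<gamma> by (simp add: field_simps)
      let ?A = "{\<omega>\<in>space M. \<delta> * lam t < \<bar>real (N t \<omega>) - lam t\<bar> \<and> (real (N t \<omega>) < lam t \<and> x < 2 * \<bar>\<mu>\<bar> * lam t)}"
      show "measure M ?A \<le> \<epsilon> * (lam t * f (x + \<mu>))"
      proof (cases "x < 2 * \<bar>\<mu>\<bar> * lam t")
        case True
        have fl: "f (lam t) \<le> C * f (x + \<mu>)" using True \<mu> by (intro C(3) xx) (simp add: field_simps)
        have "measure M ?A \<le> measure M {\<omega>\<in>space M. real (N t \<omega>) \<le> (1 - \<delta>) * lam t}"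
        proof (rule M.finite_measure_mono)
          show "{\<omega>\<in>space M. real (N t \<omega>) \<le> (1 - \<delta>) * lam t} \<in> sets M" by measurable
        qed (auto simp: left_diff_distrib)
        also have "\<dots> \<le> \<epsilon> / C * (lam t * f (lam t))" using elim f_nonneg[of "lam t"] by simp
        also have "\<dots> \<le> \<epsilon> / C * (lam t * (C * f (x + \<mu>)))"
          using fl elim eC by (intro mult_left_mono) auto
        also have "\<dots> = \<epsilon> * (lam t * f (x + \<mu>))" using C by simp
        finally show ?thesis .
      next
        case False
        then have "measure M ?A = 0" by simp
        moreover have "0 \<le> \<epsilon> * (lam t * f (x + \<mu>))" using \<epsilon> elim f_nonneg by simp
        ultimately show ?thesis by linarith
      qed
    qed
  qed
qed

end

lemma powr_moment_le_2:
  fixes Z :: "'a \<Rightarrow> real"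
  assumes M: "finite_measure M" and Z: "Z \<in> borel_measurable M" and r: "r > 1"
    and int: "integrable M (\<lambda>\<omega>. max 0 (Z \<omega>) powr r)"
  shows "integrable M (\<lambda>\<omega>. max 0 (Z \<omega>) powr min r 2)"
proof -
  interpret finite_measure M by fact
  show ?thesis
  proof (rule Bochner_Integration.integrable_bound)
    show "integrable M (\<lambda>\<omega>. 1 + max 0 (Z \<omega>) powr r)" using int by simp
    show "(\<lambda>\<omega>. max 0 (Z \<omega>) powr min r 2) \<in> borel_measurable M" using Z by measurable
    have "u powr min r 2 \<le> 1 + u powr r" if "0 \<le> u" for u :: real
    proof (cases "u \<le> 1")
      case True
      then have "u powr min r 2 \<le> 1" using that r by (intro powr_le1) auto
      then show ?thesis by (simp add: add_increasing2)
    next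
      case False
      then have "u powr min r 2 \<le> u powr r" by (intro powr_mono) auto
      then show ?thesis by simp
    qed
    then show "AE \<omega> in M. norm (max 0 (Z \<omega>) powr min r 2) \<le> norm (1 + max 0 (Z \<omega>) powr r)"
      by (intro AE_I2) (simp add: abs_of_nonneg)
  qed
qed

section \<open>Both alternatives combined and passage to uniform asymptotics\<close>

theorem theorem3p1:
  fixes M :: "'a measure" and F :: "real measure"
    and X :: "nat \<Rightarrow> 'a \<Rightarrow> real" \<comment> \<open>\<open>X 0\<close> is the generic copy, \<open>X k\<close> with \<open>k \<ge> 1\<close> are the summands\<close>
    and N :: "real \<Rightarrow> 'a \<Rightarrow> nat"
    and T :: ereal and \<mu> :: real and lam :: "real \<Rightarrow> real"
  assumes T: "0 < T"
    and M: "prob_space M"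
    and X_iid: "iid M X F"
    and X_mean: "integrable M (X 0)" "\<mu> = (\<integral>\<omega>. X 0 \<omega> \<partial>M)"
    and N_counting: "counting_process M N"
    and N_indep: "independent_processes M X N"
    and N_mean: "\<And>t. 0 \<le> t \<Longrightarrow> integrable M (\<lambda>\<omega>. real (N t \<omega>))"
      "\<And>t. 0 \<le> t \<Longrightarrow> lam t = (\<integral>\<omega>. real (N t \<omega>) \<partial>M)"
    and N_mean_lim: "filterlim lam at_top at_top"
    and F_ad: "almost_decreasing (F_Delta F T)"
    and X_moment: "\<exists>r>1. integrable M (\<lambda>\<omega>. (X 0 \<omega> * indicator {0..} (X 0 \<omega>)) powr r)"
    and cond:
      "(\<mu> \<ge> 0 \<and>
        (\<exists>p::real. ereal p > \<bar>lower_Matuszewska_index (F_Delta F T)\<bar> \<and>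
          (\<forall>\<delta>>0.
            (\<forall>\<^sub>F t in at_top. integrable M
              (\<lambda>\<omega>. real (N t \<omega>) powr p * indicator {\<omega>. real (N t \<omega>) > (1 + \<delta>) * lam t} \<omega>)) \<and>
            (\<lambda>t. \<integral>\<omega>. real (N t \<omega>) powr p * indicator {\<omega>. real (N t \<omega>) > (1 + \<delta>) * lam t} \<omega> \<partial>M)
              \<in> O[at_top](lam))))
       \<or>
       (\<mu> < 0 \<and>
        (\<forall>\<delta>. 0 < \<delta> \<and> \<delta> < 1 \<longrightarrow>
          (\<lambda>t. measure M {\<omega>\<in>space M. real (N t \<omega>) \<le> (1 - \<delta>) * lam t})
            \<in> o[at_top](\<lambda>t. lam t * F_Delta F T (lam t))))"
  shows
    "(O_regularly_varying (F_Delta F T) \<longrightarrow>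
      (\<forall>\<gamma>>0.
        unif_lesssim (\<lambda>t. {\<gamma> * lam t..})
          (\<lambda>t x. (l_index (F_Delta F T))\<^sup>2 * ereal (lam t * F_Delta F T (x + \<mu>)))
          (\<lambda>t x. ereal (measure M
             {\<omega>\<in>space M. random_sum X N t \<omega> - \<mu> * lam t \<in> translate x (Delta T)})) \<and>
        unif_lesssim (\<lambda>t. {\<gamma> * lam t..})
          (\<lambda>t x. ereal (measure M
             {\<omega>\<in>space M. random_sum X N t \<omega> - \<mu> * lam t \<in> translate x (Delta T)}))
          (\<lambda>t x. (L_index (F_Delta F T))\<^sup>2 * ereal (lam t * F_Delta F T (x + \<mu>)))))
     \<and>
     (intermediate_regularly_varying (F_Delta F T) \<longrightarrow>
      (\<forall>\<gamma>>0.
        unif_sim (\<lambda>t. {\<gamma> * lam t..})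
          (\<lambda>t x. ereal (measure M
             {\<omega>\<in>space M. random_sum X N t \<omega> - \<mu> * lam t \<in> translate x (Delta T)}))
          (\<lambda>t x. ereal (lam t * F_Delta F T (x + \<mu>)))))"
proof -
  interpret M: prob_space M by (rule M)
  let ?f = "F_Delta F T"
  let ?Q = "\<lambda>t x. measure M {\<omega>\<in>space M. random_sum X N t \<omega> - \<mu> * lam t \<in> translate x (Delta T)}"
  let ?D = "\<lambda>\<gamma> t. {\<gamma> * lam t..}"
  have F: "distr M borel (X k) = F" for k using X_iid by (auto simp: iid_def)
  have rv[measurable]: "X k \<in> borel_measurable M" for k
    using X_iid by (auto simp: iid_def M.indep_vars_def)
  have sF: "sets F = sets borel" using F[of 0] by (metis sets_distr)
  have pF: "prob_space F" using F[of 0] rv[of 0] M.prob_space_distr by metis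
  obtain r0 where r0: "r0 > 1" "integrable M (\<lambda>\<omega>. (X 0 \<omega> * indicator {0..} (X 0 \<omega>)) powr r0)"
    using X_moment by blast
  define r where "r = min r0 2"
  have r: "1 < r" "r \<le> 2" using r0 by (auto simp: r_def)
  have "x * indicator {0..} x = max 0 x" for x :: real by (auto simp: indicator_def)
  with r0(2) have "integrable M (\<lambda>\<omega>. max 0 (X 0 \<omega>) powr r0)" by simp
  then have "integrable M (\<lambda>\<omega>. max 0 (X 0 \<omega>) powr r)"
    unfolding r_def by (intro powr_moment_le_2 r0) (auto intro: M.finite_measure_axioms)
  then have momF: "integrable F (\<lambda>x. max 0 x powr r)"
    using integrable_distr_eq[OF rv[of 0], of "\<lambda>x. max 0 x powr r"] unfolding F by simp
  have idF: "integrable F (\<lambda>x. x)"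
    using integrable_distr_eq[OF rv[of 0], of "\<lambda>x. x"] X_mean(1) unfolding F by simp
  have mF: "\<mu> = (\<integral>x. x \<partial>F)"
    using integral_distr[OF rv[of 0], of "\<lambda>x. x"] unfolding F X_mean(2) by simp
  have ereal_sq: "(ereal a)\<^sup>2 * ereal b = ereal (a\<^sup>2 * b)" for a b by (simp add: power2_eq_square)
  have ereal_div: "ereal a / ereal b = ereal (a / b)" if "b \<noteq> 0" for a b using that by simp
  have Nm: "N t \<in> measurable M (count_space UNIV)" if "0 \<le> t" for t
    using N_counting that by (simp add: counting_process_def)
  have main: "unif_lesssim (?D \<gamma>) (\<lambda>t x. (l_index ?f)\<^sup>2 * ereal (lam t * ?f (x + \<mu>))) (\<lambda>t x. ereal (?Q t x)) \<and>
      unif_lesssim (?D \<gamma>) (\<lambda>t x. ereal (?Q t x)) (\<lambda>t x. (L_index ?f)\<^sup>2 * ereal (lam t * ?f (x + \<mu>)))"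
    if OR: "O_regularly_varying ?f" and \<gamma>: "\<gamma> > 0" for \<gamma>
  proof -
    interpret R: random_index F T r \<mu> M N lam
      by (intro random_index.intro heavy_local.intro random_index_axioms.intro;
          fact pF sF idF mF r momF F_ad OR M Nm N_mean N_mean_lim)
    have Q_eq: "?Q t x = R.mixture_prob t x" if "0 \<le> t" for t x
    proof -
      have "{\<omega>\<in>space M. random_sum X N t \<omega> - \<mu> * lam t \<in> translate x (Delta T)}
        = {\<omega>\<in>space M. random_sum X N t \<omega> \<in> translate (x + \<mu> * lam t) (Delta T)}"
        by (auto simp: mem_translate_Delta algebra_simps)
      then show ?thesis
        using random_sum_mixture[OF M X_iid N_counting N_indep that translate_Delta_borel]
        by (simp add: R.mixture_prob_def R.iid_prob_def)
    qed
    \<comment> \<open>Extended division by zero would spoil the quotients in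
      \<open>unif_lesssim\<close>, so the denominators are shown to be positive on the whole
      region.\<close>
    have pos: "\<forall>\<^sub>F t in at_top. \<forall>x\<in>?D \<gamma> t. 0 < lam t * ?f (x + \<mu>)"
    proof -
      obtain x0 where x0: "\<And>x. x \<ge> x0 \<Longrightarrow> ?f x > 0"
        using R.eventually_pos unfolding eventually_positive_def eventually_at_top_linorder by blast
      show ?thesis
        using R.lam_ge[of 1] R.lam_ge[of "(x0 - \<mu>) / \<gamma>"]
      proof eventually_elim
        case (elim t)
        have "x0 - \<mu> \<le> \<gamma> * lam t" using elim \<gamma> by (simp add: field_simps)
        then show ?case using elim by (auto intro!: mult_pos_pos x0)
      qed
    qed
    \<comment> \<open>What the two alternatives have in common: concentration in mean, and a crude
      bound whose exceptional indices are negligible.\<close>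
    have bounds: "(\<forall>\<epsilon>>0. \<forall>\<^sub>F t in at_top. R.abs_dev t \<le> \<epsilon> * lam t) \<and>
      (\<exists>C\<ge>0. \<exists>B. (\<forall>\<^sub>F t in at_top. \<forall>x\<ge>\<gamma> * lam t. \<forall>n. R.iid_prob n (x + \<mu> * lam t) \<le> C * real n * ?f (x + \<mu>) + of_bool (B t x n)) \<and>
        (\<forall>\<delta> \<epsilon>. 0 < \<delta> \<longrightarrow> \<delta> < 1 \<longrightarrow> \<epsilon> > 0 \<longrightarrow> (\<forall>\<^sub>F t in at_top. \<forall>x\<ge>\<gamma> * lam t.
          R.far_prob \<delta> t (B t x) \<le> \<epsilon> * (lam t * ?f (x + \<mu>)))))"
      using cond
    proof
      assume "\<mu> \<ge> 0 \<and> (\<exists>p::real. ereal p > \<bar>lower_Matuszewska_index ?f\<bar> \<and>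
        (\<forall>\<delta>>0. (\<forall>\<^sub>F t in at_top. integrable M (R.tail_power p \<delta> t)) \<and>
          (\<lambda>t. integral\<^sup>L M (R.tail_power p \<delta> t)) \<in> O[at_top](lam)))"
      then obtain p :: real where \<mu>: "\<mu> \<ge> 0" and p: "\<bar>lower_Matuszewska_index ?f\<bar> < ereal p"
        and int: "\<And>\<delta>. \<delta> > 0 \<Longrightarrow> \<forall>\<^sub>F t in at_top. integrable M (R.tail_power p \<delta> t)"
        and O: "\<And>\<delta>. \<delta> > 0 \<Longrightarrow> (\<lambda>t. integral\<^sup>L M (R.tail_power p \<delta> t)) \<in> O[at_top](lam)"
        by blast
      obtain s c0 x2 where s: "0 \<le> s" "s < p" "c0 > 0" "x2 > 0" "\<And>x. x \<ge> x2 \<Longrightarrow> c0 * x powr (-s) \<le> ?f x"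
        using lower_Matuszewska_power_bound[OF OR F_ad p] by metis
      have "r \<le> s" by (rule R.power_bound_exponent[OF s(3,5)])
      then have p1: "p > 1" using r s by simp
      obtain C b x0 where C: "C > 0" "b > 0" "x0 > 0" "\<And>x m n. x \<ge> x0 \<Longrightarrow> x \<ge> \<gamma> * m \<Longrightarrow> 0 \<le> m \<Longrightarrow>
          R.iid_prob n (x + \<mu> * m) \<le> C * real n * ?f (x + \<mu>) + of_bool (m < real n \<and> b * x < real n)"
        by (rule R.iid_prob_crude_nonneg_mean[OF \<mu> \<gamma>]) (rule that)
      let ?B = "\<lambda>t x n. lam t < real n \<and> b * x < real n"
      have "\<forall>\<^sub>F t in at_top. \<forall>x\<ge>\<gamma> * lam t. \<forall>n. R.iid_prob n (x + \<mu> * lam t) \<le> C * real n * ?f (x + \<mu>) + of_bool (?B t x n)"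
        using R.lam_ge[of 0] R.lam_ge[of "x0 / \<gamma>"]
      proof eventually_elim
        case (elim t)
        have "x0 \<le> \<gamma> * lam t" using elim \<gamma> by (simp add: field_simps)
        then show ?case using C(4) elim by auto
      qed
      moreover have "\<forall>\<^sub>F t in at_top. \<forall>x\<ge>\<gamma> * lam t.
          R.far_prob \<delta> t (?B t x) \<le> \<epsilon> * (lam t * ?f (x + \<mu>))"
        if "0 < \<delta>" "\<epsilon> > 0" for \<delta> \<epsilon>
        by (rule R.remainder_nonneg_mean[OF \<gamma> C(2) s(2,1,3,5) int O]) (use that in auto)
      moreover have "\<forall>\<epsilon>>0. \<forall>\<^sub>F t in at_top. R.abs_dev t \<le> \<epsilon> * lam t"
        using R.L1_upper_tail[OF p1 int O] by blast
      ultimately show ?thesis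
        by (intro conjI exI[of _ C] exI[of _ ?B]) (use C(1) in auto)
    next
      assume "\<mu> < 0 \<and>
        (\<forall>\<delta>. 0 < \<delta> \<and> \<delta> < 1 \<longrightarrow>
          (\<lambda>t. measure M {\<omega>\<in>space M. real (N t \<omega>) \<le> (1 - \<delta>) * lam t})
            \<in> o[at_top](\<lambda>t. lam t * ?f (lam t)))"
      then have \<mu>: "\<mu> < 0" and o: "\<And>\<delta>. 0 < \<delta> \<Longrightarrow> \<delta> < 1 \<Longrightarrow>
          (\<lambda>t. measure M {\<omega>\<in>space M. real (N t \<omega>) \<le> (1 - \<delta>) * lam t}) \<in> o[at_top](\<lambda>t. lam t * ?f (lam t))"
        by auto
      obtain C x0 where C: "C > 0" "x0 > 0" "\<And>x m n. x \<ge> x0 \<Longrightarrow> x \<ge> \<gamma> * m \<Longrightarrow> 0 \<le> m \<Longrightarrow>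
          R.iid_prob n (x + \<mu> * m) \<le> C * real n * ?f (x + \<mu>) + of_bool (real n < m \<and> x < 2 * \<bar>\<mu>\<bar> * m)"
        by (rule R.iid_prob_crude_neg_mean[OF \<mu> \<gamma>]) (rule that)
      let ?B = "\<lambda>t x n. real n < lam t \<and> x < 2 * \<bar>\<mu>\<bar> * lam t"
      have "\<forall>\<^sub>F t in at_top. \<forall>x\<ge>\<gamma> * lam t. \<forall>n. R.iid_prob n (x + \<mu> * lam t) \<le> C * real n * ?f (x + \<mu>) + of_bool (?B t x n)"
        using R.lam_ge[of 0] R.lam_ge[of "x0 / \<gamma>"]
      proof eventually_elim
        case (elim t)
        have "x0 \<le> \<gamma> * lam t" using elim \<gamma> by (simp add: field_simps)
        then show ?case using C(3) elim by auto
      qed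
      moreover have "\<forall>\<^sub>F t in at_top. \<forall>x\<ge>\<gamma> * lam t.
          R.far_prob \<delta> t (?B t x) \<le> \<epsilon> * (lam t * ?f (x + \<mu>))"
        if "0 < \<delta>" "\<delta> < 1" "\<epsilon> > 0" for \<delta> \<epsilon>
        by (rule R.remainder_neg_mean[OF \<gamma> \<mu> that(1,2) o[OF that(1,2)] that(3)])
      moreover have "\<forall>\<epsilon>>0. \<forall>\<^sub>F t in at_top. R.abs_dev t \<le> \<epsilon> * lam t"
        using R.L1_lower_tail[OF o] by blast
      ultimately show ?thesis
        by (intro conjI exI[of _ C] exI[of _ ?B]) (use C(1) in auto)
    qed
    then have L1: "\<And>\<epsilon>. \<epsilon> > 0 \<Longrightarrow> \<forall>\<^sub>F t in at_top. R.abs_dev t \<le> \<epsilon> * lam t" by blast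
    from bounds obtain C B where C: "C \<ge> 0"
      and crude: "\<forall>\<^sub>F t in at_top. \<forall>x\<ge>\<gamma> * lam t. \<forall>n. R.iid_prob n (x + \<mu> * lam t) \<le> C * real n * ?f (x + \<mu>) + of_bool (B t x n)"
      and rem: "\<And>\<delta> \<epsilon>. 0 < \<delta> \<Longrightarrow> \<delta> < 1 \<Longrightarrow> \<epsilon> > 0 \<Longrightarrow> \<forall>\<^sub>F t in at_top. \<forall>x\<ge>\<gamma> * lam t.
          R.far_prob \<delta> t (B t x) \<le> \<epsilon> * (lam t * ?f (x + \<mu>))"
      by blast
    obtain L where L: "L_index ?f = ereal L" "L \<ge> 1" using O_regularly_varying_L_index[OF OR F_ad] by blast
    obtain l where l: "l_index ?f = ereal l" "0 < l" using O_regularly_varying_l_index[OF OR F_ad] by blast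
    show ?thesis
    proof
      show "unif_lesssim (?D \<gamma>) (\<lambda>t x. ereal (?Q t x)) (\<lambda>t x. (L_index ?f)\<^sup>2 * ereal (lam t * ?f (x + \<mu>)))"
      proof (rule unif_lesssimI)
        fix k :: real assume k: "1 < k"
        \<comment> \<open>\<open>K\<^sup>2\<close> takes half of the excess of \<open>k\<close> over
          1 and the error term below the other half, so that together they make
          \<open>L\<^sup>2 * k\<close>.\<close>
        define K where "K = L * sqrt ((k + 1) / 2)"
        have "1 < sqrt ((k + 1) / 2)" using k by simp
        then have KL: "L_index ?f < ereal K" using L by (simp add: K_def)
        define \<epsilon> where "\<epsilon> = L\<^sup>2 * ((k - 1) / 2)"
        have \<epsilon>: "\<epsilon> > 0" unfolding \<epsilon>_def using L k by (intro mult_pos_pos) auto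
        have K2: "K\<^sup>2 + \<epsilon> = L\<^sup>2 * k" using k by (simp add: K_def \<epsilon>_def power_mult_distrib field_simps)
        have "\<forall>\<^sub>F t in at_top. \<forall>x\<ge>\<gamma> * lam t. R.mixture_prob t x \<le> (K\<^sup>2 + \<epsilon>) * (lam t * ?f (x + \<mu>))"
          by (rule R.mixture_prob_upper[OF \<gamma> KL C L1 crude rem \<epsilon>])
        then show "\<forall>\<^sub>F t in at_top. \<forall>x\<in>?D \<gamma> t. ereal (?Q t x) / ((L_index ?f)\<^sup>2 * ereal (lam t * ?f (x + \<mu>))) \<le> ereal k"
          using pos eventually_ge_at_top[of 0]
        proof eventually_elim
          case (elim t)
          show ?case
          proof
            fix x assume x: "x \<in> ?D \<gamma> t"
            let ?v = "lam t * ?f (x + \<mu>)"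
            have v: "?v > 0" using elim(2) x by blast
            have "?Q t x \<le> k * (L\<^sup>2 * ?v)" using elim(1,3) x K2 by (simp add: Q_eq mult_ac)
            moreover have "L\<^sup>2 * ?v > 0" by (rule mult_pos_pos[OF _ v]) (use L in simp)
            ultimately have "?Q t x / (L\<^sup>2 * ?v) \<le> k" by (simp only: pos_divide_le_eq)
            then have "ereal (?Q t x / (L\<^sup>2 * ?v)) \<le> ereal k" by (simp only: ereal_less_eq)
            moreover have "ereal (?Q t x) / ((L_index ?f)\<^sup>2 * ereal ?v) = ereal (?Q t x / (L\<^sup>2 * ?v))"
              unfolding L(1) ereal_sq by (rule ereal_div) (rule less_imp_neq[OF \<open>L\<^sup>2 * ?v > 0\<close>, symmetric])
            ultimately show "ereal (?Q t x) / ((L_index ?f)\<^sup>2 * ereal ?v) \<le> ereal k" by (simp only:)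
          qed
        qed
      qed
      show "unif_lesssim (?D \<gamma>) (\<lambda>t x. (l_index ?f)\<^sup>2 * ereal (lam t * ?f (x + \<mu>))) (\<lambda>t x. ereal (?Q t x))"
      proof (rule unif_lesssimI)
        fix k :: real assume k: "1 < k"
        \<comment> \<open>The deficit from \<open>l\<^sup>2\<close> to \<open>l\<^sup>2 / k\<close>
          is split evenly between \<open>K\<^sup>2\<close> and the error term.\<close>
        define K where "K = l * sqrt ((1 + 1 / k) / 2)"
        have "sqrt ((1 + 1 / k) / 2) < 1" "0 < sqrt ((1 + 1 / k) / 2)"
          using k by (auto simp: real_sqrt_lt_1_iff field_simps add_pos_pos)
        then have Kl: "ereal K < l_index ?f" "0 < K" using l by (auto simp: K_def)
        define \<epsilon> where "\<epsilon> = l\<^sup>2 * ((1 - 1 / k) / 2)"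
        have \<epsilon>: "\<epsilon> > 0" unfolding \<epsilon>_def using l k by (intro mult_pos_pos) auto
        have "(sqrt ((1 + 1 / k) / 2))\<^sup>2 = (1 + 1 / k) / 2" using k by (intro real_sqrt_pow2) auto
        then have K2: "K\<^sup>2 - \<epsilon> = l\<^sup>2 / k" using k by (simp add: K_def \<epsilon>_def power_mult_distrib field_simps)
        have "\<forall>\<^sub>F t in at_top. \<forall>x\<ge>\<gamma> * lam t. (K\<^sup>2 - \<epsilon>) * (lam t * ?f (x + \<mu>)) \<le> R.mixture_prob t x"
          by (rule R.mixture_prob_lower[OF \<gamma> Kl L1 \<epsilon>])
        then show "\<forall>\<^sub>F t in at_top. \<forall>x\<in>?D \<gamma> t. (l_index ?f)\<^sup>2 * ereal (lam t * ?f (x + \<mu>)) / ereal (?Q t x) \<le> ereal k"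
          using pos eventually_ge_at_top[of 0]
        proof eventually_elim
          case (elim t)
          show ?case
          proof
            fix x assume x: "x \<in> ?D \<gamma> t"
            let ?v = "lam t * ?f (x + \<mu>)"
            have v: "?v > 0" using elim(2) x by blast
            have le: "l\<^sup>2 / k * ?v \<le> ?Q t x" using elim(1,3) x K2 by (simp add: Q_eq)
            have "0 < l\<^sup>2 / k * ?v" by (rule mult_pos_pos[OF _ v]) (use l k in simp)
            \<comment> \<open>The lower bound itself shows that the denominator is positive.\<close>
            then have Q0: "0 < ?Q t x" using le by linarith
            have "k * (l\<^sup>2 / k * ?v) \<le> k * ?Q t x" using le k by (intro mult_left_mono) auto
            then have "l\<^sup>2 * ?v \<le> k * ?Q t x" using k by simp
            then have "l\<^sup>2 * ?v / ?Q t x \<le> k" using Q0 by (simp only: pos_divide_le_eq)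
            then have "ereal (l\<^sup>2 * ?v / ?Q t x) \<le> ereal k" by (simp only: ereal_less_eq)
            moreover have "(l_index ?f)\<^sup>2 * ereal ?v / ereal (?Q t x) = ereal (l\<^sup>2 * ?v / ?Q t x)"
              unfolding l(1) ereal_sq by (rule ereal_div) (rule less_imp_neq[OF Q0, symmetric])
            ultimately show "(l_index ?f)\<^sup>2 * ereal ?v / ereal (?Q t x) \<le> ereal k" by (simp only:)
          qed
        qed
      qed
    qed
  qed
  show ?thesis
  proof (intro conjI impI allI)
    fix \<gamma> :: real assume IR: "intermediate_regularly_varying ?f" and \<gamma>: "0 < \<gamma>"
    have fm: "?f \<in> borel_measurable borel" by (rule F_Delta_borel_measurable[OF pF sF T])
    show "unif_sim (?D \<gamma>) (\<lambda>t x. ereal (?Q t x)) (\<lambda>t x. ereal (lam t * ?f (x + \<mu>)))"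
      using main[OF intermediate_imp_O_regularly_varying[OF IR fm F_ad] \<gamma>]
      by (simp add: unif_sim_def intermediate_regularly_varying_index[OF IR fm])
  qed (use main in blast)+
qed

end
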